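(* For all integers $k\ge2$ we have $\alpha_k\ge\beta_k/(1-\beta_k)$.
   Context: For $k\ge2$, $\alpha_k$ is the supremum of all real $\alpha$ such that for almost every $n\in\mathbb{N}$ (exceptions $n\le X$ number $o(X)$), $n$ has $k$ divisors $d_1<\cdots<d_k$ with $d_k\le d_1(1+(\log n)^{-\alpha})$. A logarithmic random set is a random $\mathbf{A}\subseteq\mathbb{N}$ with each $i$ included independently with probability $1/i$. $\beta_k$ is the supremum of all $c<1$ such that, with probability tending to $1$ as $D\to\infty$, there exist distinct $A_1,\dots,A_k\subseteq\mathbf{A}\cap[D^c,D]$ with $\sum_{a\in A_1}a=\cdots=\sum_{a\in A_k}a$. *)

theory Defs
  imports "HOL-Probability.Probability" "HOL-Library.Landau_Symbols"
begin

definition almost_every :: "(nat \<Rightarrow> bool) \<Rightarrow> bool" where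
  "almost_every P \<longleftrightarrow>
     (\<lambda>X::real. real (card {n::nat. 0 < n \<and> real n \<le> X \<and> \<not> P n})) \<in> o[at_top](\<lambda>X. X)"

definition has_close_divisors :: "nat \<Rightarrow> real \<Rightarrow> nat \<Rightarrow> bool" where
  "has_close_divisors k \<alpha> n \<longleftrightarrow>
     (\<exists>d :: nat \<Rightarrow> nat. strict_mono_on {1..k} d \<and> (\<forall>i\<in>{1..k}. d i dvd n) \<and>
        real (d k) \<le> real (d 1) * (1 + ln (real n) powr (- \<alpha>)))"

text \<open>Both suprema are taken in the extended reals, so that neither boundedness of the first set
  nor the strict inequality \<open>\<beta>\<^sub>k < 1\<close> is built into the definitions.\<close>

definition alpha :: "nat \<Rightarrow> ereal" where
  "alpha k = (SUP \<alpha>\<in>{\<alpha>::real. almost_every (has_close_divisors k \<alpha>)}. ereal \<alpha>)"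

text \<open>The logarithmic random set is realised on the canonical product space of independent
  Bernoulli variables of parameter \<open>1/i\<close>, indexed by the positive integers \<open>i\<close>.\<close>

definition log_random_space :: "(nat \<Rightarrow> bool) measure" where
  "log_random_space = (\<Pi>\<^sub>M i\<in>{1..}. measure_pmf (bernoulli_pmf (1 / real i)))"

definition log_random_set :: "(nat \<Rightarrow> bool) \<Rightarrow> nat set" where
  "log_random_set \<omega> = {i\<in>{1..}. \<omega> i}"

definition has_equal_subset_sums :: "nat \<Rightarrow> nat set \<Rightarrow> bool" where
  "has_equal_subset_sums k B \<longleftrightarrow>
     (\<exists>S :: nat \<Rightarrow> nat set. inj_on S {1..k} \<and> (\<forall>i\<in>{1..k}. S i \<subseteq> B) \<and>
        (\<forall>i\<in>{1..k}. \<forall>j\<in>{1..k}. \<Sum>(S i) = \<Sum>(S j)))"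

definition equal_sums_event :: "nat \<Rightarrow> real \<Rightarrow> real \<Rightarrow> (nat \<Rightarrow> bool) set" where
  "equal_sums_event k c D = {\<omega> \<in> space log_random_space.
     has_equal_subset_sums k {a \<in> log_random_set \<omega>. D powr c \<le> real a \<and> real a \<le> D}}"

definition beta :: "nat \<Rightarrow> ereal" where
  "beta k = (SUP c\<in>{c::real. c < 1 \<and>
     ((\<lambda>D::real. measure log_random_space (equal_sums_event k c D)) \<longlongrightarrow> 1) at_top}. ereal c)"

lemma prob_space_log_random_space: "prob_space log_random_space"
  unfolding log_random_space_def by (intro prob_space_PiM prob_space_measure_pmf)

lemma mem_log_random_set_measurable:
  assumes "i \<ge> 1"
  shows "{\<omega> \<in> space log_random_space. i \<in> log_random_set \<omega>} \<in> sets log_random_space"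
proof -
  have "(\<lambda>\<omega>. \<omega> i) \<in> measurable log_random_space (measure_pmf (bernoulli_pmf (1 / real i)))"
    unfolding log_random_space_def using assms by (intro measurable_component_singleton) auto
  from measurable_sets[OF this, of "{True}"] assms show ?thesis
    by (auto simp: log_random_set_def vimage_def Int_def conj_commute)
qed

lemma prob_mem_log_random_set:
  assumes "i \<ge> 1"
  shows "measure log_random_space {\<omega> \<in> space log_random_space. i \<in> log_random_set \<omega>} = 1 / real i"
proof -
  interpret product_prob_space "\<lambda>i. measure_pmf (bernoulli_pmf (1 / real i))" "{1..}"
    by unfold_locales
  have "measure log_random_space {\<omega> \<in> space log_random_space. i \<in> log_random_set \<omega>} =
        measure (distr log_random_space (measure_pmf (bernoulli_pmf (1 / real i))) (\<lambda>\<omega>. \<omega> i)) {True}"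
    unfolding log_random_space_def using assms
    by (subst measure_distr)
       (auto intro!: arg_cong2[where f = measure] measurable_component_singleton simp: log_random_set_def)
  also have "\<dots> = 1 / real i"
    unfolding log_random_space_def using assms
    by (subst PiM_component) (auto simp: measure_pmf_single)
  finally show ?thesis .
qed

lemma indep_events_log_random_set:
  "prob_space.indep_events log_random_space
     (\<lambda>i. {\<omega> \<in> space log_random_space. i \<in> log_random_set \<omega>}) {1..}"
proof -
  interpret P: product_prob_space "\<lambda>i. measure_pmf (bernoulli_pmf (1 / real i))" "{1..}"
    by unfold_locales
  interpret Q: prob_space log_random_space by (rule prob_space_log_random_space)
  show ?thesis
  proof (rule Q.indep_eventsI)
    fix i :: nat assume "i \<in> {1..}"
    then show "{\<omega> \<in> space log_random_space. i \<in> log_random_set \<omega>} \<in> Q.events"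
      by (intro mem_log_random_set_measurable) auto
  next
    fix J :: "nat set" assume J: "J \<subseteq> {1..}" "finite J" "J \<noteq> {}"
    have "Q.prob (\<Inter>j\<in>J. {\<omega> \<in> space log_random_space. j \<in> log_random_set \<omega>}) =
      measure (PiM {1..} (\<lambda>i. measure_pmf (bernoulli_pmf (1 / real i))))
        (prod_emb {1..} (\<lambda>i. measure_pmf (bernoulli_pmf (1 / real i))) J (\<Pi>\<^sub>E j\<in>J. {True}))"
    proof (intro arg_cong2[where f = measure])
      have "prod_emb {1..} (\<lambda>i. measure_pmf (bernoulli_pmf (1 / real i))) J (\<Pi>\<^sub>E j\<in>J. {True}) =
          (\<Pi>\<^sub>E i\<in>{1..}. if i \<in> J then {True} else UNIV)"
        using J by (subst prod_emb_PiE) (auto intro!: PiE_cong)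
      also have "\<dots> = (\<Inter>j\<in>J. {\<omega> \<in> space log_random_space. j \<in> log_random_set \<omega>})"
        unfolding log_random_space_def log_random_set_def space_PiM set_eq_iff INT_iff mem_Collect_eq PiE_iff
        using J by (fastforce split: if_splits)
      finally show "(\<Inter>j\<in>J. {\<omega> \<in> space log_random_space. j \<in> log_random_set \<omega>}) =
          prod_emb {1..} (\<lambda>i. measure_pmf (bernoulli_pmf (1 / real i))) J (\<Pi>\<^sub>E j\<in>J. {True})" ..
    qed (simp add: log_random_space_def)
    also have "\<dots> = (\<Prod>j\<in>J. measure (measure_pmf (bernoulli_pmf (1 / real j))) {True})"
      using J by (intro P.measure_PiM_emb) auto
    also have "\<dots> = (\<Prod>j\<in>J. Q.prob {\<omega> \<in> space log_random_space. j \<in> log_random_set \<omega>})"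
      using J by (intro prod.cong refl, subst prob_mem_log_random_set) (auto simp: measure_pmf_single)
    finally show "Q.prob (\<Inter>j\<in>J. {\<omega> \<in> space log_random_space. j \<in> log_random_set \<omega>}) =
      (\<Prod>j\<in>J. Q.prob {\<omega> \<in> space log_random_space. j \<in> log_random_set \<omega>})" .
  qed
qed

lemma equal_sums_event_measurable: "equal_sums_event k c D \<in> sets log_random_space"
proof -
  define I where "I = {a::nat. 1 \<le> a \<and> D powr c \<le> real a \<and> real a \<le> D}"
  have "I \<subseteq> {..nat \<lfloor>D\<rfloor>}" unfolding I_def by (auto simp: le_nat_floor)
  then have fin: "finite I" by (rule finite_subset) simp
  have restrict: "{a \<in> log_random_set \<omega>. D powr c \<le> real a \<and> real a \<le> D} = log_random_set \<omega> \<inter> I" for \<omega>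
    by (auto simp: I_def log_random_set_def)
  have "equal_sums_event k c D = (\<Union>T\<in>{T. T \<subseteq> I \<and> has_equal_subset_sums k T}.
      {\<omega> \<in> space log_random_space. \<forall>i\<in>I. i \<in> log_random_set \<omega> \<longleftrightarrow> i \<in> T})"
    unfolding equal_sums_event_def restrict
  proof (intro equalityI subsetI)
    fix \<omega> assume "\<omega> \<in> {\<omega> \<in> space log_random_space. has_equal_subset_sums k (log_random_set \<omega> \<inter> I)}"
    then show "\<omega> \<in> (\<Union>T\<in>{T. T \<subseteq> I \<and> has_equal_subset_sums k T}.
      {\<omega> \<in> space log_random_space. \<forall>i\<in>I. i \<in> log_random_set \<omega> \<longleftrightarrow> i \<in> T})"
      by (intro UN_I[of "log_random_set \<omega> \<inter> I"]) auto
  next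
    fix \<omega> assume "\<omega> \<in> (\<Union>T\<in>{T. T \<subseteq> I \<and> has_equal_subset_sums k T}.
      {\<omega> \<in> space log_random_space. \<forall>i\<in>I. i \<in> log_random_set \<omega> \<longleftrightarrow> i \<in> T})"
    then obtain T where T: "T \<subseteq> I" "has_equal_subset_sums k T" "\<omega> \<in> space log_random_space"
      "\<forall>i\<in>I. i \<in> log_random_set \<omega> \<longleftrightarrow> i \<in> T" by blast
    then have "log_random_set \<omega> \<inter> I = T" by blast
    with T show "\<omega> \<in> {\<omega> \<in> space log_random_space. has_equal_subset_sums k (log_random_set \<omega> \<inter> I)}"
      by simp
  qed
  also have "\<dots> \<in> sets log_random_space"
  proof (rule sets.finite_UN)
    show "finite {T. T \<subseteq> I \<and> has_equal_subset_sums k T}"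
      using fin by simp
    fix T
    have *: "{\<omega> \<in> space log_random_space. i \<in> log_random_set \<omega> \<longleftrightarrow> i \<in> T} \<in> sets log_random_space"
      if "i \<in> I" for i
    proof (cases "i \<in> T")
      case True
      then show ?thesis using that mem_log_random_set_measurable[of i] by (simp add: I_def)
    next
      case False
      then show ?thesis using that sets.sets_Collect_neg[OF mem_log_random_set_measurable[of i]]
        by (simp add: I_def)
    qed
    show "{\<omega> \<in> space log_random_space. \<forall>i\<in>I. i \<in> log_random_set \<omega> \<longleftrightarrow> i \<in> T} \<in> sets log_random_space"
      by (rule sets.sets_Collect_finite_All[OF * fin])
  qed
  finally show ?thesis .
qed

end

theory Submission
  imports Defs "HOL-Complex_Analysis.Complex_Analysis" "HOL-Real_Asymp.Real_Asymp"
begin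

text \<open>
  Write \<open>L = ln X\<close> and cut the primes between \<open>exp (L powr \<eta>)\<close> and \<open>exp (L powr (1 - \<epsilon>))\<close> into blocks
  \<open>i \<delta> < ln p < (i + 1) \<delta>\<close> with \<open>\<delta> = L powr (- \<alpha> - \<epsilon>)\<close>. A random \<open>n \<le> X\<close> has a prime factor in the
  \<open>i\<close>-th block with probability close to \<open>1 / i\<close>, almost independently for different \<open>i\<close>, so the
  blocks hit by \<open>n\<close> behave like a logarithmic random set on \<open>[D powr c, D]\<close>, \<open>D = L powr (1 + \<alpha>)\<close>.
  Equal subset sums of block indices become products of prime factors of \<open>n\<close> whose logarithms differ
  by at most \<open>\<delta>\<close> times the number of factors. The blocks lie above \<open>exp (L powr \<eta>)\<close> with \<open>\<eta> > 0\<close>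
  for small \<open>\<epsilon>\<close> exactly when \<open>\<alpha> < c / (1 - c)\<close>.

  Two inputs are needed. The prime number theorem with an arbitrary power of the logarithm saved
  gives the primes in the blocks: \<open>\<zeta>\<close> has no zeros within \<open>c \<bar>t\<bar> powr (- \<epsilon>)\<close> of the line \<open>Re s = 1\<close>,
  hence all derivatives of \<open>\<Sum>\<^sub>p ln p / p powr s - \<zeta> s\<close> are \<open>O(\<bar>t\<bar> powr (1/2))\<close> there, and
  \<open>K\<close> derivatives save \<open>K\<close> powers of the logarithm after Fourier inversion against a Fejer kernel.
  Since the primes used are at most \<open>exp (o(L))\<close>, Brun's pure sieve gives the independence.
\<close>

section \<open>The zeta function to the right of and near the line \<open>Re s = 1\<close>\<close>

text \<open>The lowest block has index about L^((1 + \<alpha>) c), hence position a = L^\<eta> on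
  the logarithmic scale with \<eta> = (1 + \<alpha>) c - \<alpha> - \<epsilon>, and its width is
  \<delta> = a^(-B) with B = (\<alpha> + \<epsilon>) / \<eta>. As \<alpha> approaches c / (1 - c), B
  is unbounded, so no fixed saving in the prime number theorem is enough. Having equal subset sums
  is a monotone event, so lower bounds for the primes in each block suffice. The margin \<epsilon>
  is spent twice: in \<delta>, so that r = O(L^(\<epsilon>/2)) prime factors together shift a
  logarithm by less than L^(-\<alpha>), and at the top of the range, so that a sieve remainder of
  size exp(O(r L^(1 - \<epsilon>))) is o(N). The truncation error exp(3 \<Lambda>) / 2^r of the
  sieve vanishes because the sum \<Lambda> of the reciprocals of the primes used is O(ln L). Nothing
  in the definitions makes \<open>beta k\<close> positive, so \<open>alpha k\<close> \<ge> 0 is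
  proved separately, from negative exponents.\<close>

definition cpow :: "real \<Rightarrow> complex \<Rightarrow> complex" where
  "cpow x s = exp (- s * of_real (ln x))"

lemma norm_cpow: "x > 0 \<Longrightarrow> norm (cpow x s) = x powr (- Re s)"
  by (simp add: cpow_def powr_def)

lemma cpow_1 [simp]: "cpow 1 s = 1"
  by (simp add: cpow_def)

lemma cpow_mult: "x > 0 \<Longrightarrow> y > 0 \<Longrightarrow> cpow (x * y) s = cpow x s * cpow y s"
  by (simp add: cpow_def ln_mult algebra_simps exp_add flip: exp_minus)
     (simp add: exp_diff exp_minus field_simps)

lemma holomorphic_cpow [holomorphic_intros]:
  "f holomorphic_on A \<Longrightarrow> (\<lambda>s. cpow x (f s)) holomorphic_on A"
  unfolding cpow_def by (intro holomorphic_intros)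

lemma deriv_cpow:
  "((\<lambda>s. cpow x s) has_field_derivative - of_real (ln x) * cpow x s) (at s)"
  unfolding cpow_def by (auto intro!: derivative_eq_intros)

lemma cpow_has_vector_derivative:
  assumes "x > 0"
  shows "((\<lambda>x. cpow x s) has_vector_derivative (- s / of_real x * cpow x s)) (at x within A)"
proof -
  have "((\<lambda>x. - s * of_real (ln x)) has_vector_derivative (- s * of_real (inverse x))) (at x within A)"
    using assms by (auto intro!: derivative_eq_intros simp: divide_inverse)
  from field_vector_diff_chain_within[OF this, of exp "exp (- s * of_real (ln x))"]
  have "((\<lambda>x. cpow x s) has_vector_derivative (- s * of_real (inverse x) * exp (- s * of_real (ln x)))) (at x within A)"
    by (simp add: cpow_def o_def has_field_derivative_at_within)
  also have "- s * of_real (inverse x) * exp (- s * of_real (ln x)) = - s / of_real x * cpow x s"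
    by (simp add: cpow_def field_simps)
  finally show ?thesis .
qed

lemma onorm_scaleR_le:
  fixes c :: "'a :: real_normed_vector"
  assumes "norm c \<le> B"
  shows "onorm (\<lambda>h::real. h *\<^sub>R c) \<le> B"
proof (rule onorm_le)
  fix h :: real
  show "norm (h *\<^sub>R c) \<le> B * norm h"
    using mult_left_mono[OF assms, of "\<bar>h\<bar>"] by (simp add: mult.commute)
qed

lemma exp_of_real_ln [simp]: "x > 0 \<Longrightarrow> exp (complex_of_real (ln x)) = of_real x"
  by (simp add: exp_of_real)

lemma cpow_diff_bound:
  assumes n: "n \<ge> 1" and x: "x \<in> {n..n+1}" and s: "Re s \<ge> -1"
  shows "norm (cpow x s - cpow n s) \<le> norm s * n powr (- Re s - 1)"
proof -
  have "norm (cpow x s - cpow n s) \<le> (norm s * n powr (- Re s - 1)) * norm (x - n)"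
  proof (rule differentiable_bound[of "{n..n+1}" "\<lambda>x. cpow x s" "\<lambda>x h. h *\<^sub>R (- s / of_real x * cpow x s)"])
    fix y assume y: "y \<in> {n..n+1}"
    then show "((\<lambda>x. cpow x s) has_derivative (\<lambda>h. h *\<^sub>R (- s / of_real y * cpow y s))) (at y within {n..n+1})"
      using cpow_has_vector_derivative[of y s "{n..n+1}"] n by (auto simp: has_vector_derivative_def)
    have "norm (- s / of_real y * cpow y s) = norm s * y powr (- Re s - 1)"
      using n y by (simp add: norm_mult norm_divide norm_cpow powr_diff)
    also have "\<dots> \<le> norm s * n powr (- Re s - 1)"
      using n y s by (intro mult_left_mono powr_mono2') auto
    finally show "onorm (\<lambda>h. h *\<^sub>R (- s / of_real y * cpow y s)) \<le> norm s * n powr (- Re s - 1)"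
      by (rule onorm_scaleR_le)
  qed (use n x in auto)
  also have "\<dots> \<le> (norm s * n powr (- Re s - 1)) * 1"
    using x by (intro mult_left_mono) auto
  finally show ?thesis by simp
qed

text \<open>The trivial bound 2 n^(-Re s) and the mean value bound |s| n^(-Re s - 1) are
  interpolated with weights 1 - \<theta> and \<theta>. A small \<theta> keeps the growth in |s| low
  at the price of weaker decay in n: \<theta> = 1 serves for holomorphy, \<theta> = 2e for the
  growth near Re s = 1.\<close>

lemma cpow_diff_bound':
  assumes n: "n \<ge> 1" and x: "x \<in> {n..n+1}" and s: "Re s \<ge> 0" and \<theta>: "0 \<le> \<theta>" "\<theta> \<le> 1"
  shows "norm (cpow x s - cpow n s) \<le> 2 * norm s powr \<theta> * n powr (- Re s - \<theta>)"
proof (cases "s = 0")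
  case True
  then show ?thesis by (simp add: cpow_def)
next
  case False
  define A where "A = norm (cpow x s - cpow n s)"
  show ?thesis
  proof (cases "A = 0")
    case True
    then show ?thesis unfolding A_def by simp
  next
    case A0: False
    have "norm (cpow x s - cpow n s) \<le> norm (cpow x s) + norm (cpow n s)"
      by (rule norm_triangle_ineq4)
    also have "\<dots> \<le> 2 * n powr (- Re s)"
      using n x s powr_mono2'[of "- Re s" n x] by (simp add: norm_cpow)
    finally have A2: "A \<le> 2 * n powr (- Re s)" unfolding A_def .
    have A1: "A \<le> norm s * n powr (- Re s - 1)"
      unfolding A_def using cpow_diff_bound[OF n x] s by simp
    have Apos: "A > 0" using A0 unfolding A_def by auto
    have "A = A powr \<theta> * A powr (1 - \<theta>)" using Apos by (simp flip: powr_add)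
    also have "\<dots> \<le> (norm s * n powr (- Re s - 1)) powr \<theta> * (2 * n powr (- Re s)) powr (1 - \<theta>)"
      using A1 A2 Apos \<theta> by (intro mult_mono powr_mono2) auto
    also have "\<dots> = 2 powr (1 - \<theta>) * norm s powr \<theta> * (n powr ((- Re s - 1) * \<theta>) * n powr (- Re s * (1 - \<theta>)))"
      using n by (simp add: powr_mult powr_powr)
    also have "n powr ((- Re s - 1) * \<theta>) * n powr (- Re s * (1 - \<theta>)) = n powr (- Re s - \<theta>)"
      by (simp add: algebra_simps flip: powr_add)
    also have "2 powr (1 - \<theta>) * norm s powr \<theta> * n powr (- Re s - \<theta>) \<le> 2 * norm s powr \<theta> * n powr (- Re s - \<theta>)"
      using \<theta> powr_mono[of "1 - \<theta>" 1 "2::real"] by (intro mult_right_mono) auto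
    finally show ?thesis unfolding A_def .
  qed
qed

text \<open>\<open>zeta_reg s = (s - 1) \<zeta>(s)\<close>: each term is \<open>s - 1\<close> times \<open>n powr (- s)\<close> minus the integral
  of \<open>x powr (- s)\<close> over \<open>[n, n + 1]\<close>, with \<open>n = Suc m\<close>, written without the pole at \<open>s = 1\<close>.\<close>

definition zeta_reg_term :: "nat \<Rightarrow> complex \<Rightarrow> complex" where
  "zeta_reg_term m s = (s - 1) * cpow (real (Suc m)) s - cpow (real (Suc m)) (s - 1) + cpow (real (Suc (Suc m))) (s - 1)"

definition zeta_reg :: "complex \<Rightarrow> complex" where
  "zeta_reg s = 1 + (\<Sum>m. zeta_reg_term m s)"

lemma zeta_reg_term_bound:
  assumes s: "Re s \<ge> 0" and \<theta>: "0 \<le> \<theta>" "\<theta> \<le> 1"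
  shows "norm (zeta_reg_term m s) \<le> 2 * norm (s - 1) * norm s powr \<theta> * real (Suc m) powr (- Re s - \<theta>)"
proof -
  define n where "n = real (Suc m)"
  have n: "n \<ge> 1" by (simp add: n_def)
  \<comment> \<open>The derivative of b at x is (s - 1) (n^(-s) - x^(-s)), and the increment of b
    over [n, n + 1] is the term itself, so the mean value inequality takes the place of an
    integral.\<close>
  define b where "b = (\<lambda>x. (s - 1) * of_real (x - n) * cpow n s + cpow x (s - 1))"
  define B where "B = norm (s - 1) * (2 * norm s powr \<theta> * n powr (- Re s - \<theta>))"
  have "norm (b (n + 1) - b n) \<le> B * norm (n + 1 - n)"
  proof (rule differentiable_bound[of "{n..n+1}" b "\<lambda>x h. h *\<^sub>R ((s - 1) * (cpow n s - cpow x s))"])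
    fix y assume y: "y \<in> {n..n+1}"
    have *: "((\<lambda>x. (s - 1) * of_real (x - n) * cpow n s) has_vector_derivative (s - 1) * cpow n s) (at y within {n..n+1})"
      by (auto intro!: derivative_eq_intros)
    have "cpow y (s - 1) = of_real y * cpow y s"
      using y n by (simp add: cpow_def algebra_simps exp_diff exp_add exp_minus field_simps)
    then have "- (s - 1) / of_real y * cpow y (s - 1) = - (s - 1) * cpow y s"
      using y n by (simp add: field_simps)
    with cpow_has_vector_derivative[of y "s - 1" "{n..n+1}"] y n
    have "((\<lambda>x. cpow x (s - 1)) has_vector_derivative (- (s - 1) * cpow y s)) (at y within {n..n+1})" by auto
    from has_vector_derivative_add[OF * this]
    show "(b has_derivative (\<lambda>h. h *\<^sub>R ((s - 1) * (cpow n s - cpow y s)))) (at y within {n..n+1})"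
      by (simp add: has_vector_derivative_def b_def algebra_simps)
    have "norm ((s - 1) * (cpow n s - cpow y s)) \<le> B"
      unfolding B_def norm_mult using cpow_diff_bound'[OF n y s \<theta>]
      by (intro mult_left_mono) (auto simp: norm_minus_commute)
    then show "onorm (\<lambda>h. h *\<^sub>R ((s - 1) * (cpow n s - cpow y s))) \<le> B"
      by (rule onorm_scaleR_le)
  qed auto
  moreover have "b (n + 1) - b n = zeta_reg_term m s"
    by (simp add: b_def zeta_reg_term_def n_def add.commute algebra_simps)
  ultimately show ?thesis by (simp add: B_def n_def mult_ac)
qed

text \<open>The offset 3 dominates |Re s| and |Re (s - 1)| on the strips used, so a single quantity,
  bounded away from 0, controls both |s| and |s - 1|.\<close>

definition ht :: "complex \<Rightarrow> real" where "ht s = 3 + \<bar>Im s\<bar>"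

lemma ht_ge [simp]: "ht s \<ge> 3" "ht s \<ge> 1" "ht s > 0" "ht s \<ge> 0" by (auto simp: ht_def)

lemma ht_neq_0 [simp]: "ht s \<noteq> 0"
  by (metis ht_ge(3) less_irrefl)

lemma norm_le_ht:
  assumes "- 1 \<le> Re s" "Re s \<le> 3"
  shows "norm s \<le> ht s" "norm (s - 1) \<le> ht s"
proof -
  have "norm s \<le> \<bar>Re s\<bar> + \<bar>Im s\<bar>" by (rule cmod_le)
  then show "norm s \<le> ht s" using assms by (auto simp: ht_def)
  have "norm (s - 1) \<le> \<bar>Re (s - 1)\<bar> + \<bar>Im (s - 1)\<bar>" by (rule cmod_le)
  then show "norm (s - 1) \<le> ht s" using assms by (auto simp: ht_def)
qed

lemma summable_Suc_powr: "e > 0 \<Longrightarrow> summable (\<lambda>m. real (Suc m) powr (- 1 - e))"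
  using summable_real_powr_iff[of "- 1 - e"] summable_Suc_iff[of "\<lambda>n. real n powr (- 1 - e)"] by auto

lemma summable_zeta_reg_term:
  assumes "Re s > 0"
  shows "summable (\<lambda>m. zeta_reg_term m s)" "summable (\<lambda>m. norm (zeta_reg_term m s))"
proof -
  have "summable (\<lambda>m. 2 * norm (s - 1) * norm s powr 1 * real (Suc m) powr (- 1 - Re s))"
    by (intro summable_mult summable_Suc_powr assms)
  then have "summable (\<lambda>m. 2 * norm (s - 1) * norm s powr 1 * real (Suc m) powr (- Re s - 1))"
    by (simp only: minus_diff_commute[of 1])
  then show "summable (\<lambda>m. norm (zeta_reg_term m s))"
    by (rule summable_comparison_test')
       (use zeta_reg_term_bound[of s 1] assms in auto)
  then show "summable (\<lambda>m. zeta_reg_term m s)" by (rule summable_norm_cancel)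
qed

lemma zeta_reg_bound:
  assumes e: "0 < e" "e \<le> 1/2"
  obtains C where "C \<ge> 1" "\<And>s. 1 - e \<le> Re s \<Longrightarrow> Re s \<le> 3 \<Longrightarrow> norm (zeta_reg s) \<le> C * ht s powr (1 + 2 * e)"
proof -
  define A where "A = (\<Sum>m. real (Suc m) powr (- 1 - e))"
  have A: "A \<ge> 0" unfolding A_def by (intro suminf_nonneg summable_Suc_powr e) auto
  show thesis
  proof (rule that[of "1 + 2 * A"])
    show "1 + 2 * A \<ge> 1" using A by simp
    fix s assume s: "1 - e \<le> Re s" "Re s \<le> 3"
    have "norm (zeta_reg_term m s) \<le> 2 * ht s powr (1 + 2 * e) * real (Suc m) powr (- 1 - e)" for m
    proof -
      \<comment> \<open>With \<theta> = 2e and Re s \<ge> 1 - e the exponent of n is at most -1 - e,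
        just enough for convergence left of the line.\<close>
      have "norm (zeta_reg_term m s) \<le> 2 * norm (s - 1) * norm s powr (2 * e) * real (Suc m) powr (- Re s - 2 * e)"
        by (rule zeta_reg_term_bound) (use s e in auto)
      also have "\<dots> \<le> 2 * ht s * ht s powr (2 * e) * real (Suc m) powr (- 1 - e)"
        using norm_le_ht[of s] s e
        by (intro mult_mono powr_mono2 powr_mono) auto
      finally show ?thesis by (simp add: powr_add mult_ac)
    qed
    then have "(\<Sum>m. norm (zeta_reg_term m s)) \<le> (\<Sum>m. 2 * ht s powr (1 + 2 * e) * real (Suc m) powr (- 1 - e))"
      using s e by (intro suminf_le summable_zeta_reg_term summable_mult summable_Suc_powr) auto
    also have "\<dots> = 2 * ht s powr (1 + 2 * e) * A"
      unfolding A_def using e by (intro suminf_mult summable_Suc_powr) auto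
    finally have "norm (\<Sum>m. zeta_reg_term m s) \<le> 2 * ht s powr (1 + 2 * e) * A"
      using summable_norm[OF summable_zeta_reg_term(2), of s] s e by simp
    moreover have "1 \<le> ht s powr (1 + 2 * e)"
      using e by (intro ge_one_powr_ge_zero) auto
    ultimately have "norm (zeta_reg s) \<le> ht s powr (1 + 2 * e) + 2 * ht s powr (1 + 2 * e) * A"
      unfolding zeta_reg_def using norm_triangle_ineq[of 1 "\<Sum>m. zeta_reg_term m s"] by simp
    then show "norm (zeta_reg s) \<le> (1 + 2 * A) * ht s powr (1 + 2 * e)" by (simp add: algebra_simps)
  qed
qed

lemma holomorphic_zeta_reg_term: "zeta_reg_term m holomorphic_on A"
  unfolding zeta_reg_term_def by (intro holomorphic_intros)

lemma holomorphic_suminf: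
  fixes f :: "nat \<Rightarrow> complex \<Rightarrow> complex"
  assumes A: "open A" and hol: "\<And>n. f n holomorphic_on A"
    and dom: "\<And>z. z \<in> A \<Longrightarrow> \<exists>d>0. \<exists>M. cball z d \<subseteq> A \<and> summable M \<and> (\<forall>n. \<forall>w\<in>cball z d. norm (f n w) \<le> M n)"
  shows "(\<lambda>z. \<Sum>n. f n z) holomorphic_on A"
proof (rule holomorphic_uniform_sequence[OF A, of "\<lambda>N z. \<Sum>n<N. f n z"])
  show "(\<lambda>z. \<Sum>n<N. f n z) holomorphic_on A" for N by (intro holomorphic_intros hol)
  fix z assume "z \<in> A"
  from dom[OF this] obtain d M where "d > 0" "cball z d \<subseteq> A" "summable M"
    "\<And>n w. w \<in> cball z d \<Longrightarrow> norm (f n w) \<le> M n" by blast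
  then show "\<exists>d>0. cball z d \<subseteq> A \<and> uniform_limit (cball z d) (\<lambda>N z. \<Sum>n<N. f n z) (\<lambda>z. \<Sum>n. f n z) sequentially"
    using Weierstrass_m_test[of "cball z d" f M] by blast
qed

lemma open_halfplane: "open {s. Re s > a}"
  by (rule open_halfspace_Re_gt)

lemma cball_Re_bounds:
  assumes "w \<in> cball z d"
  shows "Re w \<ge> Re z - d" "Re w \<le> Re z + d" "\<bar>Im w\<bar> \<le> \<bar>Im z\<bar> + d"
proof -
  have "\<bar>Re (z - w)\<bar> \<le> d" "\<bar>Im (z - w)\<bar> \<le> d"
    using assms abs_Re_le_cmod[of "z - w"] abs_Im_le_cmod[of "z - w"] by (auto simp: dist_norm)
  then show "Re w \<ge> Re z - d" "Re w \<le> Re z + d" "\<bar>Im w\<bar> \<le> \<bar>Im z\<bar> + d" by auto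
qed

lemma zeta_reg_holomorphic: "zeta_reg holomorphic_on {s. Re s > 0}"
  unfolding zeta_reg_def
proof (intro holomorphic_intros holomorphic_suminf open_halfplane holomorphic_zeta_reg_term)
  fix z assume "z \<in> {s. Re s > 0}"
  then have z: "Re z > 0" by simp
  define d where "d = Re z / 2"
  have d: "d > 0" using z by (simp add: d_def)
  define M where "M = (\<lambda>m. 2 * (norm z + d + 1) * (norm z + d) * real (Suc m) powr (- 1 - d))"
  have "norm (zeta_reg_term m w) \<le> M m" if w: "w \<in> cball z d" for m w
  proof -
    have Re: "Re w \<ge> d" using cball_Re_bounds(1)[OF w] by (simp add: d_def)
    have nw: "norm w \<le> norm z + d"
      using w norm_triangle_sub[of w z] by (auto simp: dist_norm norm_minus_commute)
    moreover have "norm (w - 1) \<le> norm z + d + 1"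
      using nw norm_triangle_ineq4[of w 1] by simp
    ultimately have "2 * norm (w - 1) * norm w powr 1 * real (Suc m) powr (- Re w - 1) \<le> M m"
      unfolding M_def using Re d by (intro mult_mono powr_mono) auto
    with zeta_reg_term_bound[of w 1 m] Re d show ?thesis by simp
  qed
  moreover have "summable M"
    unfolding M_def by (intro summable_mult summable_Suc_powr d)
  moreover have "cball z d \<subseteq> {s. Re s > 0}"
    using cball_Re_bounds(1)[of _ z d] d by (force simp: d_def)
  ultimately show "\<exists>d>0. \<exists>M. cball z d \<subseteq> {s. Re s > 0} \<and> summable M \<and> (\<forall>n. \<forall>w\<in>cball z d. norm (zeta_reg_term n w) \<le> M n)"
    using d by blast
qed

lemma zeta_reg_1: "zeta_reg 1 = 1"
  by (simp add: zeta_reg_def zeta_reg_term_def cpow_def)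

section \<open>The Dirichlet series of zeta\<close>

definition zeta :: "complex \<Rightarrow> complex" where
  "zeta s = (\<Sum>m. cpow (real (Suc m)) s)"

lemma summable_cpow:
  assumes "Re s > 1"
  shows "summable (\<lambda>m. norm (cpow (real (Suc m)) s))" "summable (\<lambda>m. cpow (real (Suc m)) s)"
proof -
  show "summable (\<lambda>m. norm (cpow (real (Suc m)) s))"
    using summable_Suc_powr[of "Re s - 1"] assms by (simp add: norm_cpow)
  then show "summable (\<lambda>m. cpow (real (Suc m)) s)" by (rule summable_norm_cancel)
qed

text \<open>The differences of n^(1 - s) telescope to -1, because n^(1 - s) tends to 0 when Re s >
  1; the constant 1 in \<open>zeta_reg\<close> compensates this.\<close>

lemma zeta_reg_eq_zeta:
  assumes "Re s > 1"
  shows "zeta_reg s = (s - 1) * zeta s"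
proof -
  have 1: "(\<lambda>m. (s - 1) * cpow (real (Suc m)) s) sums ((s - 1) * zeta s)"
    unfolding zeta_def by (intro sums_mult summable_sums summable_cpow assms)
  have lim: "(\<lambda>m. cpow (real (Suc m)) (s - 1)) \<longlonglongrightarrow> 0"
  proof (rule tendsto_norm_zero_cancel)
    have "(\<lambda>m. real (Suc m) powr (- (Re s - 1))) \<longlonglongrightarrow> 0"
      using assms by real_asymp
    then show "(\<lambda>m. norm (cpow (real (Suc m)) (s - 1))) \<longlonglongrightarrow> 0"
      by (simp add: norm_cpow)
  qed
  have "(\<lambda>m. cpow (real (Suc (Suc m))) (s - 1) - cpow (real (Suc m)) (s - 1)) sums (0 - cpow (real (Suc 0)) (s - 1))"
    by (rule telescope_sums[OF lim])
  from sums_add[OF 1 this] have "(\<lambda>m. zeta_reg_term m s) sums ((s - 1) * zeta s - 1)"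
    by (simp add: zeta_reg_term_def algebra_simps)
  then show ?thesis by (simp add: zeta_reg_def sums_iff)
qed

section \<open>Euler product\<close>

definition sifted :: "nat set \<Rightarrow> nat set" where
  "sifted S = {n. n \<ge> 1 \<and> (\<forall>p\<in>S. \<not> p dvd n)}"

lemma cpow_summable_on:
  assumes "Re s > 1" "A \<subseteq> {1..}"
  shows "(\<lambda>n::nat. norm (cpow (real n) s)) summable_on A" "(\<lambda>n::nat. cpow (real n) s) summable_on A"
proof -
  have "summable (\<lambda>n. norm (cpow (real n) s))"
    using summable_cpow(1)[OF assms(1)] summable_Suc_iff[of "\<lambda>n. norm (cpow (real n) s)"] by simp
  then have "(\<lambda>n. norm (cpow (real n) s)) summable_on UNIV"
    by (intro norm_summable_imp_summable_on) simp
  then show "(\<lambda>n. norm (cpow (real n) s)) summable_on A"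
    by (rule summable_on_subset_banach) auto
  then show "(\<lambda>n::nat. cpow (real n) s) summable_on A"
    by (rule abs_summable_summable)
qed

lemma infsum_cpow_zeta:
  assumes "Re s > 1"
  shows "infsum (\<lambda>n. cpow (real n) s) {1..} = zeta s"
proof -
  have "infsum (\<lambda>n. cpow (real n) s) (Suc ` UNIV) = infsum ((\<lambda>n. cpow (real n) s) \<circ> Suc) UNIV"
    by (intro infsum_reindex) auto
  also have "Suc ` UNIV = {1..}" by (auto simp: image_iff dest: Suc_le_D)
  also have "infsum ((\<lambda>n. cpow (real n) s) \<circ> Suc) UNIV = zeta s"
    unfolding o_def zeta_def
    by (intro infsumI norm_summable_imp_has_sum summable_cpow assms summable_sums)
  finally show ?thesis .
qed

text \<open>The sieve of Eratosthenes on an absolutely convergent series: the multiples of p in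
  \<open>sifted S\<close> are exactly p times \<open>sifted S\<close>, so deleting them multiplies
  the sum by 1 - p^(-s).\<close>

lemma euler_sieve:
  assumes s: "Re s > 1" and S: "finite S" "\<And>p. p \<in> S \<Longrightarrow> prime p"
  shows "(\<Prod>p\<in>S. 1 - cpow (real p) s) * zeta s = infsum (\<lambda>n. cpow (real n) s) (sifted S)"
  using S
proof (induction S)
  case empty
  have "sifted {} = {1..}" by (auto simp: sifted_def)
  then show ?case using infsum_cpow_zeta[OF s] by simp
next
  case (insert p S)
  have p: "prime p" using insert by auto
  then have p0: "p > 0" by (rule prime_gt_0_nat)
  have split: "sifted S = sifted (insert p S) \<union> (*) p ` sifted S"
  proof (intro equalityI subsetI)
    fix n assume n: "n \<in> sifted S"
    show "n \<in> sifted (insert p S) \<union> (*) p ` sifted S"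
    proof (cases "p dvd n")
      case True
      then obtain m where m: "n = p * m" by auto
      with n have "m \<in> sifted S" by (auto simp: sifted_def)
      with m show ?thesis by auto
    qed (use n in \<open>auto simp: sifted_def\<close>)
  next
    fix n assume "n \<in> sifted (insert p S) \<union> (*) p ` sifted S"
    then consider "n \<in> sifted S" | m where "n = p * m" "m \<in> sifted S" by (auto simp: sifted_def)
    then show "n \<in> sifted S"
    proof cases
      case 2
      have "\<not> q dvd n" if q: "q \<in> S" for q
      proof
        assume "q dvd n"
        moreover have "prime q" using q insert by auto
        ultimately have "q dvd p \<or> q dvd m" using 2 prime_dvd_mult_iff by blast
        then have "q dvd p" using 2 q by (auto simp: sifted_def)
        then have "q = p" using p \<open>prime q\<close> primes_dvd_imp_eq by blast
        with q insert show False by auto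
      qed
      with 2 p0 show ?thesis by (auto simp: sifted_def)
    qed
  qed
  have sub: "sifted T \<subseteq> {1..}" for T by (auto simp: sifted_def)
  have sub2: "(*) p ` sifted S \<subseteq> {1..}" using p0 by (auto simp: sifted_def)
  have "infsum (\<lambda>n. cpow (real n) s) (sifted S) =
    infsum (\<lambda>n. cpow (real n) s) (sifted (insert p S)) + infsum (\<lambda>n. cpow (real n) s) ((*) p ` sifted S)"
    by (subst split, intro infsum_Un_disjoint cpow_summable_on s sub sub2) (auto simp: sifted_def)
  also have "infsum (\<lambda>n. cpow (real n) s) ((*) p ` sifted S) = infsum ((\<lambda>n. cpow (real n) s) \<circ> (*) p) (sifted S)"
    using p0 by (intro infsum_reindex) (auto simp: inj_on_def)
  also have "\<dots> = infsum (\<lambda>n. cpow (real p) s * cpow (real n) s) (sifted S)"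
    using p0 by (intro infsum_cong) (auto simp: cpow_mult sifted_def)
  also have "\<dots> = cpow (real p) s * infsum (\<lambda>n. cpow (real n) s) (sifted S)"
    by (rule infsum_cmult_right')
  finally have "infsum (\<lambda>n. cpow (real n) s) (sifted (insert p S)) =
      (1 - cpow (real p) s) * infsum (\<lambda>n. cpow (real n) s) (sifted S)"
    by (simp add: algebra_simps)
  then show ?case using insert by (simp add: mult.assoc)
qed

definition primes_le :: "nat \<Rightarrow> nat set" where
  "primes_le N = {p. prime p \<and> p \<le> N}"

lemma finite_primes_le [simp]: "finite (primes_le N)"
  by (simp add: primes_le_def)

definition ztail :: "nat \<Rightarrow> real \<Rightarrow> real" where
  "ztail N \<sigma> = (\<Sum>m. real (Suc (m + N)) powr (- \<sigma>))"

lemma ztail_tendsto_0: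
  assumes "\<sigma> > 1"
  shows "(\<lambda>N. ztail N \<sigma>) \<longlonglongrightarrow> 0"
proof -
  have sm: "summable (\<lambda>m. real (Suc m) powr (- \<sigma>))"
    using summable_Suc_powr[of "\<sigma> - 1"] assms by simp
  have "(\<lambda>N. (\<Sum>m. real (Suc m) powr (- \<sigma>)) - (\<Sum>m<N. real (Suc m) powr (- \<sigma>))) \<longlonglongrightarrow>
    (\<Sum>m. real (Suc m) powr (- \<sigma>)) - (\<Sum>m. real (Suc m) powr (- \<sigma>))"
    by (intro tendsto_intros summable_LIMSEQ sm)
  moreover have "ztail N \<sigma> = (\<Sum>m. real (Suc m) powr (- \<sigma>)) - (\<Sum>m<N. real (Suc m) powr (- \<sigma>))" for N
    unfolding ztail_def by (rule suminf_minus_initial_segment[OF sm])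
  ultimately show ?thesis by simp
qed

text \<open>An integer other than 1 without prime factors up to N exceeds N, so the sifted series
  minus its first term is part of a tail. The tail depends on \<sigma> only; this uniformity is what
  permits differentiating the products in \<open>zeta_logderiv\<close>.\<close>

lemma euler_product_bound:
  assumes s: "Re s \<ge> \<sigma>" and \<sigma>: "\<sigma> > 1"
  shows "norm ((\<Prod>p\<in>primes_le N. 1 - cpow (real p) s) * zeta s - 1) \<le> ztail N \<sigma>"
proof -
  let ?f = "\<lambda>n::nat. cpow (real n) s"
  let ?T = "sifted (primes_le N) - {1}"
  have s1: "Re s > 1" using s \<sigma> by simp
  have one: "1 \<in> sifted (primes_le N)"
    by (auto simp: sifted_def primes_le_def)
  have T: "?T \<subseteq> {Suc N..}"
  proof
    fix n assume n: "n \<in> ?T"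
    then have "n \<noteq> 1" by simp
    then obtain p where p: "prime p" "p dvd n" using prime_factor_nat by blast
    then have "p \<notin> primes_le N" using n by (auto simp: sifted_def)
    then have "p > N" using p by (auto simp: primes_le_def)
    moreover have "p \<le> n" using p n by (intro dvd_imp_le) (auto simp: sifted_def)
    ultimately show "n \<in> {Suc N..}" by simp
  qed
  have T1: "?T \<subseteq> {1..}" using T by auto
  have "(\<Prod>p\<in>primes_le N. 1 - cpow (real p) s) * zeta s = infsum ?f (sifted (primes_le N))"
    by (rule euler_sieve[OF s1]) (auto simp: primes_le_def)
  also have "sifted (primes_le N) = {1} \<union> ?T" using one by auto
  also have "infsum ?f \<dots> = infsum ?f {1} + infsum ?f ?T"
    by (intro infsum_Un_disjoint cpow_summable_on s1 T1) auto
  finally have "(\<Prod>p\<in>primes_le N. 1 - cpow (real p) s) * zeta s - 1 = infsum ?f ?T" by simp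
  also have "norm \<dots> \<le> infsum (\<lambda>n. norm (?f n)) ?T"
    by (intro norm_infsum_bound cpow_summable_on s1 T1)
  also have "\<dots> \<le> infsum (\<lambda>n. norm (?f n)) {Suc N..}"
    by (intro infsum_mono2 cpow_summable_on s1 T1 T) auto
  also have "{Suc N..} = (\<lambda>m. Suc (m + N)) ` UNIV"
    by (auto simp: image_iff) (metis add.commute add_Suc le_Suc_ex)
  also have "infsum (\<lambda>n. norm (?f n)) \<dots> = infsum ((\<lambda>n. norm (?f n)) \<circ> (\<lambda>m. Suc (m + N))) UNIV"
    by (intro infsum_reindex) (auto simp: inj_on_def)
  also have "\<dots> = (\<Sum>m. norm (?f (Suc (m + N))))"
    unfolding o_def using summable_cpow(1)[OF s1] summable_iff_shift[of "\<lambda>m. norm (?f (Suc m))" N]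
    by (intro infsumI norm_summable_imp_has_sum summable_sums) auto
  also have "\<dots> \<le> ztail N \<sigma>"
    unfolding ztail_def
  proof (rule suminf_le)
    show "norm (?f (Suc (m + N))) \<le> real (Suc (m + N)) powr - \<sigma>" for m
      using s by (subst norm_cpow) (auto intro!: powr_mono)
    show "summable (\<lambda>m. norm (?f (Suc (m + N))))"
      using summable_cpow(1)[OF s1] summable_iff_shift[of "\<lambda>m. norm (?f (Suc m))" N] by simp
    show "summable (\<lambda>m. real (Suc (m + N)) powr - \<sigma>)"
      using summable_Suc_powr[of "\<sigma> - 1"] \<sigma> summable_iff_shift[of "\<lambda>m. real (Suc m) powr (-\<sigma>)" N] by simp
  qed
  finally show ?thesis .
qed

lemma euler_product_tendsto:
  assumes "Re s > 1"
  shows "(\<lambda>N. (\<Prod>p\<in>primes_le N. 1 - cpow (real p) s) * zeta s) \<longlonglongrightarrow> 1"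
proof -
  have "(\<lambda>N. (\<Prod>p\<in>primes_le N. 1 - cpow (real p) s) * zeta s - 1) \<longlonglongrightarrow> 0"
    by (rule tendsto_norm_zero_cancel, rule tendsto_sandwich[OF _ _ tendsto_const ztail_tendsto_0[OF assms]])
       (use euler_product_bound[OF order_refl assms] in auto)
  then show ?thesis by (simp add: LIM_zero_iff)
qed

lemma zeta_nonzero:
  assumes "Re s > 1" shows "zeta s \<noteq> 0"
proof
  assume "zeta s = 0"
  with euler_product_tendsto[OF assms] have "(\<lambda>N::nat. 0::complex) \<longlonglongrightarrow> 1" by simp
  then show False using LIMSEQ_unique tendsto_const by (metis zero_neq_one)
qed

text \<open>The real part of the logarithm is expanded in its power series. Term by term the
  combination is -(x^n / n) times 3 + 4 cos \<phi> + cos 2\<phi> = 2 (1 + cos \<phi>)^2 with \<phi>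
  = n \<theta>. The norms are those of factors of 1 / zeta, hence an upper bound 1.\<close>

lemma three_four_one_factor:
  fixes x \<theta> :: real
  assumes x: "0 \<le> x" "x < 1"
  shows "norm (1 - of_real x :: complex) ^ 3 * norm (1 - of_real x * cis \<theta>) ^ 4 * norm (1 - of_real x * cis (2 * \<theta>)) \<le> 1"
proof -
  define L where "L = (\<lambda>\<phi>. Re (ln (1 - of_real x * cis \<phi>)))"
  have sums: "(\<lambda>n. - (x ^ n * cos (real n * \<phi>) / real n)) sums L \<phi>" for \<phi>
  proof -
    have "(\<lambda>n. - ((- (- (of_real x * cis \<phi>)))^n) / of_nat n) sums ln (1 + (- (of_real x * cis \<phi>)))"
      by (rule Ln_series') (use x in \<open>simp add: norm_mult\<close>)
    then have "(\<lambda>n. Re (- ((of_real x * cis \<phi>)^n) / of_nat n)) sums L \<phi>"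
      unfolding L_def by (intro sums_Re) simp
    moreover have "Re (- ((of_real x * cis \<phi>)^n) / of_nat n) = - (x ^ n * cos (real n * \<phi>) / real n)" for n
    proof -
      have "Re ((of_real x * cis \<phi>)^n) = Re (of_real (x ^ n) * cis (real n * \<phi>))"
        by (simp only: power_mult_distrib Complex.DeMoivre of_real_power)
      also have "\<dots> = x ^ n * cos (real n * \<phi>)"
        by (simp del: of_real_power)
      finally show ?thesis
        unfolding Re_divide_of_nat uminus_complex.sel by simp
    qed
    ultimately show ?thesis by (simp only:)
  qed
  have nz: "1 - of_real x * cis \<phi> \<noteq> 0" for \<phi>
  proof
    assume "1 - of_real x * cis \<phi> = 0"
    then have "norm (of_real x * cis \<phi>) = 1" by (metis norm_one right_minus_eq)
    with x show False by (simp add: norm_mult)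
  qed
  have expL: "norm (1 - of_real x * cis \<phi>) = exp (L \<phi>)" for \<phi>
    using nz[of \<phi>] by (simp add: L_def)
  have S: "(\<lambda>n. 3 * (- (x ^ n * cos (real n * 0) / real n)) + 4 * (- (x ^ n * cos (real n * \<theta>) / real n)) +
     (- (x ^ n * cos (real n * (2 * \<theta>)) / real n))) sums (3 * L 0 + 4 * L \<theta> + L (2 * \<theta>))"
    by (intro sums_add sums_mult sums)
  have N: "3 * (- (x ^ n * cos (real n * 0) / real n)) + 4 * (- (x ^ n * cos (real n * \<theta>) / real n)) +
     (- (x ^ n * cos (real n * (2 * \<theta>)) / real n)) \<le> 0" for n
  proof -
    define y c where "y = x ^ n / real n" and "c = cos (real n * \<theta>)"
    have cos2: "cos (real n * (2 * \<theta>)) = 2 * c ^ 2 - 1"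
      using cos_double_cos[of "real n * \<theta>"] by (simp add: c_def mult_ac)
    have y: "x ^ n * u / real n = y * u" for u by (simp add: y_def)
    have "3 * (- (y * 1)) + 4 * (- (y * c)) + (- (y * (2 * c\<^sup>2 - 1))) = - (y * (2 * (1 + c)\<^sup>2))"
      by (simp add: power2_eq_square algebra_simps)
    also have "\<dots> \<le> 0" using x by (simp add: y_def)
    finally show ?thesis unfolding y cos2 mult_zero_right cos_zero c_def[symmetric] .
  qed
  have "3 * L 0 + 4 * L \<theta> + L (2 * \<theta>) \<le> 0"
    by (rule sums_le[OF N S sums_zero])
  then have "exp (3 * L 0 + 4 * L \<theta> + L (2 * \<theta>)) \<le> 1" by simp
  also have "exp (3 * L 0 + 4 * L \<theta> + L (2 * \<theta>)) = exp (L 0) ^ 3 * exp (L \<theta>) ^ 4 * exp (L (2 * \<theta>))"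
    by (simp add: exp_add flip: exp_of_nat_mult)
  also have "\<dots> = norm (1 - of_real x * cis 0) ^ 3 * norm (1 - of_real x * cis \<theta>) ^ 4 * norm (1 - of_real x * cis (2 * \<theta>))"
    by (simp only: expL)
  finally show ?thesis by simp
qed

lemma cpow_Complex:
  assumes "x > 0"
  shows "cpow x (Complex \<sigma> t) = of_real (x powr (- \<sigma>)) * cis (- t * ln x)"
proof -
  have "Complex \<sigma> t = of_real \<sigma> + \<i> * of_real t" by (simp add: complex_eq_iff)
  then have "cpow x (Complex \<sigma> t) = exp (of_real (- \<sigma> * ln x) + \<i> * of_real (- t * ln x))"
    by (simp add: cpow_def algebra_simps)
  also have "\<dots> = of_real (x powr (- \<sigma>)) * cis (- t * ln x)"
    using assms by (simp only: exp_add exp_of_real cis_conv_exp powr_def) simp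
  finally show ?thesis .
qed

text \<open>The factorwise inequality is multiplied over the primes up to N; then N tends to
  infinity, where each truncated product times zeta has norm tending to 1.\<close>

lemma three_four_one:
  assumes "\<sigma> > 1"
  shows "norm (zeta (Complex \<sigma> 0)) ^ 3 * norm (zeta (Complex \<sigma> t)) ^ 4 * norm (zeta (Complex \<sigma> (2 * t))) \<ge> 1"
proof -
  define P where "P = (\<lambda>N u. (\<Prod>p\<in>primes_le N. 1 - cpow (real p) (Complex \<sigma> u)))"
  have lim: "(\<lambda>N. norm (P N u * zeta (Complex \<sigma> u))) \<longlonglongrightarrow> 1" for u
    using tendsto_norm[OF euler_product_tendsto[of "Complex \<sigma> u"]] assms by (simp add: P_def)
  have "(\<lambda>N. norm (P N 0 * zeta (Complex \<sigma> 0)) ^ 3 * norm (P N t * zeta (Complex \<sigma> t)) ^ 4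
     * norm (P N (2 * t) * zeta (Complex \<sigma> (2 * t)))) \<longlonglongrightarrow> 1 ^ 3 * 1 ^ 4 * 1"
    by (intro tendsto_intros lim)
  moreover have "norm (P N 0 * zeta (Complex \<sigma> 0)) ^ 3 * norm (P N t * zeta (Complex \<sigma> t)) ^ 4
     * norm (P N (2 * t) * zeta (Complex \<sigma> (2 * t))) \<le>
     norm (zeta (Complex \<sigma> 0)) ^ 3 * norm (zeta (Complex \<sigma> t)) ^ 4 * norm (zeta (Complex \<sigma> (2 * t)))" for N
  proof -
    have fac: "norm (1 - cpow (real p) (Complex \<sigma> 0)) ^ 3 * norm (1 - cpow (real p) (Complex \<sigma> t)) ^ 4
        * norm (1 - cpow (real p) (Complex \<sigma> (2 * t))) \<le> 1" if "p \<in> primes_le N" for p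
    proof -
      have p: "real p \<ge> 2" using that prime_ge_2_nat by (auto simp: primes_le_def)
      have "real p powr (- \<sigma>) < 1"
        using p assms by (simp add: powr_less_one)
      from three_four_one_factor[of "real p powr (- \<sigma>)" "- t * ln (real p)"] this
      show ?thesis using p by (simp add: cpow_Complex mult.assoc)
    qed
    have "norm (P N 0) ^ 3 * norm (P N t) ^ 4 * norm (P N (2 * t)) \<le> 1"
    proof -
      have "norm (P N 0) ^ 3 * norm (P N t) ^ 4 * norm (P N (2 * t)) =
        (\<Prod>p\<in>primes_le N. norm (1 - cpow (real p) (Complex \<sigma> 0)) ^ 3 *
          norm (1 - cpow (real p) (Complex \<sigma> t)) ^ 4 * norm (1 - cpow (real p) (Complex \<sigma> (2 * t))))"
        by (simp add: P_def prod_power_distrib prod.distrib flip: prod_norm)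
      also have "\<dots> \<le> 1" using fac by (intro prod_le_1) auto
      finally show ?thesis .
    qed
    from mult_right_mono[OF this, of "norm (zeta (Complex \<sigma> 0)) ^ 3 * norm (zeta (Complex \<sigma> t)) ^ 4 * norm (zeta (Complex \<sigma> (2 * t)))"]
    show ?thesis by (simp add: norm_mult power_mult_distrib mult_ac)
  qed
  ultimately show ?thesis using LIMSEQ_le_const2 by (metis (no_types, lifting) mult_1 power_one)
qed

lemma holomorphic_zeta: "zeta holomorphic_on {s. Re s > 1}"
proof -
  have "(\<lambda>s. zeta_reg s / (s - 1)) holomorphic_on {s. Re s > 1}"
    by (intro holomorphic_intros holomorphic_on_subset[OF zeta_reg_holomorphic]) auto
  then show ?thesis
    by (rule holomorphic_transform) (auto simp: zeta_reg_eq_zeta)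
qed

lemma cpow_neq_1:
  assumes "p > 1" "Re s > 0"
  shows "norm (cpow p s) < 1" "cpow p s \<noteq> 1"
proof -
  show "norm (cpow p s) < 1" using assms by (simp add: norm_cpow powr_less_one)
  then show "cpow p s \<noteq> 1" by auto
qed

lemma deriv_euler_product:
  assumes "finite S" "\<And>p. p \<in> S \<Longrightarrow> prime p" "Re s > 0"
  shows "((\<lambda>s. \<Prod>p\<in>S. 1 - cpow (real p) s) has_field_derivative
     (\<Prod>p\<in>S. 1 - cpow (real p) s) * (\<Sum>p\<in>S. of_real (ln (real p)) * cpow (real p) s / (1 - cpow (real p) s))) (at s)"
  using assms
proof (induction S)
  case (insert p S)
  have "real p > 1" using insert prime_gt_1_nat by auto
  then have nz: "1 - cpow (real p) s \<noteq> 0" using cpow_neq_1(2)[of "real p" s] insert by auto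
  have 1: "((\<lambda>s. 1 - cpow (real p) s) has_field_derivative of_real (ln (real p)) * cpow (real p) s) (at s)"
    by (auto intro!: derivative_eq_intros deriv_cpow)
  from insert have 2: "((\<lambda>s. \<Prod>p\<in>S. 1 - cpow (real p) s) has_field_derivative
     (\<Prod>p\<in>S. 1 - cpow (real p) s) * (\<Sum>p\<in>S. of_real (ln (real p)) * cpow (real p) s / (1 - cpow (real p) s))) (at s)"
    by auto
  define P where "P = (\<Prod>p\<in>S. 1 - cpow (real p) s)"
  define Q where "Q = (\<Sum>p\<in>S. of_real (ln (real p)) * cpow (real p) s / (1 - cpow (real p) s))"
  define c where "c = of_real (ln (real p)) * cpow (real p) s"
  from DERIV_mult[OF 1 2] have "((\<lambda>s. \<Prod>p\<in>insert p S. 1 - cpow (real p) s) has_field_derivative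
      c * P + P * Q * (1 - cpow (real p) s)) (at s)"
    using insert by (simp add: P_def Q_def c_def)
  also have "c * P + P * Q * (1 - cpow (real p) s) = ((1 - cpow (real p) s) * P) * (c / (1 - cpow (real p) s) + Q)"
    using nz by (simp add: field_simps)
  finally show ?case using insert by (simp add: P_def Q_def c_def)
qed auto

text \<open>The truncated products times zeta converge to the constant 1 uniformly on a half-plane,
  so their derivatives tend to 0. Dividing by the products themselves leaves the sum over primes
  plus zeta' / zeta.\<close>

lemma zeta_logderiv:
  assumes s: "Re s > 1"
  shows "(\<lambda>N. \<Sum>p\<in>primes_le N. of_real (ln (real p)) * cpow (real p) s / (1 - cpow (real p) s))
     \<longlonglongrightarrow> - deriv zeta s / zeta s"
proof -
  define \<sigma> where "\<sigma> = (1 + Re s) / 2"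
  have \<sigma>: "\<sigma> > 1" "Re s > \<sigma>" using s by (auto simp: \<sigma>_def field_simps)
  define G where "G = (\<lambda>N s. (\<Prod>p\<in>primes_le N. 1 - cpow (real p) s) * zeta s)"
  define Q where "Q = (\<lambda>N. \<Sum>p\<in>primes_le N. of_real (ln (real p)) * cpow (real p) s / (1 - cpow (real p) s))"
  have "uniform_limit {s. Re s > \<sigma>} G (\<lambda>_. 1) sequentially"
    unfolding uniform_limit_iff
  proof (intro allI impI)
    fix e :: real assume "e > 0"
    then have "eventually (\<lambda>N. ztail N \<sigma> < e) sequentially"
      using order_tendstoD(2)[OF ztail_tendsto_0[OF \<sigma>(1)]] by auto
    then show "eventually (\<lambda>N. \<forall>s\<in>{s. Re s > \<sigma>}. dist (G N s) 1 < e) sequentially"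
    proof eventually_elim
      case (elim N)
      then show ?case using euler_product_bound[of \<sigma> _ N] \<sigma> unfolding G_def dist_norm
        by (smt (verit, best) mem_Collect_eq)
    qed
  qed
  moreover have "eventually (\<lambda>N. G N holomorphic_on {s. Re s > \<sigma>}) sequentially"
    unfolding G_def using \<sigma> by (intro always_eventually allI holomorphic_intros holomorphic_on_subset[OF holomorphic_zeta]) auto
  ultimately have "(\<lambda>N. (deriv ^^ 1) (G N) s) \<longlonglongrightarrow> (deriv ^^ 1) (\<lambda>_. 1) s"
    by (rule higher_deriv_complex_uniform_limit) (use \<sigma> in \<open>auto intro: open_halfplane\<close>)
  then have lim0: "(\<lambda>N. deriv (G N) s) \<longlonglongrightarrow> 0" by simp
  have dz: "(zeta has_field_derivative deriv zeta s) (at s)"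
    using holomorphic_derivI[OF holomorphic_zeta open_halfplane] s by auto
  have "deriv (G N) s = G N s * (Q N + deriv zeta s / zeta s)" for N
  proof -
    have "(G N has_field_derivative ((\<Prod>p\<in>primes_le N. 1 - cpow (real p) s) * Q N * zeta s
       + deriv zeta s * (\<Prod>p\<in>primes_le N. 1 - cpow (real p) s))) (at s)"
      unfolding G_def Q_def
      using s by (intro DERIV_mult deriv_euler_product dz) (auto simp: primes_le_def)
    then show ?thesis unfolding G_def using zeta_nonzero[OF s]
      by (simp add: DERIV_imp_deriv field_simps)
  qed
  with lim0 have lim1: "(\<lambda>N. G N s * (Q N + deriv zeta s / zeta s)) \<longlonglongrightarrow> 0" by simp
  have limG: "(\<lambda>N. G N s) \<longlonglongrightarrow> 1"
    using euler_product_tendsto[OF s] by (simp add: G_def)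
  have "(\<lambda>N. G N s * (Q N + deriv zeta s / zeta s) / G N s) \<longlonglongrightarrow> 0 / 1"
    by (intro tendsto_divide lim1 limG) auto
  moreover have "eventually (\<lambda>N. G N s \<noteq> 0) sequentially"
    using tendsto_imp_eventually_ne[OF limG] by auto
  ultimately have "(\<lambda>N. Q N + deriv zeta s / zeta s) \<longlonglongrightarrow> 0"
    by (auto elim!: Lim_transform_eventually eventually_mono)
  from tendsto_diff[OF this tendsto_const[of "deriv zeta s / zeta s"]] show ?thesis
    by (simp add: Q_def)
qed

section \<open>Zero-free region\<close>

lemma power4_powr_quarter:
  assumes "(x::real) > 0"
  shows "(x ^ 4) powr (1/4) = x" "(x powr (1/4)) ^ 4 = x" "(x powr (3/4)) ^ 4 = x ^ 3"
proof -
  have "(x ^ 4) powr (1/4) = (x powr real 4) powr (1/4)" using assms by (simp only: powr_realpow)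
  also have "\<dots> = x" using assms by (simp only: powr_powr) simp
  finally show "(x ^ 4) powr (1/4) = x" .
  show "(x powr (1/4)) ^ 4 = x" "(x powr (3/4)) ^ 4 = x ^ 3"
    using assms by (simp_all add: powr_power)
qed

lemma ht_cball:
  assumes "w \<in> cball s r" "r \<le> 1"
  shows "ht w \<le> 2 * ht s"
  using cball_Re_bounds(3)[OF assms(1)] assms(2) by (auto simp: ht_def)

text \<open>Cauchy's estimate on discs of radius e / 2, which costs half of the strip on the left.
  The same C serves both bounds.\<close>

lemma deriv_zeta_reg_bound:
  assumes e: "0 < e" "e \<le> 1/2"
  obtains C where "C \<ge> 1"
    "\<And>s. 1 - e \<le> Re s \<Longrightarrow> Re s \<le> 3 \<Longrightarrow> norm (zeta_reg s) \<le> C * ht s powr (1 + 2 * e)"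
    "\<And>s. 1 - e / 2 \<le> Re s \<Longrightarrow> Re s \<le> 2 \<Longrightarrow> norm (deriv zeta_reg s) \<le> C * ht s powr (1 + 2 * e)"
proof -
  from zeta_reg_bound[OF e] obtain C where C: "C \<ge> 1"
    "\<And>s. 1 - e \<le> Re s \<Longrightarrow> Re s \<le> 3 \<Longrightarrow> norm (zeta_reg s) \<le> C * ht s powr (1 + 2 * e)" by blast
  define C' where "C' = 2 * C * 2 powr (1 + 2 * e) / e"
  have "C * 1 \<le> C * (2 * 2 powr (1 + 2 * e) / e)"
  proof (intro mult_left_mono)
    have "1 \<le> (2::real) powr (1 + 2 * e)" using e by (intro ge_one_powr_ge_zero) auto
    then show "1 \<le> 2 * 2 powr (1 + 2 * e) / e" using e by (simp add: field_simps)
  qed (use C in auto)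
  then have CC: "C \<le> C'" by (simp add: C'_def mult_ac)
  show thesis
  proof (rule that[of C'])
    show "C' \<ge> 1" using CC C by simp
    fix s assume s: "1 - e \<le> Re s" "Re s \<le> 3"
    have "norm (zeta_reg s) \<le> C * ht s powr (1 + 2 * e)" by (rule C(2)[OF s])
    also have "\<dots> \<le> C' * ht s powr (1 + 2 * e)" using CC by (intro mult_right_mono) auto
    finally show "norm (zeta_reg s) \<le> C' * ht s powr (1 + 2 * e)" .
  next
    fix s assume s: "1 - e / 2 \<le> Re s" "Re s \<le> 2"
    have sub: "cball s (e / 2) \<subseteq> {s. Re s > 0}"
      using cball_Re_bounds(1)[of _ s "e/2"] s e by force
    have bd: "norm (zeta_reg w) \<le> C * (2 * ht s) powr (1 + 2 * e)" if w: "w \<in> cball s (e / 2)" for w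
    proof -
      have "norm (zeta_reg w) \<le> C * ht w powr (1 + 2 * e)"
        using cball_Re_bounds(1,2)[OF w] s e by (intro C(2)) auto
      also have "\<dots> \<le> C * (2 * ht s) powr (1 + 2 * e)"
        using ht_cball[OF w] e C by (intro mult_left_mono powr_mono2) auto
      finally show ?thesis .
    qed
    have "norm ((deriv ^^ 1) zeta_reg s) \<le> fact 1 * (C * (2 * ht s) powr (1 + 2 * e)) / (e / 2) ^ 1"
    proof (rule Cauchy_inequality)
      show "zeta_reg holomorphic_on ball s (e / 2)"
        by (rule holomorphic_on_subset[OF zeta_reg_holomorphic subset_trans[OF ball_subset_cball sub]])
      show "continuous_on (cball s (e / 2)) zeta_reg"
        by (intro holomorphic_on_imp_continuous_on holomorphic_on_subset[OF zeta_reg_holomorphic] sub)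
      show "norm (zeta_reg x) \<le> C * (2 * ht s) powr (1 + 2 * e)" if "norm (s - x) = e / 2" for x
        using that by (intro bd) (simp add: dist_norm)
    qed (use e in auto)
    also have "\<dots> = C' * ht s powr (1 + 2 * e)" by (simp add: C'_def powr_mult mult_ac)
    finally show "norm (deriv zeta_reg s) \<le> C' * ht s powr (1 + 2 * e)" by simp
  qed
qed

lemma zeta_reg_diff_bound:
  assumes S: "convex S" "S \<subseteq> {s. Re s > 0}"
    and bd: "\<And>s. s \<in> S \<Longrightarrow> norm (deriv zeta_reg s) \<le> B" and ab: "a \<in> S" "b \<in> S"
  shows "norm (zeta_reg a - zeta_reg b) \<le> B * norm (a - b)"
proof (rule field_differentiable_bound[OF S(1), of zeta_reg "deriv zeta_reg"])
  fix z assume "z \<in> S"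
  then show "(zeta_reg has_field_derivative deriv zeta_reg z) (at z within S)"
    using holomorphic_derivI[OF zeta_reg_holomorphic open_halfplane] S by auto
qed (use assms in auto)

lemma zeta_reg_near_1:
  assumes e: "0 < e" "e \<le> 1/2" and C: "C \<ge> 1"
    "\<And>s. 1 - e / 2 \<le> Re s \<Longrightarrow> Re s \<le> 2 \<Longrightarrow> norm (deriv zeta_reg s) \<le> C * ht s powr (1 + 2 * e)"
    and s: "norm (s - 1) \<le> e / 2"
  shows "norm (zeta_reg s - 1) \<le> 16 * C * norm (s - 1)"
proof -
  have "norm (zeta_reg s - zeta_reg 1) \<le> (16 * C) * norm (s - 1)"
  proof (rule zeta_reg_diff_bound[of "cball 1 (e/2)"])
    show "cball 1 (e / 2) \<subseteq> {s. Re s > 0}"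
      using cball_Re_bounds(1)[of _ 1 "e/2"] e by force
    fix w :: complex assume w: "w \<in> cball 1 (e/2)"
    \<comment> \<open>The constant 16 is 4^2: on this disc \<open>ht w\<close> \<le> 4, and the
      exponent 1 + 2e is at most 2.\<close>
    have h: "ht w \<le> 4" using cball_Re_bounds(3)[OF w] e by (simp add: ht_def)
    have "norm (deriv zeta_reg w) \<le> C * ht w powr (1 + 2 * e)"
      using cball_Re_bounds(1,2)[OF w] e by (intro C) auto
    also have "\<dots> \<le> C * ht w powr 2" using e C by (intro mult_left_mono powr_mono) auto
    also have "\<dots> = C * ht w ^ 2" by simp
    also have "\<dots> \<le> C * 4 ^ 2" using h C by (intro mult_left_mono power_mono) auto
    finally show "norm (deriv zeta_reg w) \<le> 16 * C" by simp
  qed (use s e in \<open>auto simp: dist_norm norm_minus_commute\<close>)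
  then show ?thesis by (simp add: zeta_reg_1)
qed

text \<open>In the 3-4-1 inequality zeta at \<sigma> contributes (\<sigma> - 1)^(-3), each zeta off
  the real axis is \<open>zeta_reg\<close> divided by at least a multiple of the height h, and
  \<open>zeta_reg\<close> at 2t is O(h^(1 + 2e)). This leaves |zeta_reg s|^4 at least a multiple of
  (\<sigma> - 1)^3 h^(4 - 2e), and the claim is its fourth root. The condition \<bar>Im s\<bar>
  \<ge> t0 keeps away from the pole.\<close>

lemma zeta_reg_341:
  assumes e: "0 < e" "e \<le> 1/2" and C: "C \<ge> 1"
    "\<And>s. 1 - e \<le> Re s \<Longrightarrow> Re s \<le> 3 \<Longrightarrow> norm (zeta_reg s) \<le> C * ht s powr (1 + 2 * e)"
    and t0: "0 < t0" "t0 \<le> 1"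
  obtains K where "K > 0"
    "\<And>s. 1 < Re s \<Longrightarrow> Re s \<le> 2 \<Longrightarrow> \<bar>Im s\<bar> \<ge> t0 \<Longrightarrow>
       norm (zeta_reg s) \<ge> K * (Re s - 1) powr (3/4) * ht s powr (1 - e / 2)"
proof -
  \<comment> \<open>From t0 \<le> \<bar>t\<bar> and t0 \<le> 1 follows t0 (3 + \<bar>t\<bar>) \<le>
    4 \<bar>t\<bar>; hence the quarter.\<close>
  define t1 where "t1 = t0 / 4"
  define K1 where "K1 = t1 ^ 5 / ((9 * C) ^ 3 * (4 * C))"
  have K1: "K1 > 0" using t0 C by (simp add: K1_def t1_def)
  show thesis
  proof (rule that[of "K1 powr (1/4)"])
    show "K1 powr (1/4) > 0" using K1 by simp
    fix s assume s: "1 < Re s" "Re s \<le> 2" "\<bar>Im s\<bar> \<ge> t0"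
    define \<sigma> t where "\<sigma> = Re s" and "t = Im s"
    define h where "h = ht s"
    have h3: "h \<ge> 3" by (simp add: h_def)
    have seq: "s = Complex \<sigma> t" by (simp add: \<sigma>_def t_def)
    have th: "\<bar>t\<bar> \<ge> t1 * h"
    proof -
      have "t0 * (3 + \<bar>t\<bar>) \<le> 3 * \<bar>t\<bar> + 1 * \<bar>t\<bar>"
        unfolding distrib_left using s t0 by (intro add_mono mult_right_mono) (auto simp: t_def)
      then show ?thesis by (simp add: t1_def h_def ht_def t_def)
    qed
    have z0: "norm (zeta_reg (Complex \<sigma> 0)) \<le> 9 * C"
    proof -
      have "norm (zeta_reg (Complex \<sigma> 0)) \<le> C * ht (Complex \<sigma> 0) powr (1 + 2 * e)"
        using s e by (intro C) (auto simp: \<sigma>_def)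
      also have "ht (Complex \<sigma> 0) = 3" by (simp add: ht_def)
      also have "C * 3 powr (1 + 2 * e) \<le> C * 3 powr 2" using e C by (intro mult_left_mono powr_mono) auto
      finally show ?thesis by simp
    qed
    have z2: "norm (zeta_reg (Complex \<sigma> (2 * t))) \<le> 4 * C * h powr (1 + 2 * e)"
    proof -
      have "norm (zeta_reg (Complex \<sigma> (2 * t))) \<le> C * ht (Complex \<sigma> (2 * t)) powr (1 + 2 * e)"
        using s e by (intro C) (auto simp: \<sigma>_def)
      also have "\<dots> \<le> C * (2 * h) powr (1 + 2 * e)"
        using e C by (intro mult_left_mono powr_mono2) (auto simp: ht_def h_def t_def)
      also have "\<dots> = C * (2 powr (1 + 2 * e) * h powr (1 + 2 * e))" using h3 by (simp add: powr_mult)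
      also have "\<dots> \<le> C * (2 powr 2 * h powr (1 + 2 * e))"
        using e C by (intro mult_left_mono mult_right_mono powr_mono) auto
      finally show ?thesis by simp
    qed
    have zr: "norm (zeta u) = norm (zeta_reg u) / norm (u - 1)" if "Re u > 1" for u
    proof -
      have "u \<noteq> 1" using that by auto
      then show ?thesis using zeta_reg_eq_zeta[OF that] by (simp add: norm_mult)
    qed
    define x where "x = norm (zeta_reg s)"
    have "1 \<le> norm (zeta (Complex \<sigma> 0)) ^ 3 * norm (zeta (Complex \<sigma> t)) ^ 4 * norm (zeta (Complex \<sigma> (2 * t)))"
      using three_four_one[of \<sigma> t] s by (simp add: \<sigma>_def)
    also have "\<dots> \<le> (9 * C / (\<sigma> - 1)) ^ 3 * (x / (t1 * h)) ^ 4 * (4 * C * h powr (1 + 2 * e) / (t1 * h))"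
    proof (intro mult_mono power_mono)
      have "norm (zeta (Complex \<sigma> 0)) = norm (zeta_reg (Complex \<sigma> 0)) / (\<sigma> - 1)"
        using s by (subst zr) (auto simp: \<sigma>_def cmod_def complex_eq_iff)
      also have "\<dots> \<le> 9 * C / (\<sigma> - 1)" using z0 s by (intro divide_right_mono) (auto simp: \<sigma>_def)
      finally show "norm (zeta (Complex \<sigma> 0)) \<le> 9 * C / (\<sigma> - 1)" .
      have t1h: "t1 * h > 0" using t0 h3 by (auto simp: t1_def)
      have "norm (s - 1) \<ge> t1 * h" using abs_Im_le_cmod[of "s - 1"] th by (simp add: t_def)
      then have "norm (zeta_reg s) / norm (s - 1) \<le> x / (t1 * h)"
        using t1h by (intro frac_le) (auto simp: x_def)
      then show "norm (zeta (Complex \<sigma> t)) \<le> x / (t1 * h)"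
        unfolding seq[symmetric] using s by (subst zr) auto
      have "norm (Complex \<sigma> (2 * t) - 1) \<ge> t1 * h"
        using abs_Im_le_cmod[of "Complex \<sigma> (2 * t) - 1"] th by simp
      then have "norm (zeta_reg (Complex \<sigma> (2 * t))) / norm (Complex \<sigma> (2 * t) - 1) \<le> 4 * C * h powr (1 + 2 * e) / (t1 * h)"
        using t1h z2 C by (intro frac_le) auto
      then show "norm (zeta (Complex \<sigma> (2 * t))) \<le> 4 * C * h powr (1 + 2 * e) / (t1 * h)"
        using s by (subst zr) (auto simp: \<sigma>_def)
    qed (use C h3 t0 s in \<open>auto simp: x_def t1_def \<sigma>_def\<close>)
    also have "\<dots> = x ^ 4 * h powr (1 + 2 * e) / (K1 * (\<sigma> - 1) ^ 3 * h ^ 5)"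
      using C t0 by (simp add: K1_def t1_def power_divide power_mult_distrib eval_nat_numeral mult_ac)
    finally have "K1 * (\<sigma> - 1) ^ 3 * h ^ 5 \<le> x ^ 4 * h powr (1 + 2 * e)"
      using K1 s h3 by (simp add: pos_le_divide_eq \<sigma>_def)
    moreover have "h ^ 5 = h powr (4 - 2 * e) * h powr (1 + 2 * e)"
      using h3 by (simp flip: powr_add)
    ultimately have "(K1 * (\<sigma> - 1) ^ 3 * h powr (4 - 2 * e)) * h powr (1 + 2 * e) \<le> x ^ 4 * h powr (1 + 2 * e)"
      by (simp add: mult.assoc)
    then have main: "K1 * (\<sigma> - 1) ^ 3 * h powr (4 - 2 * e) \<le> x ^ 4"
      using h3 by (subst (asm) mult_le_cancel_right_pos) auto
    have "(K1 powr (1/4) * (\<sigma> - 1) powr (3/4) * h powr (1 - e / 2)) ^ 4 = K1 * (\<sigma> - 1) ^ 3 * h powr (4 - 2 * e)"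
    proof -
      have "(K1 powr (1/4)) ^ 4 = K1" using K1 by (rule power4_powr_quarter)
      moreover have "((\<sigma> - 1) powr (3/4)) ^ 4 = (\<sigma> - 1) ^ 3"
        using s by (intro power4_powr_quarter) (auto simp: \<sigma>_def)
      moreover have "(h powr (1 - e / 2)) ^ 4 = h powr (4 - 2 * e)"
        using h3 by (simp add: powr_power algebra_simps)
      ultimately show ?thesis by (simp add: power_mult_distrib)
    qed
    with main have "(K1 powr (1/4) * (\<sigma> - 1) powr (3/4) * h powr (1 - e / 2)) ^ 4 \<le> x ^ 4" by simp
    \<comment> \<open>The rule speaks of exponents \<open>Suc n\<close>, so n = 3 stands for a
      fourth power.\<close>
    then have "K1 powr (1/4) * (\<sigma> - 1) powr (3/4) * h powr (1 - e / 2) \<le> x"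
      by (rule power_le_imp_le_base[of _ 3, simplified]) (simp add: x_def)
    then show "norm (zeta_reg s) \<ge> K1 powr (1/4) * (Re s - 1) powr (3/4) * ht s powr (1 - e / 2)"
      by (simp add: x_def \<sigma>_def h_def)
  qed
qed

text \<open>Right of 1 + \<kappa> the 3-4-1 bound applies directly. Further left, down to 1 -
  \<kappa>, the value differs from that at 1 + \<kappa> by at most 2 \<kappa> C h^(1 + 2e), while
  the value at 1 + \<kappa> is at least K \<kappa>^(3/4) h^(1 - e/2). With \<kappa> = c' h^(-10e)
  both are multiples of h^(1 - 8e), and for small c' the difference is the smaller one, since c' =
  c'^(3/4) c'^(1/4). This balance is the origin of 10e and 8e.\<close>

lemma zeta_reg_lower:
  assumes e: "0 < e" "e \<le> 1/2"
  obtains c where "0 < c" "c \<le> e / 2"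
    "\<And>s. 1 - c * ht s powr (- 10 * e) \<le> Re s \<Longrightarrow> Re s \<le> 1 + c \<Longrightarrow> norm (zeta_reg s) \<ge> c * ht s powr (1 - 8 * e)"
proof -
  from deriv_zeta_reg_bound[OF e] obtain C where C: "C \<ge> 1"
    "\<And>s. 1 - e \<le> Re s \<Longrightarrow> Re s \<le> 3 \<Longrightarrow> norm (zeta_reg s) \<le> C * ht s powr (1 + 2 * e)"
    "\<And>s. 1 - e / 2 \<le> Re s \<Longrightarrow> Re s \<le> 2 \<Longrightarrow> norm (deriv zeta_reg s) \<le> C * ht s powr (1 + 2 * e)"
    by blast
  define r0 where "r0 = min (e / 2) (1 / (32 * C))"
  have r0: "0 < r0" "r0 \<le> e / 2" "16 * C * r0 \<le> 1 / 2" "r0 \<le> 1"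
  proof -
    have "16 * C * r0 \<le> 16 * C * (1 / (32 * C))"
      unfolding r0_def using C by (intro mult_left_mono) auto
    then show "16 * C * r0 \<le> 1 / 2" using C by simp
  qed (use e C in \<open>auto simp: r0_def\<close>)
  define t0 where "t0 = r0 / 2"
  have t0: "0 < t0" "t0 \<le> 1" using r0 by (auto simp: t0_def)
  from zeta_reg_341[OF e C(1,2) t0] obtain K where K: "K > 0"
    "\<And>s. 1 < Re s \<Longrightarrow> Re s \<le> 2 \<Longrightarrow> \<bar>Im s\<bar> \<ge> t0 \<Longrightarrow>
       norm (zeta_reg s) \<ge> K * (Re s - 1) powr (3/4) * ht s powr (1 - e / 2)"
    by blast
  \<comment> \<open>The first entry keeps low points of the region inside the disc around 1 where
    \<open>zeta_reg\<close> is near 1; the second makes the variation at most half of the lower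
    bound, 2 C c'^(1/4) \<le> K / 2.\<close>
  define c' where "c' = min (r0 / 2) ((K / (4 * C)) ^ 4)"
  have c': "0 < c'" "c' \<le> r0 / 2" "2 * C * c' powr (1/4) \<le> K / 2"
  proof -
    have "c' powr (1/4) \<le> ((K / (4 * C)) ^ 4) powr (1/4)"
      unfolding c'_def using K C r0 by (intro powr_mono2) auto
    also have "\<dots> = K / (4 * C)" using K C by (intro power4_powr_quarter) auto
    finally have "2 * C * c' powr (1/4) \<le> 2 * C * (K / (4 * C))" using C by (intro mult_left_mono) auto
    then show "2 * C * c' powr (1/4) \<le> K / 2" using C by simp
  qed (use K C r0 in \<open>auto simp: c'_def\<close>)
  define c where "c = Min {c', K / 2 * c' powr (3/4), 1 / 8}"
  have c: "0 < c" "c \<le> c'" "c \<le> K / 2 * c' powr (3/4)" "c \<le> 1 / 8" using c' K by (auto simp: c_def)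
  show thesis
  proof (rule that[of c])
    show "c > 0" "c \<le> e / 2" using c c' r0 by auto
    fix s assume s: "1 - c * ht s powr (- 10 * e) \<le> Re s" "Re s \<le> 1 + c"
    define h where "h = ht s"
    have h3: "h \<ge> 3" by (simp add: h_def)
    have hle1: "h powr (- 10 * e) \<le> 1" using h3 e by (simp add: powr_le_one_le ge_one_powr_ge_zero powr_minus field_simps)
    have cge: "1 - c \<le> Re s"
    proof -
      have "c * h powr (- 10 * e) \<le> c * 1" using c hle1 by (intro mult_left_mono) auto
      then show ?thesis using s by (simp add: h_def)
    qed
    show "norm (zeta_reg s) \<ge> c * ht s powr (1 - 8 * e)"
    \<comment> \<open>At small height the 3-4-1 bound is spoiled by the pole; there s is close to 1,
      and \<open>zeta_reg 1 = 1\<close> gives the lower bound 1/2.\<close>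
    proof (cases "\<bar>Im s\<bar> \<ge> t0")
      case False
      have "norm (s - 1) \<le> \<bar>Re (s - 1)\<bar> + \<bar>Im (s - 1)\<bar>" by (rule cmod_le)
      also have "\<dots> \<le> r0 / 2 + r0 / 2"
      proof (intro add_mono)
        show "\<bar>Re (s - 1)\<bar> \<le> r0 / 2" unfolding abs_le_iff using cge s(2) c(2) c'(2) by simp
        show "\<bar>Im (s - 1)\<bar> \<le> r0 / 2" using False by (simp add: t0_def)
      qed
      finally have ns: "norm (s - 1) \<le> r0" by simp
      then have "norm (zeta_reg s - 1) \<le> 16 * C * norm (s - 1)"
        using r0 by (intro zeta_reg_near_1[OF e C(1,3)]) auto
      also have "\<dots> \<le> 16 * C * r0" using ns C by (intro mult_left_mono) auto
      also have "\<dots> \<le> 1/2" by (rule r0)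
      finally have "norm (zeta_reg s) \<ge> 1/2"
        using norm_triangle_ineq2[of 1 "1 - zeta_reg s"] by (simp add: norm_minus_commute)
      moreover have "c * h powr (1 - 8 * e) \<le> 1/8 * 4"
      proof (intro mult_mono)
        have "h powr (1 - 8 * e) \<le> h powr 1" using h3 e by (intro powr_mono) auto
        also have "\<dots> \<le> 4" using False t0 h3 by (simp add: h_def ht_def)
        finally show "h powr (1 - 8 * e) \<le> 4" .
      qed (use c in auto)
      ultimately show ?thesis by (simp add: h_def)
    next
      case True
      define \<kappa> where "\<kappa> = c' * h powr (- 10 * e)"
      have \<kappa>: "0 < \<kappa>" "\<kappa> \<le> c'" using c' h3 hle1 by (auto simp: \<kappa>_def mult_le_cancel_left1)
      have \<kappa>34: "\<kappa> powr (3/4) * h powr (1 - e / 2) = c' powr (3/4) * h powr (1 - 8 * e)"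
        using c' h3 by (simp add: \<kappa>_def powr_mult powr_powr mult.assoc algebra_simps flip: powr_add)
      show ?thesis
      proof (cases "Re s \<ge> 1 + \<kappa>")
        case big: True
        have "c * h powr (1 - 8 * e) \<le> (K / 2 * c' powr (3/4)) * h powr (1 - 8 * e)"
          using c by (intro mult_right_mono) auto
        also have "\<dots> \<le> K * (c' powr (3/4) * h powr (1 - 8 * e))"
          using K by simp
        also have "\<dots> = K * (\<kappa> powr (3/4) * h powr (1 - e / 2))" by (simp only: \<kappa>34)
        also have "\<dots> \<le> K * ((Re s - 1) powr (3/4) * h powr (1 - e / 2))"
          using K big \<kappa> by (intro mult_left_mono mult_right_mono powr_mono2) auto
        also have "\<dots> \<le> norm (zeta_reg s)"
          using K(2)[of s] big \<kappa> True s c by (simp add: h_def mult.assoc)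
        finally show ?thesis by (simp add: h_def)
      next
        case small: False
        define s1 where "s1 = Complex (1 + \<kappa>) (Im s)"
        have ht1: "ht s1 = h" by (simp add: s1_def ht_def h_def)
        have kle: "\<kappa> \<le> 1/4" using \<kappa> c' r0 e by auto
        have "K * (\<kappa> powr (3/4) * h powr (1 - e / 2)) \<le> norm (zeta_reg s1)"
          using K(2)[of s1] \<kappa> True kle ht1 by (simp add: s1_def mult.assoc)
        then have low1: "K * (c' powr (3/4) * h powr (1 - 8 * e)) \<le> norm (zeta_reg s1)"
          by (simp only: \<kappa>34)
        have chk: "c * h powr (- 10 * e) \<le> \<kappa>" unfolding \<kappa>_def using c by (intro mult_right_mono) auto
        have dist: "norm (s1 - s) \<le> 2 * \<kappa>"
        proof -
          have "s1 - s = of_real (1 + \<kappa> - Re s)" by (simp add: s1_def complex_eq_iff)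
          then have "norm (s1 - s) = \<bar>1 + \<kappa> - Re s\<bar>" by (simp only: norm_of_real)
          also have "\<dots> \<le> 2 * \<kappa>" using small s chk by (auto simp: h_def)
          finally show ?thesis .
        qed
        have seg: "1 - e / 2 \<le> Re w \<and> Re w \<le> 2 \<and> ht w = h" if w: "w \<in> closed_segment s s1" for w
        proof -
          from w obtain u where u: "0 \<le> u" "u \<le> 1" "w = (1 - u) *\<^sub>R s + u *\<^sub>R s1"
            by (auto simp: in_segment)
          have "Re w = (1 - u) * Re s + u * Re s1" "Im w = Im s"
            unfolding u(3) by (simp_all add: s1_def algebra_simps)
          moreover have "(1 - u) * Re s + u * Re s1 \<le> (1 - u) * 2 + u * 2"
            using u small kle by (intro add_mono mult_left_mono) (auto simp: s1_def)
          moreover have "(1 - u) * Re s + u * Re s1 \<ge> (1 - u) * (1 - e / 2) + u * (1 - e / 2)"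
            using u cge c c' r0 \<kappa> e by (intro add_mono mult_left_mono) (auto simp: s1_def)
          moreover have "(1 - u) * (1 - e / 2) + u * (1 - e / 2) = 1 - e / 2" "(1 - u) * 2 + u * 2 = 2"
            by (simp_all flip: distrib_right)
          ultimately show ?thesis by (simp only: ht_def h_def)
        qed
        have "norm (zeta_reg s1 - zeta_reg s) \<le> (C * h powr (1 + 2 * e)) * norm (s1 - s)"
        proof (rule zeta_reg_diff_bound[of "closed_segment s s1"])
          show "closed_segment s s1 \<subseteq> {s. Re s > 0}" using seg e by force
          show "norm (deriv zeta_reg w) \<le> C * h powr (1 + 2 * e)" if "w \<in> closed_segment s s1" for w
            using C(3)[of w] seg[OF that] by auto
        qed auto
        also have "\<dots> \<le> (C * h powr (1 + 2 * e)) * (2 * \<kappa>)"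
          using dist C by (intro mult_left_mono) auto
        also have "\<dots> = 2 * C * (c' powr (3/4) * c' powr (1/4)) * (h powr (1 + 2 * e) * h powr (- 10 * e))"
          using c' by (simp add: \<kappa>_def flip: powr_add)
        also have "h powr (1 + 2 * e) * h powr (- 10 * e) = h powr (1 - 8 * e)"
          by (simp flip: powr_add)
        also have "2 * C * (c' powr (3/4) * c' powr (1/4)) * h powr (1 - 8 * e)
            = (2 * C * c' powr (1/4)) * (c' powr (3/4) * h powr (1 - 8 * e))" by simp
        also have "\<dots> \<le> (K / 2) * (c' powr (3/4) * h powr (1 - 8 * e))"
          using c' by (intro mult_right_mono) auto
        finally have "norm (zeta_reg s1 - zeta_reg s) \<le> (K / 2) * (c' powr (3/4) * h powr (1 - 8 * e))" .
        with low1 have "(K / 2) * (c' powr (3/4) * h powr (1 - 8 * e)) \<le> norm (zeta_reg s)"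
          using norm_triangle_ineq2[of "zeta_reg s1" "zeta_reg s"] by (simp add: norm_minus_commute)
        moreover have "c * h powr (1 - 8 * e) \<le> (K / 2 * c' powr (3/4)) * h powr (1 - 8 * e)"
          using c by (intro mult_right_mono) auto
        ultimately show ?thesis unfolding h_def[symmetric] by (simp only: mult.assoc)
      qed
    qed
  qed
qed

section \<open>Higher prime powers, the pole at 1, and the prime series\<close>

definition prime_power_term :: "nat \<Rightarrow> complex \<Rightarrow> complex" where
  "prime_power_term m s = (if prime (Suc m) then
     of_real (ln (real (Suc m))) * cpow (real (Suc m)) s ^ 2 / (1 - cpow (real (Suc m)) s) else 0)"

text \<open>The sum of ln p * p^(-j s) over primes p and j \<ge> 2, with the geometric series in j
  already summed: the difference between - zeta' / zeta and the sum over the primes alone.\<close>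

definition prime_power_part :: "complex \<Rightarrow> complex" where
  "prime_power_part s = (\<Sum>m. prime_power_term m s)"

lemma prime_power_term_bound:
  assumes s: "Re s \<ge> 3/4"
  shows "norm (prime_power_term m s) \<le> 16 * real (Suc m) powr (- 1 - 1/4)"
proof (cases "prime (Suc m)")
  case True
  define n where "n = real (Suc m)"
  have n: "n \<ge> 2" using prime_ge_2_nat[OF True] by (simp add: n_def)
  \<comment> \<open>At Re s \<ge> 3/4 the square decays like n^(-3/2), so an allowance of n^(1/4)
    for the logarithm still leaves the summable exponent -5/4.\<close>
  have ln: "ln n \<le> 4 * n powr (1/4)" using ln_powr_bound[of n "1/4"] n by simp
  have np: "norm (cpow n s) \<le> n powr (- 3/4)" using n s by (subst norm_cpow) (auto intro: powr_mono)
  have "n powr (- 3/4) \<le> 2 powr (- 3/4)" using n by (intro powr_mono2') auto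
  also have "\<dots> \<le> 2 powr (- 1/2)" by (intro powr_mono) auto
  also have "\<dots> = 1 / sqrt 2" by (simp add: powr_minus_divide powr_half_sqrt)
  also have "\<dots> \<le> 3 / 4"
    using real_le_rsqrt[of "4/3" 2] by (simp add: field_simps power2_eq_square)
  finally have "norm (cpow n s) \<le> 3/4" using np by simp
  then have den: "norm (1 - cpow n s) \<ge> 1/4"
    using norm_triangle_ineq2[of 1 "cpow n s"] by simp
  have "norm (prime_power_term m s) = ln n * norm (cpow n s) ^ 2 / norm (1 - cpow n s)"
    using True n by (simp add: prime_power_term_def n_def norm_mult norm_divide norm_power)
  also have "\<dots> \<le> (4 * n powr (1/4)) * (n powr (- 3/4)) ^ 2 / (1/4)"
    using n ln np den by (intro frac_le mult_mono power_mono) auto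
  also have "\<dots> = 16 * (n powr (1/4) * n powr (- 3/2))"
    using n by (simp add: powr_power)
  also have "n powr (1/4) * n powr (- 3/2) = n powr (- 1 - 1/4)"
    by (simp flip: powr_add)
  finally show ?thesis by (simp add: n_def)
qed (simp add: prime_power_term_def)

lemma summable_prime_power_term:
  assumes "Re s \<ge> 3/4"
  shows "summable (\<lambda>m. norm (prime_power_term m s))" "summable (\<lambda>m. prime_power_term m s)"
proof -
  have "summable (\<lambda>m. 16 * real (Suc m) powr (- 1 - 1/4))"
    by (intro summable_mult summable_Suc_powr) auto
  then show "summable (\<lambda>m. norm (prime_power_term m s))"
    by (rule summable_comparison_test') (use prime_power_term_bound[OF assms] in auto)
  then show "summable (\<lambda>m. prime_power_term m s)" by (rule summable_norm_cancel)
qed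

lemma prime_power_part_bound:
  obtains C where "C \<ge> 0" "\<And>s. Re s \<ge> 3/4 \<Longrightarrow> norm (prime_power_part s) \<le> C"
proof (rule that)
  have sm: "summable (\<lambda>m. 16 * real (Suc m) powr (- 1 - 1/4))"
    by (intro summable_mult summable_Suc_powr) auto
  then show "(\<Sum>m. 16 * real (Suc m) powr (- 1 - 1/4)) \<ge> 0" by (intro suminf_nonneg) auto
  fix s assume s: "Re s \<ge> 3/4"
  have "norm (prime_power_part s) \<le> (\<Sum>m. norm (prime_power_term m s))"
    unfolding prime_power_part_def by (intro summable_norm summable_prime_power_term s)
  also have "\<dots> \<le> (\<Sum>m. 16 * real (Suc m) powr (- 1 - 1/4))"
    by (intro suminf_le prime_power_term_bound s summable_prime_power_term sm)
  finally show "norm (prime_power_part s) \<le> (\<Sum>m. 16 * real (Suc m) powr (- 1 - 1/4))" .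
qed

lemma prime_power_part_holomorphic: "prime_power_part holomorphic_on {s. Re s > 3/4}"
  unfolding prime_power_part_def
proof (rule holomorphic_suminf[OF open_halfplane])
  show "prime_power_term m holomorphic_on {s. Re s > 3/4}" for m
  proof (cases "prime (Suc m)")
    case True
    then have "real (Suc m) > 1" using prime_gt_1_nat[OF True] by simp
    then have "1 - cpow (real (Suc m)) s \<noteq> 0" if "Re s > 3/4" for s
      using cpow_neq_1(2)[of "real (Suc m)" s] that by auto
    then have "(\<lambda>s. of_real (ln (real (Suc m))) * cpow (real (Suc m)) s ^ 2 / (1 - cpow (real (Suc m)) s)) holomorphic_on {s. Re s > 3/4}"
      by (intro holomorphic_intros) auto
    then show ?thesis using True by (simp add: prime_power_term_def[abs_def])
  qed (simp add: prime_power_term_def[abs_def])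
  fix z assume z: "z \<in> {s. Re s > 3/4}"
  then obtain d where d: "d > 0" "cball z d \<subseteq> {s. Re s > 3/4}"
    using open_contains_cball open_halfplane by blast
  then show "\<exists>d>0. \<exists>M. cball z d \<subseteq> {s. Re s > 3/4} \<and> summable M \<and> (\<forall>n. \<forall>w\<in>cball z d. norm (prime_power_term n w) \<le> M n)"
  proof (intro exI conjI ballI allI)
    show "summable (\<lambda>m. 16 * real (Suc m) powr (- 1 - 1/4))"
      by (intro summable_mult summable_Suc_powr) auto
    show "norm (prime_power_term n w) \<le> 16 * real (Suc n) powr (- 1 - 1/4)" if "w \<in> cball z d" for n w
      using d that by (intro prime_power_term_bound) force
  qed (use d in auto)
qed

text \<open>\<open>\<zeta>(s) - 1 / (s - 1)\<close>, with the removable singularity at \<open>1\<close> filled in.\<close>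

definition zeta_regular_part :: "complex \<Rightarrow> complex" where
  "zeta_regular_part s = (if s = 1 then deriv zeta_reg 1 else (zeta_reg s - 1) / (s - 1))"

lemma zeta_regular_part_holomorphic: "zeta_regular_part holomorphic_on {s. Re s > 0}"
  using pole_lemma_open[OF zeta_reg_holomorphic open_halfplane, of 1]
  unfolding zeta_regular_part_def[abs_def] zeta_reg_1 .

text \<open>Near 1 this is a difference quotient of \<open>zeta_reg\<close>; away from 1, |s - 1| is
  at least a multiple of \<open>ht s\<close>, so the division removes one power and leaves the
  exponent 2e. It is relaxed to 10e to match the logarithmic derivative.\<close>

lemma zeta_regular_part_bound:
  assumes e: "0 < e" "e \<le> 1/2"
  obtains C where "C \<ge> 1" "\<And>s. 1 - e / 2 \<le> Re s \<Longrightarrow> Re s \<le> 2 \<Longrightarrow> norm (zeta_regular_part s) \<le> C * ht s powr (10 * e)"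
proof -
  from deriv_zeta_reg_bound[OF e] obtain C where C: "C \<ge> 1"
    "\<And>s. 1 - e \<le> Re s \<Longrightarrow> Re s \<le> 3 \<Longrightarrow> norm (zeta_reg s) \<le> C * ht s powr (1 + 2 * e)"
    "\<And>s. 1 - e / 2 \<le> Re s \<Longrightarrow> Re s \<le> 2 \<Longrightarrow> norm (deriv zeta_reg s) \<le> C * ht s powr (1 + 2 * e)"
    by blast
  define C' where "C' = 16 * C / e"
  have C'16: "C' \<ge> 16 * C"
    using e C mult_mono[of 1 "1/e" "16 * C" "16 * C"] by (simp add: C'_def)
  show thesis
  proof (rule that[of C'])
    show "C' \<ge> 1" using C C'16 by simp
    fix s assume s: "1 - e / 2 \<le> Re s" "Re s \<le> 2"
    have h10: "1 \<le> ht s powr (10 * e)" using e by (intro ge_one_powr_ge_zero) auto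
    consider "s = 1" | "s \<noteq> 1" "norm (s - 1) \<le> e / 2" | "norm (s - 1) > e / 2" by linarith
    then show "norm (zeta_regular_part s) \<le> C' * ht s powr (10 * e)"
    proof cases
      case 1
      have "norm (zeta_regular_part s) \<le> C * 3 powr (1 + 2 * e)"
        using C(3)[of 1] e 1 by (simp add: zeta_regular_part_def ht_def)
      also have "\<dots> \<le> C * 3 powr 2" using e C by (intro mult_left_mono powr_mono) auto
      also have "\<dots> \<le> C' * 1" using C'16 C by simp
      also have "\<dots> \<le> C' * ht s powr (10 * e)" using h10 C'16 C by (intro mult_left_mono) auto
      finally show ?thesis .
    next
      case 2
      have "norm (zeta_regular_part s) = norm (zeta_reg s - 1) / norm (s - 1)"
        using 2 by (simp add: zeta_regular_part_def norm_divide)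
      also have "\<dots> \<le> 16 * C * norm (s - 1) / norm (s - 1)"
        by (intro divide_right_mono zeta_reg_near_1[OF e C(1,3)] 2) auto
      also have "\<dots> \<le> C' * 1" using 2 C'16 by simp
      also have "\<dots> \<le> C' * ht s powr (10 * e)" using h10 C'16 C by (intro mult_left_mono) auto
      finally show ?thesis .
    next
      case 3
      have big: "norm (s - 1) \<ge> e / 8 * ht s"
      proof (cases "\<bar>Im s\<bar> \<ge> 1")
        case True
        have "e / 8 * ht s \<le> 1 / 4 * (4 * \<bar>Im s\<bar>)"
          using True e by (intro mult_mono) (auto simp: ht_def)
        also have "\<dots> \<le> norm (s - 1)" using abs_Im_le_cmod[of "s - 1"] by simp
        finally show ?thesis .
      next
        case False
        have "e / 8 * ht s \<le> e / 8 * 4" using False e by (intro mult_left_mono) (auto simp: ht_def)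
        then show ?thesis using 3 by simp
      qed
      have s1: "s \<noteq> 1" using 3 e by auto
      have one: "1 \<le> ht s powr (1 + 2 * e)" using e by (intro ge_one_powr_ge_zero) auto
      have "norm (zeta_reg s - 1) \<le> norm (zeta_reg s) + 1"
        using norm_triangle_ineq4[of "zeta_reg s" 1] by simp
      also have "\<dots> \<le> C * ht s powr (1 + 2 * e) + C * ht s powr (1 + 2 * e)"
        using C(1) C(2)[of s] s e one mult_mono[of 1 C 1 "ht s powr (1 + 2 * e)"] by (intro add_mono) auto
      finally have num: "norm (zeta_reg s - 1) \<le> 2 * C * ht s powr (1 + 2 * e)" by simp
      have "norm (zeta_regular_part s) = norm (zeta_reg s - 1) / norm (s - 1)"
        using s1 by (simp add: zeta_regular_part_def norm_divide)
      also have "\<dots> \<le> 2 * C * ht s powr (1 + 2 * e) / (e / 8 * ht s)"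
        using num big e C(1) by (intro frac_le) auto
      also have "\<dots> = C' * (ht s powr (1 + 2 * e) / ht s powr 1)"
        using e by (simp add: C'_def field_simps)
      also have "ht s powr (1 + 2 * e) / ht s powr 1 = ht s powr (2 * e)" by (simp only: powr_diff[symmetric]) simp
      also have "C' * ht s powr (2 * e) \<le> C' * ht s powr (10 * e)"
        using e C'16 C by (intro mult_left_mono powr_mono) auto
      finally show ?thesis .
    qed
  qed
qed

text \<open>For \<open>Re s > 1\<close> this is the Dirichlet series with coefficients \<open>(if prime n then ln n else 0) - 1\<close>:
  the poles of \<open>- \<zeta>' / \<zeta>\<close> and \<open>\<zeta>\<close> at \<open>1\<close> cancel.\<close>

definition prime_series :: "complex \<Rightarrow> complex" where
  "prime_series s = - deriv zeta_reg s / zeta_reg s - prime_power_part s - zeta_regular_part s"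

text \<open>On the zero-free region the logarithmic derivative is at most a multiple of h^(1 + 2e) /
  h^(1 - 8e) = h^(10e). Discs of radius proportional to h^(-10e) fit inside the region, so Cauchy's
  estimate charges h^(10e) per derivative, h^(10e (K + 1)) in all.\<close>

lemma prime_series_higher_deriv_bound:
  fixes K :: nat
  obtains C c where "C > 0" "c > 0"
    "\<And>s. 1 \<le> Re s \<Longrightarrow> Re s \<le> 1 + c \<Longrightarrow> norm ((deriv ^^ K) prime_series s) \<le> C * ht s powr (1/2)"
proof -
  \<comment> \<open>Chosen so that 10e (K + 1) = 1/2, a growth that stays integrable against the
    Fejer kernel.\<close>
  define e where "e = 1 / (20 * (real K + 1))"
  have e: "0 < e" "e \<le> 1/2" "10 * e \<le> 1/2" "10 * e * (real K + 1) = 1/2"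
    by (auto simp: e_def field_simps)
  from deriv_zeta_reg_bound[OF e(1,2)] obtain C1 where C1: "C1 \<ge> 1"
    "\<And>s. 1 - e \<le> Re s \<Longrightarrow> Re s \<le> 3 \<Longrightarrow> norm (zeta_reg s) \<le> C1 * ht s powr (1 + 2 * e)"
    "\<And>s. 1 - e / 2 \<le> Re s \<Longrightarrow> Re s \<le> 2 \<Longrightarrow> norm (deriv zeta_reg s) \<le> C1 * ht s powr (1 + 2 * e)"
    by blast
  from zeta_reg_lower[OF e(1,2)] obtain c where c: "0 < c" "c \<le> e / 2"
    "\<And>s. 1 - c * ht s powr (- 10 * e) \<le> Re s \<Longrightarrow> Re s \<le> 1 + c \<Longrightarrow> norm (zeta_reg s) \<ge> c * ht s powr (1 - 8 * e)"
    by blast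
  from prime_power_part_bound obtain C2 where C2: "C2 \<ge> 0" "\<And>s. Re s \<ge> 3/4 \<Longrightarrow> norm (prime_power_part s) \<le> C2" by blast
  from zeta_regular_part_bound[OF e(1,2)] obtain C3 where C3: "C3 \<ge> 1"
    "\<And>s. 1 - e / 2 \<le> Re s \<Longrightarrow> Re s \<le> 2 \<Longrightarrow> norm (zeta_regular_part s) \<le> C3 * ht s powr (10 * e)" by blast
  define C where "C = C1 / c + C2 + C3"
  have Cpos: "C > 0" using C1 c C2 C3 by (auto simp: C_def intro!: add_pos_nonneg add_nonneg_pos)
  have hp: "ht s powr (- 10 * e) \<le> 1" for s
  proof -
    have "ht s powr (- 10 * e) \<le> ht s powr 0" using e by (intro powr_mono) auto
    then show ?thesis by simp
  qed
  have cc: "c * ht s powr (- 10 * e) \<le> c" for s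
    using mult_left_mono[OF hp, of c s] c by simp
  have reg: "1 - e / 2 \<le> Re s \<and> Re s \<le> 2 \<and> Re s > 3/4 \<and> zeta_reg s \<noteq> 0 \<and> norm (prime_series s) \<le> C * ht s powr (10 * e)"
    if s: "1 - c * ht s powr (- 10 * e) \<le> Re s" "Re s \<le> 1 + c" for s
  proof (intro conjI)
    have a: "Re s \<ge> 1 - c" using s(1) cc[of s] by linarith
    then show b: "1 - e / 2 \<le> Re s" "Re s \<le> 2" "Re s > 3/4" using s(2) c(2) e by auto
    have low: "norm (zeta_reg s) \<ge> c * ht s powr (1 - 8 * e)" by (rule c(3)[OF s])
    have pos: "c * ht s powr (1 - 8 * e) > 0" using c by (simp add: ht_def)
    show nz: "zeta_reg s \<noteq> 0" using low pos by auto
    have "norm (deriv zeta_reg s / zeta_reg s) \<le> (C1 * ht s powr (1 + 2 * e)) / (c * ht s powr (1 - 8 * e))"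
      unfolding norm_divide using low pos C1 b by (intro frac_le C1(3)) auto
    also have "\<dots> = C1 / c * (ht s powr (1 + 2 * e) / ht s powr (1 - 8 * e))" by simp
    also have "ht s powr (1 + 2 * e) / ht s powr (1 - 8 * e) = ht s powr (10 * e)" by (simp flip: powr_diff)
    finally have 1: "norm (deriv zeta_reg s / zeta_reg s) \<le> C1 / c * ht s powr (10 * e)" .
    have "norm (prime_power_part s) \<le> C2 * 1" using C2(2) b by simp
    also have "\<dots> \<le> C2 * ht s powr (10 * e)" using C2 e by (intro mult_left_mono ge_one_powr_ge_zero) auto
    finally have 2: "norm (prime_power_part s) \<le> C2 * ht s powr (10 * e)" .
    have "norm (prime_series s) \<le> norm (deriv zeta_reg s / zeta_reg s) + norm (prime_power_part s) + norm (zeta_regular_part s)"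
      unfolding prime_series_def
      using norm_triangle_ineq4[of "- deriv zeta_reg s / zeta_reg s - prime_power_part s" "zeta_regular_part s"]
        norm_triangle_ineq4[of "- deriv zeta_reg s / zeta_reg s" "prime_power_part s"] by simp
    also have "\<dots> \<le> C1 / c * ht s powr (10 * e) + C2 * ht s powr (10 * e) + C3 * ht s powr (10 * e)"
      by (intro add_mono 1 2 C3 b)
    finally show "norm (prime_series s) \<le> C * ht s powr (10 * e)" by (simp add: C_def algebra_simps)
  qed
  define D where "D = fact K * (C * 2) / (c / 4) ^ K"
  show thesis
  proof (rule that[of D "c / 2"])
    show "D > 0" "c / 2 > 0" using Cpos c by (auto simp: D_def)
    fix s assume s: "1 \<le> Re s" "Re s \<le> 1 + c / 2"
    define h where "h = ht s"
    have h3: "h \<ge> 3" by (simp add: h_def)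
    \<comment> \<open>On the disc the height at most doubles and 2^(-10e) \<ge> 1/2, so the region
      still has width c h^(-10e) / 2 there; a quarter leaves room.\<close>
    define r where "r = c / 4 * h powr (- 10 * e)"
    have r: "0 < r" "r \<le> c / 4" using c h3 hp[of s] by (auto simp: r_def h_def)
    have r1: "r \<le> 1" using r c e by linarith
    have in_reg: "1 - c * ht w powr (- 10 * e) \<le> Re w \<and> Re w \<le> 1 + c" if w: "w \<in> cball s r" for w
    proof
      have "(2 * h) powr (- 10 * e) \<le> ht w powr (- 10 * e)"
        using ht_cball[OF w r1] e unfolding h_def by (intro powr_mono2') auto
      moreover have "h powr (- 10 * e) / 2 \<le> (2 * h) powr (- 10 * e)"
      proof -
        have "1 / 2 = (2::real) powr (- 1)" by (simp add: powr_minus_divide)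
        also have "\<dots> \<le> 2 powr (- 10 * e)" using e by (intro powr_mono) auto
        finally have "1 / 2 * h powr (- 10 * e) \<le> 2 powr (- 10 * e) * h powr (- 10 * e)"
          by (intro mult_right_mono) auto
        then show ?thesis using h3 by (simp add: powr_mult)
      qed
      ultimately have "h powr (- 10 * e) / 2 \<le> ht w powr (- 10 * e)" by linarith
      then have "c * (h powr (- 10 * e) / 2) \<le> c * ht w powr (- 10 * e)" using c by (intro mult_left_mono) auto
      moreover have "r \<le> c * (h powr (- 10 * e) / 2)" using r(1) by (simp add: r_def)
      ultimately have "r \<le> c * ht w powr (- 10 * e)" by linarith
      then show "1 - c * ht w powr (- 10 * e) \<le> Re w"
        using cball_Re_bounds(1)[OF w] s by linarith
      show "Re w \<le> 1 + c" using cball_Re_bounds(2)[OF w] s r by linarith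
    qed
    have hol: "prime_series holomorphic_on ball s r" "continuous_on (cball s r) prime_series"
    proof -
      \<comment> \<open>Cauchy's estimate asks for continuity up to the boundary of the disc as
        well; both properties come from one open set free of zeros of
        \<open>zeta_reg\<close>.\<close>
      obtain U where U: "open U" "cball s r \<subseteq> U" "U \<subseteq> {s. Re s > 3/4}" "\<And>w. w \<in> U \<Longrightarrow> zeta_reg w \<noteq> 0"
      proof
        show "open ({s. Re s > 3/4} \<inter> zeta_reg -` (- {0}))"
        proof (rule continuous_open_preimage)
          show "continuous_on {s. Re s > 3/4} zeta_reg"
            by (intro holomorphic_on_imp_continuous_on holomorphic_on_subset[OF zeta_reg_holomorphic]) auto
          show "open {s. Re s > 3/4}" by (rule open_halfplane)
        qed auto
        show "cball s r \<subseteq> {s. Re s > 3/4} \<inter> zeta_reg -` (- {0})"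
          using reg in_reg by auto
      qed auto
      have dz: "deriv zeta_reg holomorphic_on U"
        using U by (intro holomorphic_deriv holomorphic_on_subset[OF zeta_reg_holomorphic]) auto
      have U0: "U \<subseteq> {s. Re s > 0}" using U(3) by force
      note z = holomorphic_on_subset[OF zeta_reg_holomorphic U0] holomorphic_on_subset[OF prime_power_part_holomorphic U(3)]
          holomorphic_on_subset[OF zeta_regular_part_holomorphic U0]
      have F: "prime_series holomorphic_on U"
        unfolding prime_series_def[abs_def] by (intro holomorphic_intros dz z U)
      show "prime_series holomorphic_on ball s r"
        by (rule holomorphic_on_subset[OF F subset_trans[OF ball_subset_cball U(2)]])
      show "continuous_on (cball s r) prime_series"
        by (rule continuous_on_subset[OF holomorphic_on_imp_continuous_on[OF F] U(2)])
    qed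
    have "norm ((deriv ^^ K) prime_series s) \<le> fact K * (C * 2 * h powr (10 * e)) / r ^ K"
    proof (rule Cauchy_inequality[OF hol r(1)])
      fix w assume "norm (s - w) = r"
      then have w: "w \<in> cball s r" by (simp add: dist_norm)
      have "norm (prime_series w) \<le> C * ht w powr (10 * e)" using reg in_reg[OF w] by blast
      also have "\<dots> \<le> C * (2 * h) powr (10 * e)"
        using ht_cball[OF w r1] e Cpos unfolding h_def by (intro mult_left_mono powr_mono2) auto
      also have "\<dots> = C * (2 powr (10 * e) * h powr (10 * e))" using h3 by (simp add: powr_mult)
      also have "\<dots> \<le> C * (2 powr 1 * h powr (10 * e))"
        using Cpos e by (intro mult_left_mono mult_right_mono powr_mono) auto
      finally show "norm (prime_series w) \<le> C * 2 * h powr (10 * e)" by simp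
    qed
    also have "r ^ K = (c / 4) ^ K * h powr (- 10 * e * real K)"
      unfolding r_def power_mult_distrib using h3 by (simp add: powr_power mult_ac)
    also have "fact K * (C * 2 * h powr (10 * e)) / ((c / 4) ^ K * h powr (- 10 * e * real K)) =
        D * (h powr (10 * e) / h powr (- 10 * e * real K))" by (simp add: D_def)
    also have "h powr (10 * e) / h powr (- 10 * e * real K) = h powr (10 * e * (real K + 1))"
      by (simp add: algebra_simps flip: powr_diff)
    also have "10 * e * (real K + 1) = 1/2" by (rule e)
    finally show "norm ((deriv ^^ K) prime_series s) \<le> D * ht s powr (1/2)" by (simp add: h_def)
  qed
qed

section \<open>Dirichlet series of the prime series and of its derivatives\<close>

definition prime_coeff :: "nat \<Rightarrow> real" where
  "prime_coeff n = (if prime n then ln (real n) else 0) - 1"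

lemma sum_prime_Suc:
  fixes g :: "nat \<Rightarrow> 'a :: comm_monoid_add"
  shows "(\<Sum>m<M. if prime (Suc m) then g (Suc m) else 0) = (\<Sum>p\<in>primes_le M. g p)"
proof -
  have "(\<Sum>m<M. if prime (Suc m) then g (Suc m) else 0) = (\<Sum>m\<in>{m\<in>{..<M}. prime (Suc m)}. g (Suc m))"
    by (subst sum.inter_filter) auto
  also have "\<dots> = (\<Sum>p\<in>primes_le M. g p)"
  proof (rule sum.reindex_bij_betw[of Suc])
    have "p \<in> Suc ` {m\<in>{..<M}. prime (Suc m)}" if "p \<in> primes_le M" for p
      using that prime_gt_0_nat[of p] by (intro image_eqI[of _ _ "p - 1"]) (auto simp: primes_le_def)
    then have "Suc ` {m\<in>{..<M}. prime (Suc m)} = primes_le M"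
      by (auto simp: primes_le_def)
    then show "bij_betw Suc {m \<in> {..<M}. prime (Suc m)} (primes_le M)"
      by (auto simp: bij_betw_def)
  qed
  finally show ?thesis .
qed

text \<open>For each prime, p^(-s) / (1 - p^(-s)) minus p^(-2s) / (1 - p^(-s)) is p^(-s), so
  removing the prime powers from - zeta' / zeta leaves the primes alone, and removing zeta subtracts
  1 from every coefficient. Passing to \<open>zeta_reg\<close> produces 1 / (s - 1) in both - zeta'
  / zeta and zeta, and these cancel.\<close>

lemma prime_series_sums:
  assumes s: "Re s > 1"
  shows "(\<lambda>m. of_real (prime_coeff (Suc m)) * cpow (real (Suc m)) s) sums prime_series s"
proof -
  let ?c = "\<lambda>p::nat. cpow (real p) s"
  let ?l = "\<lambda>p::nat. complex_of_real (ln (real p))"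
  have s1: "s \<noteq> 1" using s by auto
  have logd: "deriv zeta s / zeta s = deriv zeta_reg s / zeta_reg s - 1 / (s - 1)"
  proof -
    have dz: "(zeta has_field_derivative deriv zeta s) (at s)"
      using holomorphic_derivI[OF holomorphic_zeta open_halfplane] s by auto
    have "((\<lambda>s. (s - 1) * zeta s) has_field_derivative (zeta s + (s - 1) * deriv zeta s)) (at s)"
      by (auto intro!: derivative_eq_intros dz)
    moreover have "deriv zeta_reg s = deriv (\<lambda>s. (s - 1) * zeta s) s"
      using s by (intro complex_derivative_transform_within_open[of _ "{s. Re s > 1}"]
          holomorphic_on_subset[OF zeta_reg_holomorphic] holomorphic_intros holomorphic_zeta open_halfplane)
        (auto simp: zeta_reg_eq_zeta)
    ultimately have "deriv zeta_reg s = zeta s + (s - 1) * deriv zeta s"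
      by (simp add: DERIV_imp_deriv)
    moreover have "(zeta s + (s - 1) * deriv zeta s) / ((s - 1) * zeta s) = 1 / (s - 1) + deriv zeta s / zeta s"
      using zeta_nonzero[OF s] s1 by (simp add: add_divide_distrib)
    ultimately show ?thesis by (simp add: zeta_reg_eq_zeta[OF s])
  qed
  have 1: "(\<lambda>M. \<Sum>p\<in>primes_le M. ?l p * ?c p / (1 - ?c p)) \<longlonglongrightarrow> - deriv zeta s / zeta s"
    by (rule zeta_logderiv[OF s])
  have 2: "(\<lambda>M. \<Sum>p\<in>primes_le M. ?l p * ?c p ^ 2 / (1 - ?c p)) \<longlonglongrightarrow> prime_power_part s"
  proof -
    have "(\<lambda>M. \<Sum>m<M. prime_power_term m s) \<longlonglongrightarrow> prime_power_part s"
      unfolding prime_power_part_def using s by (intro summable_LIMSEQ summable_prime_power_term) auto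
    moreover have "(\<Sum>m<M. prime_power_term m s) = (\<Sum>p\<in>primes_le M. ?l p * ?c p ^ 2 / (1 - ?c p))" for M
      unfolding prime_power_term_def by (rule sum_prime_Suc)
    ultimately show ?thesis by simp
  qed
  have 3: "(\<lambda>M. \<Sum>m<M. cpow (real (Suc m)) s) \<longlonglongrightarrow> zeta s"
    unfolding zeta_def by (intro summable_LIMSEQ summable_cpow s)
  have "(\<lambda>M. (\<Sum>p\<in>primes_le M. ?l p * ?c p / (1 - ?c p)) - (\<Sum>p\<in>primes_le M. ?l p * ?c p ^ 2 / (1 - ?c p))
      - (\<Sum>m<M. cpow (real (Suc m)) s)) \<longlonglongrightarrow> - deriv zeta s / zeta s - prime_power_part s - zeta s"
    by (intro tendsto_intros 1 2 3)
  also have "(\<lambda>M. (\<Sum>p\<in>primes_le M. ?l p * ?c p / (1 - ?c p)) - (\<Sum>p\<in>primes_le M. ?l p * ?c p ^ 2 / (1 - ?c p))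
      - (\<Sum>m<M. cpow (real (Suc m)) s)) = (\<lambda>M. \<Sum>m<M. of_real (prime_coeff (Suc m)) * cpow (real (Suc m)) s)"
  proof
    fix M
    have "(\<Sum>p\<in>primes_le M. ?l p * ?c p / (1 - ?c p)) - (\<Sum>p\<in>primes_le M. ?l p * ?c p ^ 2 / (1 - ?c p)) =
        (\<Sum>p\<in>primes_le M. ?l p * ?c p)"
      unfolding sum_subtractf[symmetric]
    proof (rule sum.cong[OF refl])
      fix p assume "p \<in> primes_le M"
      then have "1 - ?c p \<noteq> 0" using cpow_neq_1(2)[of "real p" s] s prime_gt_1_nat[of p] by (auto simp: primes_le_def)
      then have "?l p * ?c p = (?l p * ?c p - ?l p * ?c p ^ 2) / (1 - ?c p)"
        by (simp add: eq_divide_eq algebra_simps power2_eq_square)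
      then show "?l p * ?c p / (1 - ?c p) - ?l p * ?c p ^ 2 / (1 - ?c p) = ?l p * ?c p"
        by (simp only: diff_divide_distrib)
    qed
    also have "\<dots> = (\<Sum>m<M. if prime (Suc m) then ?l (Suc m) * ?c (Suc m) else 0)"
      by (rule sum_prime_Suc[symmetric])
    finally show "(\<Sum>p\<in>primes_le M. ?l p * ?c p / (1 - ?c p)) - (\<Sum>p\<in>primes_le M. ?l p * ?c p ^ 2 / (1 - ?c p))
      - (\<Sum>m<M. cpow (real (Suc m)) s) = (\<Sum>m<M. of_real (prime_coeff (Suc m)) * cpow (real (Suc m)) s)"
      by (simp only: sum_subtractf[symmetric]) (auto intro!: sum.cong simp: prime_coeff_def algebra_simps)
  qed
  also have "- deriv zeta s / zeta s - prime_power_part s - zeta s = prime_series s"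
  proof -
    have "zeta s = zeta_reg s / (s - 1)" using s1 by (simp add: zeta_reg_eq_zeta[OF s])
    then have "zeta s = zeta_regular_part s + 1 / (s - 1)" using s1 by (simp add: zeta_regular_part_def diff_divide_distrib)
    then show ?thesis using logd by (simp add: prime_series_def)
  qed
  finally show ?thesis by (simp add: sums_def)
qed

lemma abs_prime_coeff_le: "n \<ge> 1 \<Longrightarrow> \<bar>prime_coeff n\<bar> \<le> 1 + ln (real n)"
  by (auto simp: prime_coeff_def abs_if)

lemma ln_power_powr_bound:
  fixes K :: nat and a :: real
  assumes "a > 0"
  obtains C where "C > 0" "\<And>x. x \<ge> 1 \<Longrightarrow> (1 + ln x) ^ K \<le> C * x powr a"
proof -
  define b where "b = a / real (Suc K)"
  have b: "b > 0" using assms by (simp add: b_def)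
  show thesis
  proof (rule that[of "(1 + 1 / b) ^ K"])
    show "(1 + 1 / b) ^ K > 0" using b by (intro zero_less_power add_pos_pos) auto
    fix x :: real assume x: "x \<ge> 1"
    have "ln x \<le> x powr b / b" using ln_powr_bound[OF x b] .
    moreover have one: "1 \<le> x powr b" using x b by (intro ge_one_powr_ge_zero) auto
    ultimately have "1 + ln x \<le> (1 + 1 / b) * x powr b" by (simp add: algebra_simps)
    then have "(1 + ln x) ^ K \<le> ((1 + 1 / b) * x powr b) ^ K" using x by (intro power_mono) auto
    also have "\<dots> = (1 + 1 / b) ^ K * x powr (b * real K)"
      using x by (simp add: power_mult_distrib powr_power mult_ac)
    also have "\<dots> \<le> (1 + 1 / b) ^ K * x powr a"
      using x b assms by (intro mult_left_mono powr_mono) (auto simp: b_def field_simps)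
    finally show "(1 + ln x) ^ K \<le> (1 + 1 / b) ^ K * x powr a" .
  qed
qed

text \<open>Supplies the Weierstrass majorant of the series (K = 0) and the absolute convergence
  behind the later exchange of sum and integral.\<close>

lemma prime_coeff_dominated:
  fixes K :: nat
  assumes "\<sigma> > 1"
  shows "summable (\<lambda>m. \<bar>prime_coeff (Suc m)\<bar> * ln (real (Suc m)) ^ K * real (Suc m) powr (- \<sigma>))"
proof -
  define a where "a = (\<sigma> - 1) / 2"
  have a: "a > 0" "\<sigma> = 1 + 2 * a" using assms by (simp_all add: a_def field_simps)
  from ln_power_powr_bound[OF a(1), of "Suc K"] obtain C where C: "C > 0"
    "\<And>x. x \<ge> 1 \<Longrightarrow> (1 + ln x) ^ Suc K \<le> C * x powr a" by blast
  have "summable (\<lambda>m. C * real (Suc m) powr (- 1 - a))"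
    by (intro summable_mult summable_Suc_powr a)
  then show ?thesis
  proof (rule summable_comparison_test')
    fix m :: nat
    define x where "x = real (Suc m)"
    have x: "x \<ge> 1" "ln x \<ge> 0" by (auto simp: x_def)
    have "\<bar>prime_coeff (Suc m)\<bar> * ln x ^ K * x powr (- \<sigma>) \<le> (1 + ln x) * (1 + ln x) ^ K * x powr (- \<sigma>)"
      using abs_prime_coeff_le[of "Suc m"] x by (intro mult_right_mono mult_mono power_mono) (auto simp: x_def)
    also have "\<dots> \<le> (C * x powr a) * x powr (- \<sigma>)"
      using C(2)[OF x(1)] by (intro mult_right_mono) auto
    also have "\<dots> = C * (x powr (a + - \<sigma>))" by (simp only: powr_add mult.assoc)
    also have "a + - \<sigma> = - 1 - a" by (simp add: a(2))
    finally show "norm (\<bar>prime_coeff (Suc m)\<bar> * ln (real (Suc m)) ^ K * real (Suc m) powr (- \<sigma>)) \<le> C * real (Suc m) powr (- 1 - a)"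
      using x by (simp add: x_def abs_mult)
  qed
qed

lemma higher_deriv_cpow_sum:
  fixes a :: "nat \<Rightarrow> complex"
  shows "(deriv ^^ K) (\<lambda>s. \<Sum>m<M. a m * cpow (real (Suc m)) s) =
     (\<lambda>s. \<Sum>m<M. a m * (- of_real (ln (real (Suc m)))) ^ K * cpow (real (Suc m)) s)"
proof (induction K)
  case (Suc K)
  have "deriv (\<lambda>s. \<Sum>m<M. a m * (- of_real (ln (real (Suc m)))) ^ K * cpow (real (Suc m)) s) s =
      (\<Sum>m<M. a m * (- of_real (ln (real (Suc m)))) ^ Suc K * cpow (real (Suc m)) s)" for s
  proof (rule DERIV_imp_deriv)
    show "((\<lambda>s. \<Sum>m<M. a m * (- of_real (ln (real (Suc m)))) ^ K * cpow (real (Suc m)) s) has_field_derivative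
       (\<Sum>m<M. a m * (- of_real (ln (real (Suc m)))) ^ Suc K * cpow (real (Suc m)) s)) (at s)"
    proof (rule DERIV_sum)
      fix m
      show "((\<lambda>s. a m * (- of_real (ln (real (Suc m)))) ^ K * cpow (real (Suc m)) s) has_field_derivative
        a m * (- of_real (ln (real (Suc m)))) ^ Suc K * cpow (real (Suc m)) s) (at s)"
        using DERIV_cmult[OF deriv_cpow[of "real (Suc m)" s], of "a m * (- of_real (ln (real (Suc m)))) ^ K"]
        by (simp add: mult_ac)
    qed
  qed
  then show ?case unfolding funpow.simps o_apply Suc.IH by (rule ext)
qed simp

lemma prime_series_higher_deriv_sums:
  assumes s: "Re s > 1"
  shows "(\<lambda>m. of_real (prime_coeff (Suc m)) * (- of_real (ln (real (Suc m)))) ^ K * cpow (real (Suc m)) s) sums (deriv ^^ K) prime_series s"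
proof -
  define \<sigma> where "\<sigma> = (1 + Re s) / 2"
  have \<sigma>: "\<sigma> > 1" "Re s > \<sigma>" using s by (auto simp: \<sigma>_def field_simps)
  define f where "f = (\<lambda>m s. complex_of_real (prime_coeff (Suc m)) * cpow (real (Suc m)) s)"
  have "uniform_limit {s. Re s > \<sigma>} (\<lambda>M s. \<Sum>m<M. f m s) (\<lambda>s. \<Sum>m. f m s) sequentially"
  proof (rule Weierstrass_m_test)
    show "norm (f m s) \<le> \<bar>prime_coeff (Suc m)\<bar> * ln (real (Suc m)) ^ 0 * real (Suc m) powr (- \<sigma>)" if "s \<in> {s. Re s > \<sigma>}" for m s
      using that unfolding f_def norm_mult by (subst norm_cpow) (auto intro!: mult_left_mono powr_mono)
  qed (rule prime_coeff_dominated[OF \<sigma>(1)])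
  moreover have "(\<lambda>s. \<Sum>m. f m s) u = prime_series u" if "u \<in> {s. Re s > \<sigma>}" for u
    using prime_series_sums[of u] that \<sigma> by (simp add: f_def sums_iff)
  ultimately have ul: "uniform_limit {s. Re s > \<sigma>} (\<lambda>M s. \<Sum>m<M. f m s) prime_series sequentially"
    by (metis (no_types, lifting) uniform_limit_cong')
  have "(\<lambda>M. (deriv ^^ K) (\<lambda>s. \<Sum>m<M. f m s) s) \<longlonglongrightarrow> (deriv ^^ K) prime_series s"
    by (rule higher_deriv_complex_uniform_limit[OF ul])
       (use \<sigma> in \<open>auto simp: f_def intro!: holomorphic_intros open_halfplane always_eventually\<close>)
  then show ?thesis
    unfolding f_def higher_deriv_cpow_sum by (simp add: sums_def)
qed

section \<open>Primes in short logarithmic intervals\<close>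

text \<open>The unnormalised Fejer kernel, whose cosine transform is a multiple of the tent
  \<open>hat\<close>. At t = 0 the division by zero yields 0 instead of the limit 1/2, which no
  integral notices.\<close>

definition fejer :: "real \<Rightarrow> real" where "fejer t = (1 - cos t) / t ^ 2"

definition hat :: "real \<Rightarrow> real" where "hat x = max 0 (1 - \<bar>x\<bar>)"

lemma fejer_nonneg: "fejer t \<ge> 0" by (simp add: fejer_def)

lemma fejer_measurable [measurable]: "fejer \<in> borel_measurable borel"
  unfolding fejer_def[abs_def] by measurable

lemma fejer_bound: "fejer t \<le> 8 / (1 + \<bar>t\<bar>) ^ 2"
proof (cases "\<bar>t\<bar> \<le> 1")
  case True
  have "1 - cos t \<le> t ^ 2 / 2"
  proof -
    have "1 - cos t = 2 * sin (t / 2) ^ 2" using cos_double_sin[of "t/2"] by simp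
    also have "\<dots> \<le> 2 * (t / 2) ^ 2"
    proof (rule mult_left_mono)
      show "sin (t / 2) ^ 2 \<le> (t / 2) ^ 2"
        using abs_sin_x_le_abs_x[of "t/2"] by (simp only: abs_le_square_iff)
    qed simp
    finally show ?thesis by (simp add: power_divide)
  qed
  then have "fejer t \<le> 1 / 2" by (cases "t = 0") (auto simp: fejer_def divide_simps)
  also have "\<dots> \<le> 8 / 2 ^ 2" by simp
  also have "\<dots> \<le> 8 / (1 + \<bar>t\<bar>) ^ 2"
    using True by (intro divide_left_mono power_mono mult_pos_pos zero_less_power) auto
  finally show ?thesis .
next
  case False
  have "fejer t \<le> 2 / t ^ 2"
    unfolding fejer_def using cos_ge_minus_one[of t] by (intro divide_right_mono) auto
  also have "2 / t ^ 2 = 8 / (\<bar>t\<bar> + \<bar>t\<bar>) ^ 2"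
    by (simp add: power2_eq_square flip: abs_mult)
  also have "\<dots> \<le> 8 / (1 + \<bar>t\<bar>) ^ 2"
    using False by (intro divide_left_mono power_mono mult_pos_pos zero_less_power) auto
  finally show ?thesis .
qed

text \<open>The exponent is -2 from the kernel plus 1/2 from the growth of the prime series.\<close>

lemma integrable_decay: "integrable lborel (\<lambda>t::real. (1 + \<bar>t\<bar>) powr (- 3/2))"
proof -
  define f :: "real \<Rightarrow> real" where "f = (\<lambda>t. (1 + \<bar>t\<bar>) powr (- 3/2) * indicator {0..} t)"
  have "(\<integral>\<^sup>+ x. ennreal ((1 + \<bar>x\<bar>) powr (- 3/2)) * indicator {0..} x \<partial>lborel) = ennreal (0 - (\<lambda>x. - 2 * (1 + x) powr (- 1/2)) 0)"
  proof (rule nn_integral_FTC_atLeast[where F = "\<lambda>x. - 2 * (1 + x) powr (- 1/2)"])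
    fix x :: real assume x: "0 \<le> x"
    have "((\<lambda>x. - 2 * (1 + x) powr (- 1/2)) has_real_derivative - 2 * ((- 1/2) * (1 + x) powr (- 1/2 - 1))) (at x)"
      using x by (auto intro!: derivative_eq_intros)
    then show "((\<lambda>x. - 2 * (1 + x) powr (- 1/2)) has_real_derivative (1 + \<bar>x\<bar>) powr (- 3/2)) (at x)"
      using x by simp
  next
    show "((\<lambda>x::real. - 2 * (1 + x) powr (- 1/2)) \<longlongrightarrow> 0) at_top" by real_asymp
  qed auto
  then have "(\<integral>\<^sup>+ x. ennreal (f x) \<partial>lborel) < \<infinity>"
    unfolding f_def by (simp add: ennreal_mult' ennreal_indicator)
  then have f: "integrable lborel f"
    by (intro integrableI_nonneg) (auto simp: f_def)
  then have "integrable lborel (\<lambda>x. f (0 + (- 1) * x))"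
    by (subst lborel_integrable_real_affine_iff) auto
  with f have "integrable lborel (\<lambda>x. f x + f (0 + (- 1) * x))" by (rule Bochner_Integration.integrable_add)
  then show ?thesis
    by (rule Bochner_Integration.integrable_bound) (auto simp: f_def indicator_def)
qed

lemma fejer_weighted_integrable: "integrable lborel (\<lambda>t. fejer t * (3 + \<bar>t\<bar>) powr (1/2))"
proof (rule Bochner_Integration.integrable_bound[OF integrable_mult_right[OF integrable_decay, of 24]])
  have "fejer t * (3 + \<bar>t\<bar>) powr (1/2) \<le> 24 * (1 + \<bar>t\<bar>) powr (- 3/2)" for t
  proof -
    have "fejer t * (3 + \<bar>t\<bar>) powr (1/2) \<le> 8 / (1 + \<bar>t\<bar>) ^ 2 * (3 * (1 + \<bar>t\<bar>)) powr (1/2)"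
      using fejer_bound fejer_nonneg by (intro mult_mono powr_mono2) auto
    also have "\<dots> = 8 * 3 powr (1/2) * ((1 + \<bar>t\<bar>) powr (1/2) / (1 + \<bar>t\<bar>) powr 2)"
      by (subst powr_mult) auto
    also have "(1 + \<bar>t\<bar>) powr (1/2) / (1 + \<bar>t\<bar>) powr 2 = (1 + \<bar>t\<bar>) powr (- 3/2)"
      by (simp only: powr_diff[symmetric]) simp
    also have "8 * 3 powr (1/2) * (1 + \<bar>t\<bar>) powr (- 3/2) \<le> 8 * 3 powr 1 * (1 + \<bar>t\<bar>) powr (- 3/2)"
      by (intro mult_right_mono mult_left_mono powr_mono) auto
    finally show ?thesis by simp
  qed
  then show "AE t in lborel. norm (fejer t * (3 + \<bar>t\<bar>) powr (1/2)) \<le> norm (24 * (1 + \<bar>t\<bar>) powr (- 3/2))"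
    using fejer_nonneg by (auto simp: abs_mult)
qed auto

lemma fejer_integrable: "integrable lborel fejer"
proof (rule Bochner_Integration.integrable_bound[OF fejer_weighted_integrable])
  have "fejer t * 1 \<le> fejer t * (3 + \<bar>t\<bar>) powr (1/2)" for t
    by (intro mult_left_mono ge_one_powr_ge_zero fejer_nonneg) auto
  then show "AE t in lborel. norm (fejer t) \<le> norm (fejer t * (3 + \<bar>t\<bar>) powr (1/2))"
    using fejer_nonneg by (auto simp: abs_mult)
qed auto

text \<open>The value of this integral (it is \<open>\<pi>\<close>) never matters: only its positivity does.\<close>

definition fejer_mass :: real where "fejer_mass = (LBINT t. fejer t)"

lemma fejer_mass_pos: "fejer_mass > 0"
proof -
  have "(LBINT t. (1 - cos 1) / 4 * indicator {1..2::real} t) \<le> fejer_mass"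
    unfolding fejer_mass_def
  proof (rule Bochner_Integration.integral_mono)
    fix t :: real
    show "(1 - cos 1) / 4 * indicator {1..2} t \<le> fejer t"
    proof (cases "t \<in> {1..2}")
      case True
      have "cos t \<le> cos 1" using True pi_ge_two by (intro cos_monotone_0_pi_le) auto
      moreover have "t ^ 2 \<le> 2 ^ 2" using True by (intro power_mono) auto
      ultimately have "(1 - cos 1) / 4 \<le> (1 - cos t) / t ^ 2"
        using True by (intro frac_le) auto
      then show ?thesis using True by (simp add: fejer_def)
    qed (simp add: fejer_nonneg)
  qed (auto intro!: fejer_integrable)
  moreover have "cos 1 < (1::real)" using cos_monotone_0_pi[of 0 1] pi_ge_two by simp
  ultimately show ?thesis by simp
qed

lemma fejer_scaled:
  "integrable lborel (\<lambda>t. (1 - cos (a * t)) / t ^ 2)"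
  "(LBINT t. (1 - cos (a * t)) / t ^ 2) = \<bar>a\<bar> * fejer_mass"
proof -
  have *: "integrable lborel (\<lambda>t. (1 - cos (a * t)) / t ^ 2) \<and> (LBINT t. (1 - cos (a * t)) / t ^ 2) = \<bar>a\<bar> * fejer_mass"
  proof (cases "a = 0")
    case False
    have eq: "(\<lambda>t. (1 - cos (a * t)) / t ^ 2) = (\<lambda>t. a ^ 2 * fejer (0 + a * t))"
      using False by (auto simp: fejer_def power_mult_distrib)
    have 1: "integrable lborel (\<lambda>t. fejer (0 + a * t))"
      using False fejer_integrable by (subst lborel_integrable_real_affine_iff) auto
    have "fejer_mass = \<bar>a\<bar> * (LBINT t. fejer (0 + a * t))"
      unfolding fejer_mass_def using lborel_integral_real_affine[OF False, of fejer 0] by simp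
    moreover have "a ^ 2 = \<bar>a\<bar> * \<bar>a\<bar>" by (simp add: power2_eq_square)
    ultimately have "a ^ 2 * (LBINT t. fejer (0 + a * t)) = \<bar>a\<bar> * fejer_mass"
      by (simp only: mult.assoc)
    then show ?thesis unfolding eq using 1 by simp
  qed simp
  show "integrable lborel (\<lambda>t. (1 - cos (a * t)) / t ^ 2)" using * by blast
  show "(LBINT t. (1 - cos (a * t)) / t ^ 2) = \<bar>a\<bar> * fejer_mass" using * by blast
qed

text \<open>Product-to-sum writes the integrand as half a second difference in x of (1 - cos (x t))
  / t^2, whose integral is \<bar>x\<bar> times the mass by scaling. Half the second difference of
  the absolute value is the tent.\<close>

lemma fejer_hat: "(LBINT t. fejer t * cos (x * t)) = fejer_mass * hat x"
proof -
  have eq: "fejer t * cos (x * t) = 1/2 * ((1 - cos ((x + 1) * t)) / t ^ 2) + 1/2 * ((1 - cos ((x - 1) * t)) / t ^ 2)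
     - (1 - cos (x * t)) / t ^ 2" for t
  proof -
    have "cos ((x + 1) * t) + cos ((x - 1) * t) = 2 * (cos t * cos (x * t))"
      by (simp add: algebra_simps cos_add cos_diff)
    then have "(1 - cos t) * cos (x * t) = 1/2 * (1 - cos ((x + 1) * t)) + 1/2 * (1 - cos ((x - 1) * t)) - (1 - cos (x * t))"
      by (simp add: algebra_simps)
    note ** = this
    have "fejer t * cos (x * t) = ((1 - cos t) * cos (x * t)) / t ^ 2" by (simp add: fejer_def)
    also have "\<dots> = (1/2 * (1 - cos ((x + 1) * t)) + 1/2 * (1 - cos ((x - 1) * t)) - (1 - cos (x * t))) / t ^ 2"
      by (simp only: **)
    finally show ?thesis by (simp add: add_divide_distrib diff_divide_distrib)
  qed
  have "(LBINT t. fejer t * cos (x * t)) = 1/2 * (\<bar>x + 1\<bar> * fejer_mass) + 1/2 * (\<bar>x - 1\<bar> * fejer_mass) - \<bar>x\<bar> * fejer_mass"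
    unfolding eq by (simp only: Bochner_Integration.integral_diff Bochner_Integration.integral_add
        Bochner_Integration.integrable_add integrable_mult_right fejer_scaled integral_mult_right_zero)
  also have "\<dots> = fejer_mass * (1/2 * (\<bar>x + 1\<bar> + \<bar>x - 1\<bar> - 2 * \<bar>x\<bar>))" by (simp add: algebra_simps)
  also have "1/2 * (\<bar>x + 1\<bar> + \<bar>x - 1\<bar> - 2 * \<bar>x\<bar>) = hat x" by (auto simp: hat_def abs_if max_def)
  finally show ?thesis .
qed

lemma Re_of_real_mult: "Re (of_real r * z) = r * Re z"
  by simp

text \<open>Writing the tent as a cosine integral and exchanging sum and integral gives, up to sign
  and the mass, the integral of \<open>fejer t\<close> times the real part of exp(i a t / h) times
  the K-th derivative of the prime series at 1 + \<eta> + i t / h. That derivative is O(((3 +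
  \<bar>t\<bar>) / h)^(1/2)), the source of h^(-1/2). The bound is uniform in a and \<eta>, so
  \<eta> may later depend on a.\<close>

lemma smoothed_prime_sum_bound:
  fixes K :: nat
  obtains C c where "C > 0" "c > 0"
    "\<And>\<eta> a h. 0 < \<eta> \<Longrightarrow> \<eta> \<le> c \<Longrightarrow> 0 < h \<Longrightarrow> h \<le> 1 \<Longrightarrow>
       \<bar>\<Sum>m. prime_coeff (Suc m) * ln (real (Suc m)) ^ K * real (Suc m) powr (- (1 + \<eta>)) * hat ((ln (real (Suc m)) - a) / h)\<bar> \<le> C * h powr (- 1/2)"
proof -
  from prime_series_higher_deriv_bound[of K] obtain C c where C: "C > 0" "c > 0"
    "\<And>s. 1 \<le> Re s \<Longrightarrow> Re s \<le> 1 + c \<Longrightarrow> norm ((deriv ^^ K) prime_series s) \<le> C * ht s powr (1/2)" by blast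
  define I where "I = (LBINT t. fejer t * (3 + \<bar>t\<bar>) powr (1/2))"
  have I: "I \<ge> 0" unfolding I_def using fejer_nonneg by (intro Bochner_Integration.integral_nonneg) auto
  define D where "D = C * (I + 1) / fejer_mass"
  show thesis
  proof (rule that[of D c])
    show "D > 0" "c > 0" using C I fejer_mass_pos by (auto simp: D_def)
    fix \<eta> a h :: real assume \<eta>: "0 < \<eta>" "\<eta> \<le> c" and h: "0 < h" "h \<le> 1"
    define b where "b = (\<lambda>m. prime_coeff (Suc m) * ln (real (Suc m)) ^ K * real (Suc m) powr (- (1 + \<eta>)))"
    define x where "x = (\<lambda>m. (ln (real (Suc m)) - a) / h)"
    define f where "f = (\<lambda>m t. b m * (fejer t * cos (x m * t)))"
    have sb: "summable (\<lambda>m. \<bar>b m\<bar>)"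
      using prime_coeff_dominated[of "1 + \<eta>" K] \<eta> by (simp add: b_def abs_mult)
    have int: "integrable lborel (\<lambda>t. fejer t * cos (x m * t))" for m
      by (rule Bochner_Integration.integrable_bound[OF fejer_integrable])
         (auto simp: abs_mult intro!: mult_left_le)
    have intf: "integrable lborel (f m)" for m
      unfolding f_def by (intro integrable_mult_right int)
    have fle: "norm (f m t) \<le> \<bar>b m\<bar> * fejer t" for m t
      unfolding f_def using fejer_nonneg[of t]
      by (auto simp: abs_mult intro!: mult_left_mono mult_left_le)
    have sumf: "summable (\<lambda>m. norm (f m t))" for t
      by (rule summable_comparison_test'[OF summable_mult2[OF sb, of "fejer t"]]) (use fle in auto)
    have "(LBINT t. (\<Sum>m. f m t)) = (\<Sum>m. LBINT t. f m t)"
    proof (rule integral_suminf)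
      show "AE t in lborel. summable (\<lambda>m. norm (f m t))" using sumf by auto
      show "summable (\<lambda>m. LBINT t. norm (f m t))"
      proof (rule summable_comparison_test'[OF summable_mult2[OF sb, of fejer_mass]])
        fix m
        have "(LBINT t. norm (f m t)) \<le> (LBINT t. \<bar>b m\<bar> * fejer t)"
          by (intro Bochner_Integration.integral_mono integrable_norm intf integrable_mult_right fejer_integrable fle)
        also have "\<dots> = \<bar>b m\<bar> * fejer_mass" by (simp add: fejer_mass_def)
        finally show "norm (LBINT t. norm (f m t)) \<le> \<bar>b m\<bar> * fejer_mass" by simp
      qed
    qed (rule intf)
    moreover have "(LBINT t. f m t) = fejer_mass * (b m * hat (x m))" for m
      unfolding f_def by (simp add: fejer_hat)
    moreover have sbh: "summable (\<lambda>m. b m * hat (x m))"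
      by (rule summable_comparison_test'[OF sb])
         (auto simp: abs_mult hat_def intro!: mult_left_le)
    ultimately have main: "(LBINT t. (\<Sum>m. f m t)) = fejer_mass * (\<Sum>m. b m * hat (x m))"
      by (simp add: suminf_mult)
    have pt: "\<bar>\<Sum>m. f m t\<bar> \<le> C * h powr (- 1/2) * (fejer t * (3 + \<bar>t\<bar>) powr (1/2))" for t
    proof -
      define s where "s = Complex (1 + \<eta>) (t / h)"
      have "(\<lambda>m. exp (\<i> * of_real (a * t / h)) * (of_real (prime_coeff (Suc m)) * (- of_real (ln (real (Suc m)))) ^ K * cpow (real (Suc m)) s))
         sums (exp (\<i> * of_real (a * t / h)) * (deriv ^^ K) prime_series s)"
        by (intro sums_mult prime_series_higher_deriv_sums) (use \<eta> in \<open>simp add: s_def\<close>)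
      then have "(\<lambda>m. Re (exp (\<i> * of_real (a * t / h)) * (of_real (prime_coeff (Suc m)) * (- of_real (ln (real (Suc m)))) ^ K * cpow (real (Suc m)) s)))
         sums Re (exp (\<i> * of_real (a * t / h)) * (deriv ^^ K) prime_series s)"
        by (rule sums_Re)
      moreover have "Re (exp (\<i> * of_real (a * t / h)) * (of_real (prime_coeff (Suc m)) * (- of_real (ln (real (Suc m)))) ^ K * cpow (real (Suc m)) s))
         = (- 1) ^ K * (b m * cos (x m * t))" for m
      proof -
        define n where "n = real (Suc m)"
        have "cpow n s = of_real (n powr (- (1 + \<eta>))) * cis (- (t / h) * ln n)"
          unfolding s_def by (rule cpow_Complex) (simp add: n_def)
        then have "exp (\<i> * of_real (a * t / h)) * (of_real (prime_coeff (Suc m)) * (- of_real (ln n)) ^ K * cpow n s) =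
            of_real (prime_coeff (Suc m) * (- ln n) ^ K * n powr (- (1 + \<eta>))) * (cis (a * t / h) * cis (- (t / h) * ln n))"
          by (simp add: cis_conv_exp mult_ac)
        also have "cis (a * t / h) * cis (- (t / h) * ln n) = cis (- (x m * t))"
          by (simp add: cis_mult x_def n_def diff_divide_distrib algebra_simps)
        finally have "Re (exp (\<i> * of_real (a * t / h)) * (of_real (prime_coeff (Suc m)) * (- of_real (ln n)) ^ K * cpow n s)) =
            prime_coeff (Suc m) * (- ln n) ^ K * n powr (- (1 + \<eta>)) * cos (x m * t)"
          by (simp only: Re_of_real_mult cis.sel cos_minus)
        also have "(- ln n) ^ K = (- 1) ^ K * ln n ^ K" by (rule power_minus)
        finally show ?thesis by (simp add: b_def n_def mult_ac)
      qed
      ultimately have "(\<lambda>m. (- 1) ^ K * (b m * cos (x m * t))) sums Re (exp (\<i> * of_real (a * t / h)) * (deriv ^^ K) prime_series s)"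
        by simp
      note S = sums_mult[OF this, of "(- 1) ^ K * fejer t"]
      \<comment> \<open>Each derivative brings down a factor -ln n; a second factor (-1)^K removes
        the sign.\<close>
      have sq: "(- 1) ^ K * (- 1) ^ K = (1 :: real)" by (simp flip: power_mult_distrib)
      have "(- 1) ^ K * fejer t * ((- 1) ^ K * (b m * cos (x m * t))) = ((- 1) ^ K * (- 1) ^ K) * (b m * (fejer t * cos (x m * t)))" for m
        by (simp only: mult_ac)
      then have "(- 1) ^ K * fejer t * ((- 1) ^ K * (b m * cos (x m * t))) = f m t" for m
        by (simp only: sq f_def mult_1_left)
      with S have "(\<lambda>m. f m t) sums ((- 1) ^ K * fejer t * Re (exp (\<i> * of_real (a * t / h)) * (deriv ^^ K) prime_series s))"
        by simp
      then have "(\<Sum>m. f m t) = (- 1) ^ K * fejer t * Re (exp (\<i> * of_real (a * t / h)) * (deriv ^^ K) prime_series s)"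
        by (simp add: sums_iff)
      then have "\<bar>\<Sum>m. f m t\<bar> = fejer t * \<bar>Re (exp (\<i> * of_real (a * t / h)) * (deriv ^^ K) prime_series s)\<bar>"
        using fejer_nonneg[of t] by (simp add: abs_mult)
      also have "\<dots> \<le> fejer t * norm (exp (\<i> * of_real (a * t / h)) * (deriv ^^ K) prime_series s)"
        by (intro mult_left_mono abs_Re_le_cmod fejer_nonneg)
      also have "\<dots> = fejer t * norm ((deriv ^^ K) prime_series s)"
        by (simp add: norm_mult)
      also have "\<dots> \<le> fejer t * (C * ht s powr (1/2))"
        using \<eta> by (intro mult_left_mono C fejer_nonneg) (auto simp: s_def)
      also have "\<dots> \<le> fejer t * (C * ((3 + \<bar>t\<bar>) / h) powr (1/2))"
      proof -
        have "ht s = 3 + \<bar>t\<bar> / h" using h by (simp add: ht_def s_def abs_divide)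
        also have "\<dots> \<le> 3 / h + \<bar>t\<bar> / h" using h by (intro add_mono) (auto simp: divide_simps)
        finally have "ht s \<le> (3 + \<bar>t\<bar>) / h" by (simp add: add_divide_distrib)
        then show ?thesis using C fejer_nonneg by (intro mult_left_mono powr_mono2) auto
      qed
      also have "((3 + \<bar>t\<bar>) / h) powr (1/2) = h powr (- 1/2) * (3 + \<bar>t\<bar>) powr (1/2)"
        using h by (simp add: powr_divide powr_minus_divide)
      finally show ?thesis by (simp add: mult_ac)
    qed
    have "fejer_mass * \<bar>\<Sum>m. b m * hat (x m)\<bar> = \<bar>LBINT t. (\<Sum>m. f m t)\<bar>"
      unfolding main using fejer_mass_pos by (simp add: abs_mult)
    also have "\<dots> \<le> (LBINT t. \<bar>\<Sum>m. f m t\<bar>)"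
      by (rule integral_abs_bound)
    also have "\<dots> \<le> (LBINT t. C * h powr (- 1/2) * (fejer t * (3 + \<bar>t\<bar>) powr (1/2)))"
    proof (rule Bochner_Integration.integral_mono)
      show intr: "integrable lborel (\<lambda>t. C * h powr (- 1/2) * (fejer t * (3 + \<bar>t\<bar>) powr (1/2)))"
        by (intro integrable_mult_right fejer_weighted_integrable)
      have meas: "(\<lambda>t. \<Sum>m. f m t) \<in> borel_measurable lborel"
        unfolding f_def by measurable
      show "integrable lborel (\<lambda>t. \<bar>\<Sum>m. f m t\<bar>)"
        by (rule Bochner_Integration.integrable_bound[OF intr])
           (use pt C fejer_nonneg meas in \<open>auto simp: abs_mult\<close>)
    qed (rule pt)
    also have "\<dots> = C * h powr (- 1/2) * I" by (simp add: I_def)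
    also have "\<dots> \<le> C * h powr (- 1/2) * (I + 1)" using C by (intro mult_left_mono) auto
    finally have "\<bar>\<Sum>m. b m * hat (x m)\<bar> \<le> D * h powr (- 1/2)"
      using fejer_mass_pos by (simp add: D_def field_simps)
    then show "\<bar>\<Sum>m. prime_coeff (Suc m) * ln (real (Suc m)) ^ K * real (Suc m) powr (- (1 + \<eta>)) * hat ((ln (real (Suc m)) - a) / h)\<bar> \<le> D * h powr (- 1/2)"
      by (simp add: b_def x_def)
  qed
qed

lemma ln_le_iff_le_exp:
  fixes x y :: real
  assumes "x > 0"
  shows "ln x \<le> y \<longleftrightarrow> x \<le> exp y"
  using assms exp_le_cancel_iff[of "ln x" y] by simp

text \<open>Comparison with the telescoping sum of ln (n + 1) - ln n \<le> 1 / n. At the upper end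
  rounding is harmless, as ln (u + 1) \<ge> y; at the lower end rounding exp x up to an integer
  costs at most exp (-x).\<close>

lemma harmonic_log_interval:
  fixes x y :: real
  assumes "x \<le> y"
  shows "(\<Sum>n\<in>{n::nat. n \<ge> 1 \<and> x \<le> ln (real n) \<and> ln (real n) \<le> y}. 1 / real n) \<ge> y - x - exp (- x)"
proof -
  define l u where "l = nat \<lceil>exp x\<rceil>" and "u = nat \<lfloor>exp y\<rfloor>"
  have l: "l \<ge> 1" "real l \<ge> exp x" "real l \<le> exp x + 1"
  proof -
    show "real l \<ge> exp x" unfolding l_def by (rule real_nat_ceiling_ge)
    then show "l \<ge> 1" using exp_gt_zero[of x] by (cases l) auto
    have "0 \<le> \<lceil>exp x\<rceil>" using exp_gt_zero[of x] by linarith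
    then show "real l \<le> exp x + 1" unfolding l_def using of_int_ceiling_le_add_one[of "exp x"]
      by simp
  qed
  have u: "real u \<le> exp y" "real u + 1 \<ge> exp y"
  proof -
    have "real u = of_int \<lfloor>exp y\<rfloor>" by (simp add: u_def)
    then show "real u \<le> exp y" "real u + 1 \<ge> exp y" by linarith+
  qed
  have lu: "l \<le> Suc u"
  proof -
    have "exp x \<le> real (Suc u)"
    proof -
      have "exp x \<le> exp y" using assms by simp
      also have "\<dots> \<le> real (Suc u)" using u(2) by simp
      finally show ?thesis .
    qed
    then show ?thesis unfolding l_def by (simp add: nat_ceiling_le_eq)
  qed
  have eq: "{n::nat. n \<ge> 1 \<and> x \<le> ln (real n) \<and> ln (real n) \<le> y} = {l..u}"
  proof -
    have "x \<le> ln (real n) \<longleftrightarrow> l \<le> n" if "n \<ge> 1" for n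
      using that by (simp add: l_def ln_ge_iff nat_ceiling_le_eq)
    moreover have "ln (real n) \<le> y \<longleftrightarrow> n \<le> u" if "n \<ge> 1" for n
    proof -
      have "ln (real n) \<le> y \<longleftrightarrow> real n \<le> exp y" using that by (simp add: ln_le_iff_le_exp)
      also have "\<dots> \<longleftrightarrow> n \<le> u"

      proof
        show "real n \<le> exp y \<Longrightarrow> n \<le> u" unfolding u_def by (rule le_nat_floor)
        show "n \<le> u \<Longrightarrow> real n \<le> exp y" using u(1) by linarith
      qed
      finally show ?thesis .
    qed
    ultimately show ?thesis using l(1) by auto
  qed
  have "ln (real (Suc u)) - ln (real l) = (\<Sum>n=l..u. ln (real (Suc n)) - ln (real n))"
    using sum_Suc_diff[OF lu, of "\<lambda>n. ln (real n)"] by simp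
  also have "\<dots> \<le> (\<Sum>n=l..u. 1 / real n)"
  proof (rule sum_mono)
    fix n assume "n \<in> {l..u}"
    then have n: "n \<ge> 1" using l by auto
    have "ln (real (Suc n)) - ln (real n) = ln (real (Suc n) / real n)"
      using n by (subst ln_div) auto
    also have "real (Suc n) / real n = 1 + 1 / real n" using n by (simp add: field_simps)
    also have "ln (1 + 1 / real n) \<le> 1 / real n" using n by (intro ln_add_one_self_le_self) auto
    finally show "ln (real (Suc n)) - ln (real n) \<le> 1 / real n" .
  qed
  finally have 1: "ln (real (Suc u)) - ln (real l) \<le> (\<Sum>n=l..u. 1 / real n)" .
  have 2: "ln (real (Suc u)) \<ge> y" using u by (simp add: ln_ge_iff)
  have "ln (real l) \<le> ln (exp x + 1)" using l by simp
  also have "exp x + 1 = exp x * (1 + exp (- x))" by (simp add: algebra_simps exp_minus)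
  also have "ln (exp x * (1 + exp (- x))) = x + ln (1 + exp (- x))"
    using add_pos_pos[OF zero_less_one exp_gt_zero[of "- x"]] by (subst ln_mult) auto
  also have "ln (1 + exp (- x)) \<le> exp (- x)" by (intro ln_add_one_self_le_self) auto
  finally have "ln (real l) \<le> x + exp (- x)" by simp
  with 1 2 show ?thesis unfolding eq by linarith
qed

text \<open>Up to a constant this is the weight \<open>v ^ K * exp (- \<eta> v)\<close> produced by \<open>K\<close> derivatives at
  \<open>Re s = 1 + \<eta>\<close>; the choice \<open>\<eta> = K / a\<close> puts its maximum, normalised to \<open>1\<close>, at \<open>v = a\<close>.\<close>

definition bump :: "nat \<Rightarrow> real \<Rightarrow> real \<Rightarrow> real" where
  "bump K a v = (v / a) ^ K * exp (real K - real K * v / a)"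

lemma bump_altdef: "bump K a v = ((v / a) * exp (1 - v / a)) ^ K"
proof -
  have "exp (1 - v / a) ^ K = exp (real K * (1 - v / a))" by (rule exp_of_nat_mult[symmetric])
  also have "real K * (1 - v / a) = real K - real K * v / a" by (simp add: algebra_simps)
  finally show ?thesis by (simp only: bump_def power_mult_distrib)
qed

text \<open>With u = v / a - 1 the base of the K-th power is (1 + u) exp (-u), which is at most 1
  and, for |u| \<le> 1, at least 1 - u^2. Near a one has u^2 \<le> 1 / a, and Bernoulli's inequality
  turns the K-th power into 1 - K / a.\<close>

lemma bump_bounds:
  assumes a: "a \<ge> 1" and v: "v \<ge> 0"
  shows "bump K a v \<ge> 0" "bump K a v \<le> 1"
    "\<bar>v - a\<bar> \<le> 1/2 \<Longrightarrow> bump K a v \<ge> 1 - real K / a"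
proof -
  have x0: "v / a \<ge> 0" using a v by simp
  then show "bump K a v \<ge> 0" unfolding bump_altdef by (intro zero_le_power mult_nonneg_nonneg) auto
  have "v / a \<le> exp (v / a - 1)" using exp_ge_add_one_self[of "v / a - 1"] by simp
  then have "(v / a) * exp (1 - v / a) \<le> exp (v / a - 1) * exp (1 - v / a)" by (intro mult_right_mono) auto
  also have "\<dots> = 1" by (simp flip: exp_add)
  finally show "bump K a v \<le> 1" unfolding bump_altdef using x0 by (intro power_le_one mult_nonneg_nonneg) auto
  assume va: "\<bar>v - a\<bar> \<le> 1/2"
  define u where "u = v / a - 1"
  have u: "\<bar>u\<bar> \<le> 1 / (2 * a)"
  proof -
    have "u = (v - a) / a" using a by (simp add: u_def field_simps)
    then have "\<bar>u\<bar> = \<bar>v - a\<bar> / a" using a by (simp add: abs_divide)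
    also have "\<dots> \<le> (1/2) / a" using va a by (intro divide_right_mono) auto
    finally show ?thesis by simp
  qed
  have "1 / (2 * a) \<le> 1" using a by simp
  then have u1: "\<bar>u\<bar> \<le> 1" using u by simp
  have "1 - u ^ 2 = (1 + u) * (1 - u)" by (simp add: power2_eq_square algebra_simps)
  also have "\<dots> \<le> (1 + u) * exp (- u)" using u1 exp_ge_add_one_self[of "- u"] by (intro mult_left_mono) auto
  finally have base: "1 - u ^ 2 \<le> (v / a) * exp (1 - v / a)" by (simp add: u_def)
  have u2: "u ^ 2 \<le> 1 / a"
  proof -
    have "u ^ 2 = \<bar>u\<bar> * \<bar>u\<bar>" by (simp add: power2_eq_square)
    also have "\<dots> \<le> 1 / (2 * a) * 1" using u u1 a by (intro mult_mono) auto
    also have "\<dots> \<le> 1 / a" using a by (simp add: field_simps)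
    finally show ?thesis .
  qed
  have "1 - real K / a \<le> 1 - real K * u ^ 2" using u2 mult_left_mono[OF u2, of "real K"] by simp
  also have "\<dots> \<le> (1 - u ^ 2) ^ K"
    using Bernoulli_inequality[of "- (u ^ 2)" K] u1 by (simp add: abs_square_le_1)
  also have "\<dots> \<le> bump K a v" unfolding bump_altdef using base u1
    by (intro power_mono) (auto simp: abs_square_le_1)
  finally show "bump K a v \<ge> 1 - real K / a" .
qed

text \<open>A combination of two tents, so the smoothed bound applies to it, but with a plateau of
  height 1: a minorant of the indicator of \<bar>v\<bar> < h1 that loses only the ramps of width h1
  - h2.\<close>

definition trapezoid :: "real \<Rightarrow> real \<Rightarrow> real \<Rightarrow> real" where
  "trapezoid h1 h2 v = (h1 * hat (v / h1) - h2 * hat (v / h2)) / (h1 - h2)"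

lemma trapezoid_bounds:
  assumes "0 < h2" "h2 < h1"
  shows "trapezoid h1 h2 v \<ge> 0" "trapezoid h1 h2 v \<le> 1" "\<bar>v\<bar> \<le> h2 \<Longrightarrow> trapezoid h1 h2 v = 1"
proof -
  have hat: "h * hat (v / h) = max 0 (h - \<bar>v\<bar>)" if "h > 0" for h
    using that by (auto simp: hat_def max_def abs_divide field_simps)
  have eq: "trapezoid h1 h2 v = (max 0 (h1 - \<bar>v\<bar>) - max 0 (h2 - \<bar>v\<bar>)) / (h1 - h2)"
    using assms by (simp add: trapezoid_def hat)
  have d: "h1 - h2 > 0" using assms by simp
  have "max 0 (h1 - \<bar>v\<bar>) - max 0 (h2 - \<bar>v\<bar>) \<ge> 0" using assms by linarith
  then show "trapezoid h1 h2 v \<ge> 0" unfolding eq using d by simp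
  have "max 0 (h1 - \<bar>v\<bar>) - max 0 (h2 - \<bar>v\<bar>) \<le> h1 - h2" using assms by linarith
  then show "trapezoid h1 h2 v \<le> 1" unfolding eq using d by simp
  assume "\<bar>v\<bar> \<le> h2"
  then have "max 0 (h1 - \<bar>v\<bar>) - max 0 (h2 - \<bar>v\<bar>) = h1 - h2" using assms by linarith
  then show "trapezoid h1 h2 v = 1" unfolding eq using d by simp
qed

lemma finite_log_interval: "finite {n::nat. n \<ge> 1 \<and> \<bar>ln (real n) - a\<bar> < h}"
proof (rule finite_subset)
  show "{n::nat. n \<ge> 1 \<and> \<bar>ln (real n) - a\<bar> < h} \<subseteq> {..nat \<lceil>exp (a + h)\<rceil>}"
  proof
    fix n assume n: "n \<in> {n::nat. n \<ge> 1 \<and> \<bar>ln (real n) - a\<bar> < h}"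
    then have "ln (real n) \<le> a + h" by auto
    then have "real n \<le> exp (a + h)" using n by (simp add: ln_le_iff_le_exp)
    also have "\<dots> \<le> real (nat \<lceil>exp (a + h)\<rceil>)" by (rule real_nat_ceiling_ge)
    finally show "n \<in> {..nat \<lceil>exp (a + h)\<rceil>}" by simp
  qed
qed simp

text \<open>The index set belongs to the larger half-width h, so that the two tents of a trapezoid
  are summed over the same finite set.\<close>

lemma suminf_hat_finite:
  assumes "0 < h'" "h' \<le> h"
  shows "(\<Sum>m. f (Suc m) * hat ((ln (real (Suc m)) - a) / h')) =
    (\<Sum>n\<in>{n::nat. n \<ge> 1 \<and> \<bar>ln (real n) - a\<bar> < h}. f n * hat ((ln (real n) - a) / h'))"
proof -
  let ?M = "{m::nat. \<bar>ln (real (Suc m)) - a\<bar> < h}"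
  let ?N = "{n::nat. n \<ge> 1 \<and> \<bar>ln (real n) - a\<bar> < h}"
  have N: "?N = Suc ` ?M"
  proof (intro equalityI subsetI)
    fix n assume "n \<in> ?N"
    then show "n \<in> Suc ` ?M" by (intro image_eqI[of _ _ "n - 1"]) auto
  qed auto
  have fin: "finite ?M" using finite_log_interval[of a h] unfolding N by (rule finite_imageD) auto
  have "(\<Sum>m. f (Suc m) * hat ((ln (real (Suc m)) - a) / h')) = (\<Sum>m\<in>?M. f (Suc m) * hat ((ln (real (Suc m)) - a) / h'))"
  proof (rule suminf_finite[OF fin])
    fix m assume "m \<notin> ?M"
    then have "\<bar>ln (real (Suc m)) - a\<bar> \<ge> h'" using assms by auto
    then have "\<bar>(ln (real (Suc m)) - a) / h'\<bar> \<ge> 1" using assms by (simp add: abs_divide)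
    then show "f (Suc m) * hat ((ln (real (Suc m)) - a) / h') = 0" by (simp add: hat_def)
  qed
  also have "\<dots> = (\<Sum>n\<in>?N. f n * hat ((ln (real n) - a) / h'))"
    unfolding N by (subst sum.reindex) auto
  finally show ?thesis .
qed

text \<open>The weight w is bump times trapezoid divided by n, hence at most 1 / n. Up to the factor
  a^K exp (-K), the sum of \<open>prime_coeff n * w n\<close> is a combination of two smoothed sums,
  so it is O(a^(1 - K) / \<delta>), and this is O(\<delta> / a) for K \<ge> 2B + 2. Thus primes
  weighted by ln p carry almost the same total weight as all integers, which the harmonic sum bounds
  below. Every loss is a relative O(1 / a).\<close>

lemma primes_log_interval:
  fixes B :: real
  assumes B: "B \<ge> 0"
  obtains C a0 where "C > 0" "a0 \<ge> 1"
    "\<And>a \<delta>. a \<ge> a0 \<Longrightarrow> a powr (- B) \<le> \<delta> \<Longrightarrow> \<delta> \<le> 1 \<Longrightarrow>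
      (\<Sum>p\<in>{p. prime p \<and> \<bar>ln (real p) - a\<bar> < \<delta> / 2}. ln (real p) / real p) \<ge> \<delta> * (1 - C / a)"
proof -
  \<comment> \<open>Large enough that a^2 \<le> \<delta>^2 a^K whenever \<delta> \<ge>
    a^(-B).\<close>
  define K where "K = nat \<lceil>2 * B\<rceil> + 2"
  have Kpos: "K > 0" by (simp add: K_def)
  have K: "real K \<ge> 2 * B + 2" unfolding K_def using real_nat_ceiling_ge[of "2 * B"] by simp
  from smoothed_prime_sum_bound[of K] obtain C c where C: "C > 0" "c > 0"
    "\<And>\<eta> a h. 0 < \<eta> \<Longrightarrow> \<eta> \<le> c \<Longrightarrow> 0 < h \<Longrightarrow> h \<le> 1 \<Longrightarrow>
       \<bar>\<Sum>m. prime_coeff (Suc m) * ln (real (Suc m)) ^ K * real (Suc m) powr (- (1 + \<eta>)) * hat ((ln (real (Suc m)) - a) / h)\<bar> \<le> C * h powr (- 1/2)"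
    by blast
  \<comment> \<open>Makes the rounding error exp (-(a - h2)) of the harmonic sum at most \<delta> /
    a.\<close>
  have "eventually (\<lambda>a::real. exp (1 - a) \<le> a powr (- B) / a) at_top" by real_asymp
  then obtain a1 where a1: "\<And>a. a \<ge> a1 \<Longrightarrow> exp (1 - a) \<le> a powr (- B) / a"
    by (auto simp: eventually_at_top_linorder)
  define a0 where "a0 = Max {1, a1, real K / c, real K}"
  define C' where "C' = real K + 2 + 16 * C * exp (real K)"
  show thesis
  proof (rule that[of C' a0])
    show "C' > 0" using C Kpos by (auto simp: C'_def intro!: add_pos_pos)
    show "a0 \<ge> 1" by (simp add: a0_def)
    fix a \<delta> :: real assume a: "a \<ge> a0" and \<delta>: "a powr (- B) \<le> \<delta>" "\<delta> \<le> 1"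
    have aa: "a \<ge> 1" "a \<ge> a1" "a \<ge> real K / c" "a \<ge> real K" using a by (auto simp: a0_def)
    have dpos: "\<delta> > 0" using \<delta> aa powr_gt_zero[of a "- B"] by linarith
    define \<eta> where "\<eta> = real K / a"
    have \<eta>: "0 < \<eta>" "\<eta> \<le> c" using aa C Kpos by (auto simp: \<eta>_def field_simps)
    \<comment> \<open>Ramps of relative width of order 1 / a: narrow enough to lose only O(\<delta>
      / a) of the interval, and wide enough that dividing by h costs only 8 a / \<delta>.\<close>
    define h where "h = \<delta> / (8 * a)"
    define h1 where "h1 = \<delta> / 2"
    define h2 where "h2 = h1 - h"
    have h: "h > 0" "h \<le> \<delta> / 8" using dpos aa by (auto simp: h_def field_simps)
    have h12: "0 < h2" "h2 < h1" "h1 \<le> 1/2" using h dpos \<delta> by (auto simp: h2_def h1_def)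
    define N where "N = {n::nat. n \<ge> 1 \<and> \<bar>ln (real n) - a\<bar> < h1}"
    have finN: "finite N" unfolding N_def by (rule finite_log_interval)
    have lnN: "ln (real n) \<ge> 0" "real n > 0" if "n \<in> N" for n using that by (auto simp: N_def)
    define b where "b = (\<lambda>n. prime_coeff n * ln (real n) ^ K * real n powr (- (1 + \<eta>)))"
    define S where "S = (\<lambda>h'. \<Sum>n\<in>N. b n * hat ((ln (real n) - a) / h'))"
    have S: "\<bar>h' * S h'\<bar> \<le> C" if h': "0 < h'" "h' \<le> h1" for h'
    proof -
      have "S h' = (\<Sum>m. b (Suc m) * hat ((ln (real (Suc m)) - a) / h'))"
        unfolding S_def N_def by (rule suminf_hat_finite[OF h', symmetric])
      then have "\<bar>S h'\<bar> \<le> C * h' powr (- 1/2)"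
        unfolding b_def using C(3)[OF \<eta> h'(1), of a] h' h12 by simp
      then have "\<bar>h' * S h'\<bar> \<le> h' powr 1 * (C * h' powr (- 1/2))"
        using h' by (simp add: abs_mult)
      also have "\<dots> = C * (h' powr (1 + - 1/2))" by (simp only: powr_add mult_ac)
      also have "\<dots> \<le> C * 1" using C h' h12 by (intro mult_left_mono powr_le1) auto
      finally show ?thesis by simp
    qed
    define w where "w = (\<lambda>n. bump K a (ln (real n)) * trapezoid h1 h2 (ln (real n) - a) / real n)"
    have w: "0 \<le> w n" "w n \<le> 1 / real n" if n: "n \<in> N" for n
    proof -
      note * = bump_bounds(1,2)[OF aa(1) lnN(1)[OF n], of K] trapezoid_bounds(1,2)[OF h12(1,2), of "ln (real n) - a"]
      show "0 \<le> w n" using * by (simp add: w_def)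
      have "bump K a (ln (real n)) * trapezoid h1 h2 (ln (real n) - a) \<le> 1 * 1" using * by (intro mult_mono) auto
      then show "w n \<le> 1 / real n" unfolding w_def by (intro divide_right_mono) auto
    qed
    define T where "T = (\<Sum>n\<in>N. prime_coeff n * w n)"
    have bw: "b n * trapezoid h1 h2 (ln (real n) - a) = a ^ K * exp (- real K) * (prime_coeff n * w n)" if n: "n \<in> N" for n
    proof -
      have "real n powr (- (1 + \<eta>)) = exp (- ln (real n)) * exp (- (real K * ln (real n) / a))"
        using lnN[OF n] by (simp add: powr_def \<eta>_def algebra_simps flip: exp_add)
      also have "exp (- ln (real n)) = 1 / real n" using lnN[OF n] by (simp add: exp_minus divide_inverse)
      finally have 1: "real n powr (- (1 + \<eta>)) = exp (- (real K * ln (real n) / a)) / real n" by simp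
      have "exp (- (real K * ln (real n) / a)) = exp (- real K) * exp (real K - real K * ln (real n) / a)"
        by (simp flip: exp_add)
      moreover have "ln (real n) ^ K = a ^ K * (ln (real n) / a) ^ K"
        using aa by (simp add: power_divide)
      ultimately show ?thesis
        unfolding b_def w_def bump_def 1 by (simp add: mult_ac)
    qed
    have "a ^ K * exp (- real K) * T = (\<Sum>n\<in>N. b n * trapezoid h1 h2 (ln (real n) - a))"
      unfolding T_def sum_distrib_left using bw by (intro sum.cong) auto
    also have "\<dots> = (h1 * S h1 - h2 * S h2) / h"
    proof -
      have "(h1 * S h1 - h2 * S h2) / h = (\<Sum>n\<in>N. (h1 * (b n * hat ((ln (real n) - a) / h1)) - h2 * (b n * hat ((ln (real n) - a) / h2))) / h)"
        unfolding S_def by (simp only: sum_distrib_left sum_subtractf[symmetric] sum_divide_distrib)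
      also have "\<dots> = (\<Sum>n\<in>N. b n * trapezoid h1 h2 (ln (real n) - a))"
      proof (rule sum.cong[OF refl])
        fix n
        have "h1 - h2 = h" by (simp add: h2_def)
        then show "(h1 * (b n * hat ((ln (real n) - a) / h1)) - h2 * (b n * hat ((ln (real n) - a) / h2))) / h = b n * trapezoid h1 h2 (ln (real n) - a)"
          unfolding trapezoid_def by (simp only: times_divide_eq_right right_diff_distrib mult.left_commute)
      qed
      finally show ?thesis by (rule sym)
    qed
    finally have TS: "a ^ K * exp (- real K) * T = (h1 * S h1 - h2 * S h2) / h" .
    have "\<bar>a ^ K * exp (- real K) * T\<bar> \<le> 2 * C / h"
      unfolding TS abs_divide using S[of h1] S[of h2] h h12 by (intro frac_le) auto
    then have "a ^ K * (exp (- real K) * \<bar>T\<bar>) \<le> 2 * C / h" using aa by (simp add: abs_mult)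
    then have "a ^ K * (exp (- real K) * \<bar>T\<bar>) * exp (real K) \<le> 2 * C / h * exp (real K)"
      by (intro mult_right_mono) auto
    then have "\<bar>T\<bar> * a ^ K \<le> 2 * C / h * exp (real K)"
      by (simp add: exp_minus mult_ac)
    then have "\<bar>T\<bar> \<le> 2 * C / h * exp (real K) / a ^ K"
      using aa by (subst pos_le_divide_eq) auto
    also have "\<dots> = 16 * C * exp (real K) * (a / (\<delta> * a ^ K))" by (simp add: h_def)
    also have "\<dots> \<le> 16 * C * exp (real K) * (\<delta> / a)"
    proof (intro mult_left_mono)
      have "a powr (- B) * a powr (- B) \<le> \<delta> * \<delta>" using \<delta> dpos by (intro mult_mono) auto
      then have d2: "a powr (- (2 * B)) \<le> \<delta> * \<delta>" by (simp flip: powr_add)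
      have "a * a = a ^ K * a powr (2 - real K)"
        using aa by (simp add: powr_diff powr_realpow power2_eq_square)
      also have "\<dots> \<le> a ^ K * a powr (- (2 * B))" using aa K by (intro mult_left_mono powr_mono) auto
      also have "\<dots> \<le> a ^ K * (\<delta> * \<delta>)" using d2 aa by (intro mult_left_mono) auto
      finally show "a / (\<delta> * a ^ K) \<le> \<delta> / a" using aa dpos by (simp add: field_simps)
    qed (use C in auto)
    finally have T: "\<bar>T\<bar> \<le> 16 * C * exp (real K) * (\<delta> / a)" .
    define P where "P = {p. prime p \<and> \<bar>ln (real p) - a\<bar> < \<delta> / 2}"
    have P: "P = {n\<in>N. prime n}" using prime_ge_1_nat by (auto simp: P_def N_def h1_def)
    define N2 where "N2 = {n::nat. n \<ge> 1 \<and> a - h2 \<le> ln (real n) \<and> ln (real n) \<le> a + h2}"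
    have N2: "N2 \<subseteq> N" using h12 by (auto simp: N2_def N_def abs_less_iff)
    have "T = (\<Sum>n\<in>N. (if prime n then ln (real n) * w n else 0) - w n)"
      unfolding T_def by (intro sum.cong) (auto simp: prime_coeff_def algebra_simps)
    also have "\<dots> = (\<Sum>p\<in>P. ln (real p) * w p) - (\<Sum>n\<in>N. w n)"
      unfolding P sum_subtractf using finN by (simp add: sum.inter_filter)
    finally have T2: "(\<Sum>p\<in>P. ln (real p) * w p) = T + (\<Sum>n\<in>N. w n)" by simp
    have "exp (- (a - h2)) \<le> exp (1 - a)" using h12 by simp
    also have "\<dots> \<le> a powr (- B) / a" by (rule a1[OF aa(2)])
    also have "\<dots> \<le> \<delta> / a" using \<delta> aa by (intro divide_right_mono) auto
    finally have ex: "exp (- (a - h2)) \<le> \<delta> / a" .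
    have "\<delta> * (1 - 2 / a) \<le> (a + h2) - (a - h2) - exp (- (a - h2))"
    proof -
      have "\<delta> * (1 - 2 / a) = \<delta> - 2 * (\<delta> / a)" by (simp add: algebra_simps)
      moreover have "8 * h = \<delta> / a" by (simp add: h_def)
      moreover have "\<delta> / a \<ge> 0" using dpos aa by simp
      ultimately show ?thesis using ex unfolding h2_def h1_def by linarith
    qed
    also have "\<dots> \<le> (\<Sum>n\<in>N2. 1 / real n)"
      unfolding N2_def using h12 by (intro harmonic_log_interval) auto
    finally have harm: "\<delta> * (1 - 2 / a) \<le> (\<Sum>n\<in>N2. 1 / real n)" .
    have "(1 - real K / a) * (\<delta> * (1 - 2 / a)) \<le> (1 - real K / a) * (\<Sum>n\<in>N2. 1 / real n)"
      using harm aa by (intro mult_left_mono) auto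
    also have "\<dots> \<le> (\<Sum>n\<in>N2. w n)"
      unfolding sum_distrib_left
    proof (rule sum_mono)
      fix n assume n: "n \<in> N2"
      then have nN: "n \<in> N" using N2 by auto
      have "\<bar>ln (real n) - a\<bar> \<le> h2" using n by (auto simp: N2_def abs_le_iff)
      then show "(1 - real K / a) * (1 / real n) \<le> w n"
        unfolding w_def using bump_bounds(3)[OF aa(1) lnN(1)[OF nN], of K] trapezoid_bounds(3)[OF h12(1,2), of "ln (real n) - a"] h12
        by (auto intro!: divide_right_mono)
    qed
    also have "\<dots> \<le> (\<Sum>n\<in>N. w n)" by (rule sum_mono2[OF finN N2]) (use w in auto)
    finally have A: "(1 - real K / a) * (\<delta> * (1 - 2 / a)) \<le> (\<Sum>n\<in>N. w n)" .
    have "\<delta> * (1 - C' / a) \<le> (1 - real K / a) * (\<delta> * (1 - 2 / a)) - 16 * C * exp (real K) * (\<delta> / a)"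
    proof -
      have "(1 - real K / a) * (\<delta> * (1 - 2 / a)) - 16 * C * exp (real K) * (\<delta> / a) - \<delta> * (1 - C' / a) = \<delta> * (2 * real K / (a * a))"
        by (simp add: C'_def divide_inverse algebra_simps)
      moreover have "\<delta> * (2 * real K / (a * a)) \<ge> 0" using dpos by simp
      ultimately show ?thesis by linarith
    qed
    also have "\<dots> \<le> (\<Sum>n\<in>N. w n) + T" using A T by linarith
    also have "\<dots> = (\<Sum>p\<in>P. ln (real p) * w p)" using T2 by simp
    also have "\<dots> \<le> (\<Sum>p\<in>P. ln (real p) / real p)"
    proof (rule sum_mono)
      fix p assume "p \<in> P"
      then have p: "p \<in> N" by (simp add: P)
      show "ln (real p) * w p \<le> ln (real p) / real p"
        using mult_left_mono[OF w(2)[OF p] lnN(1)[OF p]] by simp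
    qed
    finally show "\<delta> * (1 - C' / a) \<le> (\<Sum>p\<in>{p. prime p \<and> \<bar>ln (real p) - a\<bar> < \<delta> / 2}. ln (real p) / real p)"
      unfolding P_def .
  qed
qed

text \<open>A weak form of Mertens' bound. The Euler product at \<sigma> = 1 + 1 / L, together with
  zeta at \<sigma> being O(L), bounds the sum of p^(-\<sigma>), and for p \<le> exp L passing to 1 /
  p costs only a factor p^(1/L) \<le> 3. The constant 3 ends up in a power of L, to be beaten by 2^r
  in the sieve.\<close>

lemma sum_inverse_primes_upper:
  obtains C where "C \<ge> 1"
    "\<And>L S. L \<ge> 1 \<Longrightarrow> finite S \<Longrightarrow> (\<And>p. p \<in> S \<Longrightarrow> prime p \<and> ln (real p) \<le> L) \<Longrightarrow> (\<Sum>p\<in>S. 1 / real p) \<le> 3 * ln (C * L)"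
proof -
  from zeta_reg_bound[of "1/2"] obtain C0 where C0: "C0 \<ge> 1"
    "\<And>s. 1 - 1/2 \<le> Re s \<Longrightarrow> Re s \<le> 3 \<Longrightarrow> norm (zeta_reg s) \<le> C0 * ht s powr (1 + 2 * (1/2))" by auto
  show thesis
  proof (rule that[of "9 * C0"])
    show "9 * C0 \<ge> 1" using C0 by simp
    fix L :: real and S :: "nat set"
    assume L: "L \<ge> 1" and S: "finite S" "\<And>p. p \<in> S \<Longrightarrow> prime p \<and> ln (real p) \<le> L"
    define \<sigma> where "\<sigma> = 1 + 1 / L"
    define s where "s = complex_of_real \<sigma>"
    have \<sigma>: "\<sigma> > 1" "\<sigma> \<le> 2" using L by (auto simp: \<sigma>_def)
    have cp: "cpow (real p) s = of_real (real p powr (- \<sigma>))" if "p > 0" for p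
      using cpow_Complex[of "real p" \<sigma> 0] that by (simp add: s_def complex_of_real_def)
    have "norm (zeta_reg s) \<le> C0 * 9"
      using C0(2)[of s] \<sigma> by (simp add: s_def ht_def)
    moreover have "norm (zeta_reg s) = 1 / L * norm (zeta s)"
      using zeta_reg_eq_zeta[of s] \<sigma> L by (simp add: s_def norm_mult \<sigma>_def norm_divide)
    ultimately have zb: "norm (zeta s) \<le> 9 * C0 * L" using L by (simp add: field_simps)
    define x where "x = (\<lambda>p::nat. real p powr (- \<sigma>))"
    have x: "0 < x p" "x p < 1" if "prime p" for p
      using that prime_gt_1_nat[OF that] \<sigma> by (auto simp: x_def powr_less_one)
    have "1 \<le> (\<Prod>p\<in>S. 1 - x p) * norm (zeta s)"
    proof (rule LIMSEQ_le_const2)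
      show "(\<lambda>N. norm ((\<Prod>p\<in>primes_le N. 1 - cpow (real p) s) * zeta s)) \<longlonglongrightarrow> 1"
        using tendsto_norm[OF euler_product_tendsto[of s]] \<sigma> by (simp add: s_def)
      show "\<exists>N0. \<forall>N\<ge>N0. norm ((\<Prod>p\<in>primes_le N. 1 - cpow (real p) s) * zeta s) \<le> (\<Prod>p\<in>S. 1 - x p) * norm (zeta s)"
      proof (intro exI[of _ "Max (insert 0 S)"] allI impI)
        fix N assume "Max (insert 0 S) \<le> N"
        then have SN: "S \<subseteq> primes_le N" using S by (auto simp: primes_le_def)
        have "norm (\<Prod>p\<in>primes_le N. 1 - cpow (real p) s) = (\<Prod>p\<in>primes_le N. 1 - x p)"
          unfolding prod_norm[symmetric]
        proof (rule prod.cong[OF refl])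
          fix p assume "p \<in> primes_le N"
          then have p: "prime p" by (simp add: primes_le_def)
          have "1 - cpow (real p) s = of_real (1 - x p)" using p prime_gt_0_nat by (simp add: cp x_def)
          then show "norm (1 - cpow (real p) s) = 1 - x p" using x[OF p] by (simp only: norm_of_real)
        qed
        also have "\<dots> = (\<Prod>p\<in>primes_le N - S. 1 - x p) * (\<Prod>p\<in>S. 1 - x p)"
          using SN S by (intro prod.subset_diff) auto
        also have "\<dots> \<le> 1 * (\<Prod>p\<in>S. 1 - x p)"
          using x S by (intro mult_right_mono prod_le_1 prod_nonneg) (auto simp: primes_le_def less_imp_le)
        finally show "norm ((\<Prod>p\<in>primes_le N. 1 - cpow (real p) s) * zeta s) \<le> (\<Prod>p\<in>S. 1 - x p) * norm (zeta s)"
          by (simp add: norm_mult mult_right_mono)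
      qed
    qed
    also have "(\<Prod>p\<in>S. 1 - x p) \<le> (\<Prod>p\<in>S. exp (- x p))"
    proof (rule prod_mono)
      fix p assume "p \<in> S"
      then show "0 \<le> 1 - x p \<and> 1 - x p \<le> exp (- x p)"
        using x[of p] S(2)[of p] exp_ge_add_one_self[of "- x p"] by simp
    qed
    also have "\<dots> = exp (- (\<Sum>p\<in>S. x p))" using S by (simp add: exp_sum sum_negf[symmetric])
    finally have "1 \<le> exp (- (\<Sum>p\<in>S. x p)) * norm (zeta s)" by (simp add: mult_right_mono)
    also have "\<dots> \<le> exp (- (\<Sum>p\<in>S. x p)) * (9 * C0 * L)" using zb by (intro mult_left_mono) auto
    finally have "exp (\<Sum>p\<in>S. x p) \<le> 9 * C0 * L" by (simp add: exp_minus field_simps)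
    then have sx: "(\<Sum>p\<in>S. x p) \<le> ln (9 * C0 * L)"
      using C0 L by (subst ln_ge_iff) auto
    have "(\<Sum>p\<in>S. 1 / real p) \<le> (\<Sum>p\<in>S. 3 * x p)"
    proof (rule sum_mono)
      fix p assume p: "p \<in> S"
      then have pp: "real p > 0" using S prime_gt_0_nat by auto
      have "1 / L * ln (real p) \<le> 1" using S(2)[OF p] L by (simp add: field_simps)
      then have "exp (1 / L * ln (real p)) \<le> 3" using exp_le by (meson exp_le_cancel_iff order_trans)
      then have q: "real p powr (1 / L) \<le> 3" using pp by (simp add: powr_def)
      have "x p = 1 / real p * (1 / real p powr (1 / L))"
      proof -
        have "- \<sigma> = - 1 + - (1 / L)" by (simp add: \<sigma>_def)
        then have "x p = real p powr (- 1) * real p powr (- (1 / L))" by (simp only: x_def powr_add)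
        then show ?thesis using pp by (simp only: powr_minus_divide) simp
      qed
      then have "1 / real p = x p * real p powr (1 / L)" using pp by simp
      moreover have "x p * real p powr (1 / L) \<le> x p * 3"
        using q by (intro mult_left_mono) (auto simp: x_def)
      ultimately show "1 / real p \<le> 3 * x p" by linarith
    qed
    also have "\<dots> = 3 * (\<Sum>p\<in>S. x p)" by (simp add: sum_distrib_left)
    finally show "(\<Sum>p\<in>S. 1 / real p) \<le> 3 * ln (9 * C0 * L)" using sx by linarith
  qed
qed

section \<open>Independent Bernoulli variables and the sieve\<close>

text \<open>The probability that a random subset of S, containing each p independently with
  probability \<open>x p\<close>, is exactly T.\<close>

definition bern_weight :: "('a \<Rightarrow> real) \<Rightarrow> 'a set \<Rightarrow> 'a set \<Rightarrow> real" where
  "bern_weight x S T = (\<Prod>p\<in>T. x p) * (\<Prod>p\<in>S - T. 1 - x p)"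

lemma sum_Pow_insert:
  assumes "finite S" "p \<notin> S"
  shows "(\<Sum>V\<in>Pow (insert p S). g V) = (\<Sum>V\<in>Pow S. g V) + (\<Sum>V\<in>Pow S. g (insert p V))"
proof -
  have inj: "inj_on (insert p) (Pow S)" using assms by (auto simp: inj_on_def)
  have "(\<Sum>V\<in>Pow (insert p S). g V) = (\<Sum>V\<in>Pow S. g V) + (\<Sum>V\<in>insert p ` Pow S. g V)"
    unfolding Pow_insert using assms by (intro sum.union_disjoint) auto
  then show ?thesis using inj by (simp add: sum.reindex)
qed

lemma sum_Pow_prod:
  fixes x :: "'a \<Rightarrow> real"
  assumes "finite S"
  shows "(\<Sum>V\<in>Pow S. \<Prod>p\<in>V. x p) = (\<Prod>p\<in>S. 1 + x p)"
  using assms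
proof (induction S)
  case (insert p S)
  have "(\<Sum>V\<in>Pow S. \<Prod>q\<in>insert p V. x q) = (\<Sum>V\<in>Pow S. x p * (\<Prod>q\<in>V. x q))"
    using insert by (intro sum.cong refl prod.insert) (auto intro: finite_subset)
  then show ?case using insert by (simp add: sum_Pow_insert algebra_simps sum_distrib_left[symmetric])
qed simp

lemma bern_weight_nonneg:
  assumes "\<And>p. p \<in> S \<Longrightarrow> 0 \<le> x p \<and> x p \<le> 1" "T \<subseteq> S"
  shows "bern_weight x S T \<ge> 0"
  unfolding bern_weight_def using assms by (intro mult_nonneg_nonneg prod_nonneg) auto

lemma sum_bern_weight_Un:
  fixes g :: "'a set \<Rightarrow> real"
  assumes fin: "finite S" "finite S'" and disj: "S \<inter> S' = {}"
  shows "(\<Sum>T\<in>Pow (S \<union> S'). bern_weight x (S \<union> S') T * g T) =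
    (\<Sum>T\<in>Pow S. bern_weight x S T * (\<Sum>T'\<in>Pow S'. bern_weight x S' T' * g (T \<union> T')))"
proof -
  have "(\<Sum>T\<in>Pow (S \<union> S'). bern_weight x (S \<union> S') T * g T) =
      (\<Sum>(T, T')\<in>Pow S \<times> Pow S'. bern_weight x (S \<union> S') (T \<union> T') * g (T \<union> T'))"
  proof (rule sum.reindex_bij_witness[of _ "\<lambda>(T, T'). T \<union> T'" "\<lambda>T. (T \<inter> S, T \<inter> S')"])
    fix b assume "b \<in> Pow S \<times> Pow S'"
    then show "(case case b of (T, T') \<Rightarrow> T \<union> T' of T \<Rightarrow> (T \<inter> S, T \<inter> S')) = b" using disj by auto
  qed (auto simp: Int_Un_distrib[symmetric] Int_absorb2)
  also have "\<dots> = (\<Sum>(T, T')\<in>Pow S \<times> Pow S'. bern_weight x S T * (bern_weight x S' T' * g (T \<union> T')))"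
  proof (intro sum.cong refl, clarify)
    fix T T' assume T: "T \<subseteq> S" "T' \<subseteq> S'"
    have fT: "finite T" "finite T'" using T fin by (auto intro: finite_subset)
    have "(\<Prod>p\<in>T \<union> T'. x p) = (\<Prod>p\<in>T. x p) * (\<Prod>p\<in>T'. x p)"
      using T disj fT by (intro prod.union_disjoint) auto
    moreover have "S \<union> S' - (T \<union> T') = (S - T) \<union> (S' - T')" using T disj by auto
    moreover have "(\<Prod>p\<in>(S - T) \<union> (S' - T'). 1 - x p) = (\<Prod>p\<in>S - T. 1 - x p) * (\<Prod>p\<in>S' - T'. 1 - x p)"
      using disj fin by (intro prod.union_disjoint) auto
    ultimately show "bern_weight x (S \<union> S') (T \<union> T') * g (T \<union> T') = bern_weight x S T * (bern_weight x S' T' * g (T \<union> T'))"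
      by (simp add: bern_weight_def)
  qed
  also have "\<dots> = (\<Sum>T\<in>Pow S. \<Sum>T'\<in>Pow S'. bern_weight x S T * (bern_weight x S' T' * g (T \<union> T')))"
    by (rule sum.cartesian_product[symmetric])
  finally show ?thesis by (simp add: sum_distrib_left)
qed

lemma sum_bern_weight:
  assumes "finite S"
  shows "(\<Sum>T\<in>Pow S. bern_weight x S T) = 1"
  using assms
proof (induction S)
  case (insert p S)
  have "(\<Sum>T\<in>Pow (S \<union> {p}). bern_weight x (S \<union> {p}) T * 1) =
     (\<Sum>T\<in>Pow S. bern_weight x S T * (\<Sum>T'\<in>Pow {p}. bern_weight x {p} T' * 1))"
    using insert by (intro sum_bern_weight_Un) auto
  also have "(\<Sum>T'\<in>Pow {p}. bern_weight x {p} T' * 1) = 1"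
    by (simp add: Pow_insert bern_weight_def)
  finally show ?case using insert by simp
qed (simp add: bern_weight_def)

definition hits :: "('j \<Rightarrow> 'a set) \<Rightarrow> 'j set \<Rightarrow> 'a set \<Rightarrow> 'j set" where
  "hits P J T = {j\<in>J. T \<inter> P j \<noteq> {}}"

text \<open>Monotone events are compared by revealing one block at a time: conditionally on the other
  blocks, lowering the hitting probability of block \<open>j\<close> by \<open>e j\<close> costs at most \<open>e j\<close>.\<close>

lemma bern_weight_blocks:
  fixes E :: "'j set \<Rightarrow> bool"
  assumes "finite J" and "\<And>j. j \<in> J \<Longrightarrow> finite (P j)"
    and "\<And>i j. i \<in> J \<Longrightarrow> j \<in> J \<Longrightarrow> i \<noteq> j \<Longrightarrow> P i \<inter> P j = {}"
    and "\<And>j. j \<in> J \<Longrightarrow> 0 \<le> r j \<and> r j \<le> 1"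
    and "\<And>j p. j \<in> J \<Longrightarrow> p \<in> P j \<Longrightarrow> 0 \<le> x p \<and> x p \<le> 1"
    and "\<And>j. j \<in> J \<Longrightarrow> 1 - (\<Prod>p\<in>P j. 1 - x p) \<ge> r j - e j"
    and "\<And>j. j \<in> J \<Longrightarrow> e j \<ge> (0::real)"
    and "\<And>A B. A \<subseteq> B \<Longrightarrow> E A \<Longrightarrow> E B"
  shows "(\<Sum>T\<in>Pow (\<Union>j\<in>J. P j). bern_weight x (\<Union>j\<in>J. P j) T * of_bool (E (hits P J T)))
    \<ge> (\<Sum>T\<in>Pow J. bern_weight r J T * of_bool (E T)) - (\<Sum>j\<in>J. e j)"
  using assms
proof (induction J arbitrary: E)
  case empty
  show ?case by (simp add: bern_weight_def hits_def)
next
  case (insert j J E)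
  define U where "U = (\<Union>i\<in>J. P i)"
  define W where "W = (\<lambda>E. \<Sum>T\<in>Pow U. bern_weight x U T * of_bool (E (hits P J T)))"
  define w where "w = (\<lambda>E. \<Sum>T\<in>Pow J. bern_weight r J T * of_bool (E T))"
  \<comment> \<open>What remains of the event once block j is known to be hit; by monotonicity E
    implies it.\<close>
  define E' where "E' = (\<lambda>A. E (insert j A))"
  define q where "q = 1 - (\<Prod>p\<in>P j. 1 - x p)"
  define \<epsilon> where "\<epsilon> = (\<Sum>i\<in>J. e i)"
  have IH: "W F \<ge> w F - \<epsilon>" if "\<And>A B. A \<subseteq> B \<Longrightarrow> F A \<Longrightarrow> F B" for F
    unfolding W_def w_def U_def \<epsilon>_def
  proof (rule insert.IH)
    show "\<And>A B. A \<subseteq> B \<Longrightarrow> F A \<Longrightarrow> F B" by (rule that)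
    show "0 \<le> x p \<and> x p \<le> 1" if "i \<in> J" "p \<in> P i" for i p
      using insert.prems(4)[of i p] that by simp
  qed (use insert.prems(1,2,3,5,6) in auto)
  have finU: "finite U" and finj: "finite (P j)" using insert.hyps insert.prems(1) by (auto simp: U_def)
  have disj: "U \<inter> P j = {}" using insert.prems(2)[of _ j] insert.hyps by (auto simp: U_def)
  have q: "0 \<le> q" "q \<le> 1" "q \<ge> r j - e j"
  proof -
    have "(\<Prod>p\<in>P j. 1 - x p) \<le> 1" "(\<Prod>p\<in>P j. 1 - x p) \<ge> 0"
      using insert.prems(4)[of j] by (auto intro!: prod_le_1 prod_nonneg)
    then show "0 \<le> q" "q \<le> 1" by (auto simp: q_def)
    show "q \<ge> r j - e j" using insert.prems(5)[of j] by (simp add: q_def)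
  qed
  have inner: "(\<Sum>T'\<in>Pow (P j). bern_weight x (P j) T' * of_bool (E (hits P (insert j J) (T \<union> T'))))
      = (1 - q) * of_bool (E (hits P J T)) + q * of_bool (E' (hits P J T))" if T: "T \<in> Pow U" for T
  proof -
    have h0: "hits P (insert j J) (T \<union> {}) = hits P J T" using T disj by (auto simp: hits_def)
    have h1: "hits P (insert j J) (T \<union> T') = insert j (hits P J T)" if "T' \<in> Pow (P j) - {{}}" for T'
    proof -
      have "T' \<inter> P i = {}" if "i \<in> J" for i
        using \<open>T' \<in> _\<close> that insert.prems(2)[of i j] insert.hyps by auto
      moreover have "T' \<inter> P j \<noteq> {}" using that by auto
      ultimately show ?thesis by (auto simp: hits_def)
    qed
    have total: "(\<Sum>T'\<in>Pow (P j) - {{}}. bern_weight x (P j) T') = q"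
    proof -
      have "(\<Sum>T'\<in>Pow (P j). bern_weight x (P j) T') = bern_weight x (P j) {} + (\<Sum>T'\<in>Pow (P j) - {{}}. bern_weight x (P j) T')"
        using finj by (intro sum.remove) auto
      then show ?thesis using sum_bern_weight[OF finj, of x] by (simp add: bern_weight_def q_def)
    qed
    have "(\<Sum>T'\<in>Pow (P j). bern_weight x (P j) T' * of_bool (E (hits P (insert j J) (T \<union> T')))) =
      bern_weight x (P j) {} * of_bool (E (hits P (insert j J) (T \<union> {}))) +
      (\<Sum>T'\<in>Pow (P j) - {{}}. bern_weight x (P j) T' * of_bool (E (hits P (insert j J) (T \<union> T'))))"
      using finj by (intro sum.remove) auto
    also have "(\<Sum>T'\<in>Pow (P j) - {{}}. bern_weight x (P j) T' * of_bool (E (hits P (insert j J) (T \<union> T')))) =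
      (\<Sum>T'\<in>Pow (P j) - {{}}. bern_weight x (P j) T' * of_bool (E' (hits P J T)))"
      using h1 by (intro sum.cong) (auto simp: E'_def)
    also have "\<dots> = q * of_bool (E' (hits P J T))" by (simp only: sum_distrib_right[symmetric] total)
    finally show ?thesis unfolding h0 by (simp add: bern_weight_def q_def)
  qed
  have UJ: "(\<Union>i\<in>insert j J. P i) = U \<union> P j" by (auto simp: U_def)
  have big: "(\<Sum>T\<in>Pow (\<Union>i\<in>insert j J. P i). bern_weight x (\<Union>i\<in>insert j J. P i) T * of_bool (E (hits P (insert j J) T)))
      = (1 - q) * W E + q * W E'"
  proof -
    have "(\<Sum>T\<in>Pow (U \<union> P j). bern_weight x (U \<union> P j) T * of_bool (E (hits P (insert j J) T)))
      = (\<Sum>T\<in>Pow U. bern_weight x U T * ((1 - q) * of_bool (E (hits P J T)) + q * of_bool (E' (hits P J T))))"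
      unfolding sum_bern_weight_Un[OF finU finj disj] using inner by (intro sum.cong) auto
    also have "\<dots> = (1 - q) * W E + q * W E'"
      unfolding W_def sum_distrib_left sum.distrib[symmetric]
      by (intro sum.cong) (auto simp: algebra_simps)
    finally show ?thesis unfolding UJ .
  qed
  have small: "(\<Sum>T\<in>Pow (insert j J). bern_weight r (insert j J) T * of_bool (E T)) = (1 - r j) * w E + r j * w E'"
  proof -
    have "(\<Sum>T\<in>Pow (J \<union> {j}). bern_weight r (J \<union> {j}) T * of_bool (E T))
      = (\<Sum>T\<in>Pow J. bern_weight r J T * (\<Sum>T'\<in>Pow {j}. bern_weight r {j} T' * of_bool (E (T \<union> T'))))"
      using insert.hyps by (intro sum_bern_weight_Un) auto
    also have "\<dots> = (\<Sum>T\<in>Pow J. bern_weight r J T * ((1 - r j) * of_bool (E T) + r j * of_bool (E' T)))"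
    proof -
      have "(\<Sum>T'\<in>Pow {j}. g T') = g {} + g {j}" for g :: "'j set \<Rightarrow> real" by (simp add: Pow_insert)
      then show ?thesis by (simp only: bern_weight_def E'_def) simp
    qed
    also have "\<dots> = (1 - r j) * w E + r j * w E'"
      unfolding w_def sum_distrib_left sum.distrib[symmetric]
      by (intro sum.cong) (auto simp: algebra_simps)
    finally show ?thesis by simp
  qed
  have mono: "\<And>A B. A \<subseteq> B \<Longrightarrow> E A \<Longrightarrow> E B" by (rule insert.prems(7))
  have mono': "E' B" if "A \<subseteq> B" "E' A" for A B
    using mono[of "insert j A" "insert j B"] that unfolding E'_def by auto
  have wnn: "bern_weight r J T \<ge> 0" if "T \<in> Pow J" for T
    using insert.prems(3) that by (intro bern_weight_nonneg) auto
  have w01: "w E \<le> w E'"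
    unfolding w_def E'_def using wnn mono[OF subset_insertI[of _ j]] by (intro sum_mono mult_left_mono) auto
  have w0: "w E \<ge> 0" unfolding w_def using wnn by (intro sum_nonneg) auto
  have w1: "w E' \<le> 1"
  proof -
    have "w E' \<le> (\<Sum>T\<in>Pow J. bern_weight r J T)"
      unfolding w_def using wnn by (intro sum_mono mult_left_le) auto
    then show ?thesis using sum_bern_weight[of J r] insert.hyps by simp
  qed
  \<comment> \<open>Up to the inductive error the value is w E + q (w E' - w E), increasing in q
    because E implies E'. Replacing q by r j - e j loses at most e j times a difference of
    probabilities.\<close>
  have c1: "(1 - q) * W E + q * W E' \<ge> (1 - q) * (w E - \<epsilon>) + q * (w E' - \<epsilon>)"
    using q IH[of E, OF mono] IH[of E', OF mono'] by (intro add_mono mult_left_mono) auto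
  have c2: "(1 - q) * (w E - \<epsilon>) + q * (w E' - \<epsilon>) = w E + q * (w E' - w E) - \<epsilon>" by (simp add: algebra_simps)
  have c3: "(r j - e j) * (w E' - w E) \<le> q * (w E' - w E)"
    using q w01 by (intro mult_right_mono) auto
  have c4: "e j * (w E' - w E) \<le> e j"
    using w01 w0 w1 insert.prems(6)[of j] by (intro mult_left_le) auto
  have c5: "(\<Sum>i\<in>insert j J. e i) = e j + \<epsilon>" using insert.hyps by (simp add: \<epsilon>_def)
  show ?case unfolding big small c5 using c1 c2 c3 c4 by (simp add: algebra_simps)
qed

section \<open>Bonferroni inequalities and Rankin's trick\<close>

definition elem_sym :: "('a \<Rightarrow> real) \<Rightarrow> 'a set \<Rightarrow> nat \<Rightarrow> real" where
  "elem_sym x S k = (\<Sum>V\<in>Pow S. if card V = k then (\<Prod>p\<in>V. x p) else 0)"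

definition bonferroni_sum :: "('a \<Rightarrow> real) \<Rightarrow> 'a set \<Rightarrow> nat \<Rightarrow> real" where
  "bonferroni_sum x S r = (\<Sum>V\<in>Pow S. if card V \<le> r then (- 1) ^ card V * (\<Prod>p\<in>V. x p) else 0)"

lemma elem_sym_insert:
  assumes "finite S" "p \<notin> S"
  shows "elem_sym x (insert p S) (Suc k) = elem_sym x S (Suc k) + x p * elem_sym x S k"
proof -
  have "(\<Sum>V\<in>Pow S. if card (insert p V) = Suc k then (\<Prod>q\<in>insert p V. x q) else 0) =
      (\<Sum>V\<in>Pow S. x p * (if card V = k then (\<Prod>q\<in>V. x q) else 0))"
  proof (rule sum.cong[OF refl])
    fix V assume "V \<in> Pow S"
    then have "finite V" "p \<notin> V" using assms by (auto intro: finite_subset)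
    then show "(if card (insert p V) = Suc k then (\<Prod>q\<in>insert p V. x q) else 0) = x p * (if card V = k then (\<Prod>q\<in>V. x q) else 0)"
      by simp
  qed
  then show ?thesis using assms by (simp add: elem_sym_def sum_Pow_insert sum_distrib_left)
qed

lemma elem_sym_0: "finite S \<Longrightarrow> elem_sym x S 0 = 1"
proof -
  assume S: "finite S"
  have "elem_sym x S 0 = (\<Sum>V\<in>Pow S. if V = {} then 1 else 0)"
    unfolding elem_sym_def using finite_subset[OF _ S] by (intro sum.cong refl if_cong) auto
  then show ?thesis using S by simp
qed

lemma bonferroni_sum_0: "finite S \<Longrightarrow> bonferroni_sum x S 0 = 1"
proof -
  assume S: "finite S"
  have "bonferroni_sum x S 0 = (\<Sum>V\<in>Pow S. if V = {} then 1 else 0)"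
    unfolding bonferroni_sum_def using finite_subset[OF _ S] by (intro sum.cong refl if_cong) auto
  then show ?thesis using S by simp
qed

lemma bonferroni_sum_insert:
  assumes "finite S" "p \<notin> S"
  shows "bonferroni_sum x (insert p S) (Suc r) = bonferroni_sum x S (Suc r) - x p * bonferroni_sum x S r"
proof -
  have "(\<Sum>V\<in>Pow S. if card (insert p V) \<le> Suc r then (- 1) ^ card (insert p V) * (\<Prod>q\<in>insert p V. x q) else 0) =
      (\<Sum>V\<in>Pow S. - x p * (if card V \<le> r then (- 1) ^ card V * (\<Prod>q\<in>V. x q) else 0))"
  proof (rule sum.cong[OF refl])
    fix V assume "V \<in> Pow S"
    then have "finite V" "p \<notin> V" using assms by (auto intro: finite_subset)
    then show "(if card (insert p V) \<le> Suc r then (- 1) ^ card (insert p V) * (\<Prod>q\<in>insert p V. x q) else 0)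
      = - x p * (if card V \<le> r then (- 1) ^ card V * (\<Prod>q\<in>V. x q) else 0)" by simp
  qed
  then show ?thesis unfolding bonferroni_sum_def sum_Pow_insert[OF assms] by (simp only: sum_distrib_left[symmetric])
qed

text \<open>Splitting off one element p gives parallel recursions for the truncated sum, the product
  and the elementary symmetric sum: the signed error at r is the one for S plus x p times the one
  for S at r - 1. Hence the induction on S with r arbitrary; r = 0 has no predecessor and uses that
  the product lies between 0 and 1.\<close>

lemma bonferroni:
  assumes "finite S" "\<And>p. p \<in> S \<Longrightarrow> 0 \<le> x p \<and> x p \<le> 1"
  shows "0 \<le> (- 1) ^ r * (bonferroni_sum x S r - (\<Prod>p\<in>S. 1 - x p))
     \<and> (- 1) ^ r * (bonferroni_sum x S r - (\<Prod>p\<in>S. 1 - x p)) \<le> elem_sym x S (Suc r)"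
  using assms
proof (induction S arbitrary: r)
  case empty
  then show ?case by (simp add: bonferroni_sum_def elem_sym_def)
next
  case (insert p S)
  define Pr where "Pr = (\<Prod>p\<in>S. 1 - x p)"
  have x: "0 \<le> x p" "x p \<le> 1" using insert.prems by auto
  have Pr: "0 \<le> Pr" "Pr \<le> 1"
    unfolding Pr_def using insert.prems by (auto intro!: prod_nonneg prod_le_1)
  have prod: "(\<Prod>p\<in>insert p S. 1 - x p) = Pr - x p * Pr" using insert by (simp add: Pr_def algebra_simps)
  have IH: "0 \<le> (- 1) ^ r * (bonferroni_sum x S r - Pr)" "(- 1) ^ r * (bonferroni_sum x S r - Pr) \<le> elem_sym x S (Suc r)" for r
    using insert.IH[of r] insert.prems by (auto simp: Pr_def)
  show ?case
  proof (cases r)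
    case 0
    have "0 \<le> x p * Pr" "x p * Pr \<le> x p * 1" using x Pr by (auto intro!: mult_nonneg_nonneg mult_left_le)
    then show ?thesis
      using IH[of 0] insert.hyps by (simp add: 0 prod bonferroni_sum_0 elem_sym_insert elem_sym_0)
  next
    case (Suc r')
    have "(- 1) ^ r * (bonferroni_sum x (insert p S) r - (\<Prod>p\<in>insert p S. 1 - x p)) =
       (- 1) ^ r * (bonferroni_sum x S r - Pr) + x p * ((- 1) ^ r' * (bonferroni_sum x S r' - Pr))"
      using insert.hyps by (simp add: Suc bonferroni_sum_insert prod algebra_simps)
    moreover have "0 \<le> x p * ((- 1) ^ r' * (bonferroni_sum x S r' - Pr))" using IH[of r'] x by simp
    moreover have "x p * ((- 1) ^ r' * (bonferroni_sum x S r' - Pr)) \<le> x p * elem_sym x S (Suc r')"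
      using IH[of r'] x by (intro mult_left_mono) auto
    ultimately show ?thesis using IH[of r] insert.hyps by (simp add: Suc elem_sym_insert)
  qed
qed

lemma prod_one_plus_le_exp:
  fixes x :: "'a \<Rightarrow> real"
  assumes "\<And>p. p \<in> S \<Longrightarrow> 0 \<le> x p"
  shows "(\<Prod>p\<in>S. 1 + x p) \<le> exp (\<Sum>p\<in>S. x p)"
proof (cases "finite S")
  case True
  have "(\<Prod>p\<in>S. 1 + x p) \<le> (\<Prod>p\<in>S. exp (x p))"
    using assms by (intro prod_mono) (auto intro: add_nonneg_nonneg)
  then show ?thesis using True by (simp add: exp_sum)
qed simp

text \<open>Rankin's trick: each set in F gets the extra weight c t^(card V) \<ge> 1, and the sum is
  then extended to all subsets, where it factors. Used with t = 2 for sets with many elements, t = 1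
  for a plain bound, and t = 1 / (card P + 1) for counting small sets.\<close>

lemma rankin:
  fixes x :: "'a \<Rightarrow> real" and t :: real
  assumes S: "finite S" and x: "\<And>p. p \<in> S \<Longrightarrow> 0 \<le> x p" and t: "t > 0"
    and F: "F \<subseteq> Pow S" "\<And>V. V \<in> F \<Longrightarrow> 1 \<le> c * t ^ card V" and c: "c \<ge> 0"
  shows "(\<Sum>V\<in>F. \<Prod>p\<in>V. x p) \<le> c * exp (t * (\<Sum>p\<in>S. x p))"
proof -
  have finF: "finite F" using F S by (auto intro: finite_subset)
  have nn: "(\<Prod>p\<in>V. x p) \<ge> 0" if "V \<in> Pow S" for V using x that by (intro prod_nonneg) auto
  have "(\<Sum>V\<in>F. \<Prod>p\<in>V. x p) \<le> (\<Sum>V\<in>F. c * (\<Prod>p\<in>V. t * x p))"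
  proof (rule sum_mono)
    fix V assume V: "V \<in> F"
    have "1 * (\<Prod>p\<in>V. x p) \<le> (c * t ^ card V) * (\<Prod>p\<in>V. x p)"
      using F V nn by (intro mult_right_mono) auto
    then show "(\<Prod>p\<in>V. x p) \<le> c * (\<Prod>p\<in>V. t * x p)"
      by (simp add: prod.distrib mult.assoc)
  qed
  also have "\<dots> \<le> (\<Sum>V\<in>Pow S. c * (\<Prod>p\<in>V. t * x p))"
    using F S x t c by (intro sum_mono2 mult_nonneg_nonneg prod_nonneg) auto
  also have "\<dots> = c * (\<Prod>p\<in>S. 1 + t * x p)"
    using S by (simp add: sum_Pow_prod flip: sum_distrib_left)
  also have "\<dots> \<le> c * exp (\<Sum>p\<in>S. t * x p)"
    using x t c by (intro mult_left_mono prod_one_plus_le_exp) auto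
  finally show ?thesis by (simp add: sum_distrib_left)
qed

lemma sum_of_bool_filter:
  fixes f :: "'a \<Rightarrow> real"
  assumes "finite A"
  shows "(\<Sum>T\<in>A. f T * of_bool (G T)) = (\<Sum>T\<in>{T\<in>A. G T}. f T)"
proof -
  have "(\<Sum>T\<in>{T\<in>A. G T}. f T) = (\<Sum>T\<in>A. if G T then f T else 0)"
    by (rule sum.inter_filter[OF assms])
  also have "\<dots> = (\<Sum>T\<in>A. f T * of_bool (G T))" by (intro sum.cong) auto
  finally show ?thesis by (rule sym)
qed

section \<open>Brun's pure sieve\<close>

lemma card_multiples:
  assumes "d > 0"
  shows "card {n\<in>{1..N}. d dvd n} = N div d"
proof -
  have "{n\<in>{1..N}. d dvd n} = (*) d ` {1..N div d}"
  proof (intro equalityI subsetI)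
    fix n assume "n \<in> {n\<in>{1..N}. d dvd n}"
    then obtain k where k: "n = d * k" "1 \<le> n" "n \<le> N" by auto
    then have "k \<le> N div d" "1 \<le> k" using assms by (auto simp: less_eq_div_iff_mult_less_eq mult.commute Suc_le_eq)
    then show "n \<in> (*) d ` {1..N div d}" using k by auto
  next
    fix n assume "n \<in> (*) d ` {1..N div d}"
    then obtain k where "n = d * k" "k \<in> {1..N div d}" by (rule imageE)
    then have k: "n = d * k" "1 \<le> k" "k \<le> N div d" by auto
    then have "d * k \<le> N" using assms by (simp add: less_eq_div_iff_mult_less_eq mult.commute)
    then show "n \<in> {n\<in>{1..N}. d dvd n}" using k assms by (auto simp: Suc_le_eq)
  qed
  then show ?thesis using assms by (simp add: card_image inj_on_def)
qed

lemma prod_primes_dvd_iff: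
  fixes V :: "nat set"
  assumes "finite V" "\<And>p. p \<in> V \<Longrightarrow> prime p"
  shows "\<Prod>V dvd n \<longleftrightarrow> (\<forall>p\<in>V. p dvd n)"
proof
  show "\<forall>p\<in>V. p dvd n" if "\<Prod>V dvd n"
    using that assms dvd_prodI[of V _ "\<lambda>p. p"] dvd_trans by auto
  show "\<Prod>V dvd n" if "\<forall>p\<in>V. p dvd n"
    using assms that
  proof (induction V)
    case (insert p V)
    have "coprime p (\<Prod>V)"
    proof (rule prod_coprime_right)
      fix q assume "q \<in> V"
      then show "coprime p q" using insert by (intro primes_coprime) auto
    qed
    then have "p * \<Prod>V dvd n" using insert by (intro divides_mult) auto
    then show ?case using insert by simp
  qed simp
qed

definition prime_part :: "nat set \<Rightarrow> nat \<Rightarrow> nat set" where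
  "prime_part P n = {p\<in>P. p dvd n}"

text \<open>Rankin's trick with unit weights and t = 1 / M for M = card P + 1; the exponential is
  then at most e \<le> 3.\<close>

lemma card_le_subsets_bound:
  assumes "finite P"
  shows "real (card {V\<in>Pow P. card V \<le> r}) \<le> 3 * real (Suc (card P)) ^ r"
proof -
  define M where "M = real (Suc (card P))"
  have M: "M \<ge> 1" by (simp add: M_def)
  have "(\<Sum>V\<in>{V\<in>Pow P. card V \<le> r}. \<Prod>p\<in>V. (1::real)) \<le> M ^ r * exp (1 / M * (\<Sum>p\<in>P. 1))"
  proof (rule rankin[OF assms])
    fix V assume V: "V \<in> {V\<in>Pow P. card V \<le> r}"
    have "M ^ r = M ^ card V * M ^ (r - card V)" using V by (simp flip: power_add)
    then have "M ^ r * (1 / M) ^ card V = M ^ (r - card V)" using M by (simp add: power_divide)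
    then show "1 \<le> M ^ r * (1 / M) ^ card V" using M by (simp add: one_le_power)
  qed (use M in auto)
  also have "exp (1 / M * (\<Sum>p\<in>P. 1)) \<le> exp 1" by (simp add: M_def)
  also have "M ^ r * exp 1 \<le> M ^ r * 3" using M exp_le by (intro mult_left_mono) auto
  finally show ?thesis by (simp add: M_def mult.commute)
qed

text \<open>Divisibility by the primes of T is imposed exactly, and non-divisibility by the rest
  through inclusion-exclusion cut at the odd level r, which is a lower bound. Each V in the
  truncated sum introduces a rounding error of at most 1, whence the last term.\<close>

lemma sieve_single:
  fixes P :: "nat set"
  assumes P: "finite P" "\<And>p. p \<in> P \<Longrightarrow> prime p" and T: "T \<subseteq> P" and r: "odd r"
  shows "real (card {n\<in>{1..N}. prime_part P n = T}) \<ge>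
     real N * bern_weight (\<lambda>p. 1 / real p) P T - real N * ((\<Prod>p\<in>T. 1 / real p) * elem_sym (\<lambda>p. 1 / real p) (P - T) (Suc r))
       - real (card {V\<in>Pow P. card V \<le> r})"
proof -
  define F where "F = {V\<in>Pow (P - T). card V \<le> r}"
  have finF: "finite F" using P by (simp add: F_def)
  have finT: "finite T" using T P by (auto intro: finite_subset)
  have pos: "p > 0" if "p \<in> P" for p using P(2)[OF that] prime_gt_0_nat by auto
  have bonfF: "bonferroni_sum y (P - T) r = (\<Sum>V\<in>F. (- 1) ^ card V * (\<Prod>p\<in>V. y p))" for y :: "nat \<Rightarrow> real"
    unfolding bonferroni_sum_def F_def using P by (subst sum.inter_filter) auto
  have ptwise: "of_bool (prime_part P n = T) \<ge> (\<Sum>V\<in>F. (- 1) ^ card V * (of_bool (\<Prod>(T \<union> V) dvd n) :: real))" for n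
  proof -
    \<comment> \<open>The Bonferroni inequality is first applied pointwise in n, to divisibility
      indicators in place of probabilities.\<close>
    define y where "y = (\<lambda>p. of_bool (p dvd n) :: real)"
    have b: "bonferroni_sum y (P - T) r \<le> (\<Prod>p\<in>P - T. 1 - y p)"
      using bonferroni[of "P - T" y r] P r by (simp add: y_def)
    have prody: "(\<Prod>p\<in>V. y p) = of_bool (\<forall>p\<in>V. p dvd n)" if "V \<subseteq> P" for V
    proof -
      have "finite V" using that P by (auto intro: finite_subset)
      then show ?thesis by (induction V) (auto simp: y_def)
    qed
    have "(\<Sum>V\<in>F. (- 1) ^ card V * (of_bool (\<Prod>(T \<union> V) dvd n) :: real)) = (\<Prod>p\<in>T. y p) * bonferroni_sum y (P - T) r"
      unfolding bonfF sum_distrib_left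
    proof (rule sum.cong[OF refl])
      fix V assume V: "V \<in> F"
      have TV: "T \<union> V \<subseteq> P" using V T by (auto simp: F_def)
      have "(of_bool (\<Prod>(T \<union> V) dvd n) :: real) = of_bool (\<forall>p\<in>T \<union> V. p dvd n)"
        using TV P by (subst prod_primes_dvd_iff) (auto intro: finite_subset)
      also have "\<dots> = (\<Prod>p\<in>T. y p) * (\<Prod>p\<in>V. y p)"
        using V T by (subst (1 2) prody) (auto simp: F_def)
      finally show "(- 1) ^ card V * (of_bool (\<Prod>(T \<union> V) dvd n) :: real) = (\<Prod>p\<in>T. y p) * ((- 1) ^ card V * (\<Prod>p\<in>V. y p))"
        by simp
    qed
    also have "\<dots> \<le> (\<Prod>p\<in>T. y p) * (\<Prod>p\<in>P - T. 1 - y p)"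
      using b by (intro mult_left_mono prod_nonneg) (auto simp: y_def)
    also have "\<dots> = of_bool (prime_part P n = T)"
    proof (cases "prime_part P n = T")
      case True
      then show ?thesis using T by (auto simp: y_def prime_part_def intro!: prod.neutral)
    next
      case False
      then have "(\<exists>p\<in>T. \<not> p dvd n) \<or> (\<exists>p\<in>P - T. p dvd n)" using T by (auto simp: prime_part_def)
      then have "(\<Prod>p\<in>T. y p) = 0 \<or> (\<Prod>p\<in>P - T. 1 - y p) = 0"
        using finT P by (auto simp: y_def)
      then show ?thesis using False by auto
    qed
    finally show ?thesis .
  qed
  have c1: "real (card {n\<in>{1..N}. prime_part P n = T}) = (\<Sum>n\<in>{1..N}. of_bool (prime_part P n = T))"
    by (simp add: Int_def)
  have c2: "(\<Sum>n\<in>{1..N}. \<Sum>V\<in>F. (- 1) ^ card V * (of_bool (\<Prod>(T \<union> V) dvd n) :: real))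
      \<le> (\<Sum>n\<in>{1..N}. of_bool (prime_part P n = T))"
    by (intro sum_mono ptwise)
  have c3: "(\<Sum>n\<in>{1..N}. \<Sum>V\<in>F. (- 1) ^ card V * (of_bool (\<Prod>(T \<union> V) dvd n) :: real)) =
      (\<Sum>V\<in>F. (- 1) ^ card V * (\<Sum>n\<in>{1..N}. of_bool (\<Prod>(T \<union> V) dvd n) :: real))"
    unfolding sum_distrib_left by (rule sum.swap)
  have c4: "(\<Sum>V\<in>F. (- 1) ^ card V * (real N * ((\<Prod>p\<in>T. 1 / real p) * (\<Prod>p\<in>V. 1 / real p))) - 1)
     \<le> (\<Sum>V\<in>F. (- 1) ^ card V * (\<Sum>n\<in>{1..N}. of_bool (\<Prod>(T \<union> V) dvd n) :: real))"
  proof (rule sum_mono)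
    fix V assume V: "V \<in> F"
    have TV: "T \<union> V \<subseteq> P" "T \<inter> V = {}" using V T by (auto simp: F_def)
    define d where "d = \<Prod>(T \<union> V)"
    have finV: "finite V" using TV P by (auto intro: finite_subset)
    have d: "d > 0" using TV pos unfolding d_def by (intro prod_pos) auto
    have s: "(\<Sum>n\<in>{1..N}. of_bool (d dvd n) :: real) = real (N div d)"
      using card_multiples[OF d, of N] by (simp add: Int_def)
    have up: "real (N div d) \<le> real N / real d" by (rule of_nat_div_le_of_nat)
    have "real N < real (d + d * (N div d))"
      using dividend_less_times_div[OF d, of N] by (simp only: of_nat_less_iff)
    then have lo: "real N / real d - 1 \<le> real (N div d)" using d by (simp add: field_simps)
    have "(\<Prod>p\<in>T. 1 / real p) * (\<Prod>p\<in>V. 1 / real p) = 1 / real d"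
      using finT finV TV by (simp add: d_def prod.union_disjoint prod_dividef)
    then show "(- 1) ^ card V * (real N * ((\<Prod>p\<in>T. 1 / real p) * (\<Prod>p\<in>V. 1 / real p))) - 1
       \<le> (- 1) ^ card V * (\<Sum>n\<in>{1..N}. of_bool (\<Prod>(T \<union> V) dvd n) :: real)"
      unfolding d_def[symmetric] s using up lo by (cases "even (card V)") auto
  qed
  have c5: "(\<Sum>V\<in>F. (- 1) ^ card V * (real N * ((\<Prod>p\<in>T. 1 / real p) * (\<Prod>p\<in>V. 1 / real p))) - 1) =
     real N * ((\<Prod>p\<in>T. 1 / real p) * bonferroni_sum (\<lambda>p. 1 / real p) (P - T) r) - real (card F)"
    unfolding sum_subtractf bonfF sum_distrib_left by (simp add: mult_ac)
  have c6: "real (card F) \<le> real (card {V\<in>Pow P. card V \<le> r})"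
    using P unfolding F_def by (intro of_nat_mono card_mono) auto
  have b: "bonferroni_sum (\<lambda>p. 1 / real p) (P - T) r \<ge> (\<Prod>p\<in>P - T. 1 - 1 / real p) - elem_sym (\<lambda>p. 1 / real p) (P - T) (Suc r)"
  proof -
    have "finite (P - T)" using P by simp
    moreover have "0 \<le> 1 / real p \<and> 1 / real p \<le> 1" if "p \<in> P - T" for p
      using pos[of p] that by (auto simp: Suc_le_eq)
    ultimately show ?thesis using bonferroni[of "P - T" "\<lambda>p. 1 / real p" r] r by simp
  qed
  have "real N * ((\<Prod>p\<in>T. 1 / real p) * ((\<Prod>p\<in>P - T. 1 - 1 / real p) - elem_sym (\<lambda>p. 1 / real p) (P - T) (Suc r)))
     \<le> real N * ((\<Prod>p\<in>T. 1 / real p) * bonferroni_sum (\<lambda>p. 1 / real p) (P - T) r)"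
    by (intro mult_left_mono b prod_nonneg) auto
  moreover have "real N * ((\<Prod>p\<in>T. 1 / real p) * ((\<Prod>p\<in>P - T. 1 - 1 / real p) - elem_sym (\<lambda>p. 1 / real p) (P - T) (Suc r)))
     = real N * bern_weight (\<lambda>p. 1 / real p) P T - real N * ((\<Prod>p\<in>T. 1 / real p) * elem_sym (\<lambda>p. 1 / real p) (P - T) (Suc r))"
    by (simp only: bern_weight_def right_diff_distrib)
  ultimately show ?thesis using c1 c2 c3 c4 c5 c6 by linarith
qed

text \<open>\<open>sieve_single\<close> summed over the T with at most r elements. One exp(3
  \<Lambda>) / 2^r pays for the truncation, as exp \<Lambda> from the sum over T times exp(2
  \<Lambda>) from the elementary symmetric sum; the other pays for the T with more than r elements.
  The rounding errors are counted by pairs (T, V). The restriction to at most r prime factors stays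
  on the left because it limits how far logarithms of divisors can drift.\<close>

lemma sieve_monotone:
  fixes P :: "nat set"
  assumes P: "finite P" "\<And>p. p \<in> P \<Longrightarrow> prime p" and r: "odd r"
  defines "\<Lambda> \<equiv> (\<Sum>p\<in>P. 1 / real p)"
  shows "real (card {n\<in>{1..N}. G (prime_part P n) \<and> card (prime_part P n) \<le> r}) \<ge>
     real N * ((\<Sum>T\<in>Pow P. bern_weight (\<lambda>p. 1 / real p) P T * of_bool (G T)) - 2 * exp (3 * \<Lambda>) / 2 ^ r)
       - 9 * real (Suc (card P)) ^ (2 * r)"
proof -
  define x where "x = (\<lambda>p::nat. 1 / real p)"
  define H where "H = {T\<in>Pow P. G T \<and> card T \<le> r}"
  define m where "m = real (card {V\<in>Pow P. card V \<le> r})"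
  have x: "0 \<le> x p" "x p \<le> 1" if "p \<in> P" for p
    using P(2)[OF that] prime_gt_0_nat[of p] by (auto simp: x_def Suc_le_eq)
  have L0: "\<Lambda> \<ge> 0" unfolding \<Lambda>_def by (intro sum_nonneg) auto
  have finH: "finite H" and Hsub: "H \<subseteq> {V\<in>Pow P. card V \<le> r}" using P by (auto simp: H_def)
  have m: "m \<le> 3 * real (Suc (card P)) ^ r" unfolding m_def by (rule card_le_subsets_bound[OF P(1)])
  have Hm: "real (card H) \<le> m" unfolding m_def using Hsub P by (intro of_nat_mono card_mono) auto
  have es: "elem_sym x (P - T) (Suc r) \<le> exp (2 * \<Lambda>) / 2 ^ Suc r" for T
  proof -
    have "elem_sym x (P - T) (Suc r) = (\<Sum>V\<in>{V\<in>Pow (P - T). card V = Suc r}. \<Prod>p\<in>V. x p)"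
      unfolding elem_sym_def using P by (subst sum.inter_filter) auto
    also have "\<dots> \<le> 1 / 2 ^ Suc r * exp (2 * (\<Sum>p\<in>P. x p))"
      using P x by (intro rankin) auto
    finally show ?thesis by (simp add: x_def \<Lambda>_def)
  qed
  have eq: "{n\<in>{1..N}. G (prime_part P n) \<and> card (prime_part P n) \<le> r} = (\<Union>T\<in>H. {n\<in>{1..N}. prime_part P n = T})"
    by (auto simp: H_def prime_part_def)
  have "real (card {n\<in>{1..N}. G (prime_part P n) \<and> card (prime_part P n) \<le> r}) =
      (\<Sum>T\<in>H. real (card {n\<in>{1..N}. prime_part P n = T}))"
    unfolding eq using finH by (subst card_UN_disjoint) auto
  moreover have "(\<Sum>T\<in>H. real N * bern_weight x P T - real N * ((\<Prod>p\<in>T. x p) * (exp (2 * \<Lambda>) / 2 ^ Suc r)) - m)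
      \<le> (\<Sum>T\<in>H. real (card {n\<in>{1..N}. prime_part P n = T}))"
  proof (rule sum_mono)
    fix T assume "T \<in> H"
    then have T: "T \<subseteq> P" by (auto simp: H_def)
    have "real N * ((\<Prod>p\<in>T. x p) * elem_sym x (P - T) (Suc r)) \<le> real N * ((\<Prod>p\<in>T. x p) * (exp (2 * \<Lambda>) / 2 ^ Suc r))"
      by (intro mult_left_mono es prod_nonneg) (auto simp: x_def)
    with sieve_single[OF P T r, of N]
    show "real N * bern_weight x P T - real N * ((\<Prod>p\<in>T. x p) * (exp (2 * \<Lambda>) / 2 ^ Suc r)) - m
       \<le> real (card {n\<in>{1..N}. prime_part P n = T})"
      unfolding x_def m_def by linarith
  qed
  moreover have "(\<Sum>T\<in>H. real N * bern_weight x P T - real N * ((\<Prod>p\<in>T. x p) * (exp (2 * \<Lambda>) / 2 ^ Suc r)) - m)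
     = real N * (\<Sum>T\<in>H. bern_weight x P T) - real N * ((\<Sum>T\<in>H. \<Prod>p\<in>T. x p) * (exp (2 * \<Lambda>) / 2 ^ Suc r)) - real (card H) * m"
    by (simp only: sum_subtractf sum_distrib_left[symmetric] sum_distrib_right[symmetric] sum_constant)
  moreover have "real N * ((\<Sum>T\<in>H. \<Prod>p\<in>T. x p) * (exp (2 * \<Lambda>) / 2 ^ Suc r)) \<le> real N * (exp (3 * \<Lambda>) / 2 ^ r)"
  proof (intro mult_left_mono)
    have "(\<Sum>T\<in>H. \<Prod>p\<in>T. x p) \<le> 1 * exp (1 * (\<Sum>p\<in>P. x p))"
      using P x by (intro rankin) (auto simp: H_def)
    then have "(\<Sum>T\<in>H. \<Prod>p\<in>T. x p) * (exp (2 * \<Lambda>) / 2 ^ Suc r) \<le> exp \<Lambda> * (exp (2 * \<Lambda>) / 2 ^ r)"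
      by (intro mult_mono divide_left_mono) (auto simp: x_def \<Lambda>_def intro!: sum_nonneg prod_nonneg)
    also have "\<dots> = exp (3 * \<Lambda>) / 2 ^ r" by (simp flip: exp_add)
    finally show "(\<Sum>T\<in>H. \<Prod>p\<in>T. x p) * (exp (2 * \<Lambda>) / 2 ^ Suc r) \<le> exp (3 * \<Lambda>) / 2 ^ r" .
  qed auto
  moreover have "real (card H) * m \<le> 9 * real (Suc (card P)) ^ (2 * r)"
  proof -
    have "real (card H) * m \<le> (3 * real (Suc (card P)) ^ r) * (3 * real (Suc (card P)) ^ r)"
      using Hm m by (intro mult_mono) (auto simp: m_def)
    also have "\<dots> = 9 * real (Suc (card P)) ^ (2 * r)"
      by (simp only: mult_2 power_add)
    finally show ?thesis .
  qed
  moreover have "real N * ((\<Sum>T\<in>Pow P. bern_weight x P T * of_bool (G T)) - exp (3 * \<Lambda>) / 2 ^ r) \<le> real N * (\<Sum>T\<in>H. bern_weight x P T)"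
  proof (intro mult_left_mono)
    define H' where "H' = {T\<in>Pow P. card T > r}"
    have finP: "finite (Pow P)" using P by simp
    have nn: "bern_weight x P T \<ge> 0" if "T \<in> Pow P" for T
      using that x by (intro bern_weight_nonneg) auto
    have "(\<Sum>T\<in>Pow P. bern_weight x P T * of_bool (G T)) = (\<Sum>T\<in>{T\<in>Pow P. G T}. bern_weight x P T)"
      by (rule sum_of_bool_filter[OF finP])
    also have "\<dots> \<le> (\<Sum>T\<in>H \<union> H'. bern_weight x P T)"
      using finP nn by (intro sum_mono2) (auto simp: H_def H'_def)
    also have "\<dots> = (\<Sum>T\<in>H. bern_weight x P T) + (\<Sum>T\<in>H'. bern_weight x P T)"
      using finP by (intro sum.union_disjoint) (auto simp: H_def H'_def)
    also have "(\<Sum>T\<in>H'. bern_weight x P T) \<le> (\<Sum>T\<in>H'. \<Prod>p\<in>T. x p)"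
    proof (rule sum_mono)
      fix T assume "T \<in> H'"
      then have T: "T \<subseteq> P" by (auto simp: H'_def)
      have "(\<Prod>p\<in>P - T. 1 - x p) \<le> 1" using x by (intro prod_le_1) auto
      moreover have "(\<Prod>p\<in>T. x p) \<ge> 0" using T x by (intro prod_nonneg) auto
      ultimately show "bern_weight x P T \<le> (\<Prod>p\<in>T. x p)" unfolding bern_weight_def by (intro mult_left_le)
    qed
    also have "(\<Sum>T\<in>H'. \<Prod>p\<in>T. x p) \<le> 1 / 2 ^ r * exp (2 * (\<Sum>p\<in>P. x p))"
    proof (rule rankin[OF P(1)])
      fix V assume "V \<in> H'"
      then have "(2::real) ^ r \<le> 2 ^ card V" by (intro power_increasing) (auto simp: H'_def)
      then show "1 \<le> 1 / 2 ^ r * (2::real) ^ card V" by simp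
    qed (use x in \<open>auto simp: H'_def\<close>)
    also have "1 / 2 ^ r * exp (2 * (\<Sum>p\<in>P. x p)) \<le> exp (3 * \<Lambda>) / 2 ^ r"
      using L0 by (simp add: x_def \<Lambda>_def divide_right_mono)
    finally show "(\<Sum>T\<in>Pow P. bern_weight x P T * of_bool (G T)) - exp (3 * \<Lambda>) / 2 ^ r \<le> (\<Sum>T\<in>H. bern_weight x P T)"
      by simp
  qed auto
  moreover have "real N * ((\<Sum>T\<in>Pow P. bern_weight x P T * of_bool (G T)) - 2 * exp (3 * \<Lambda>) / 2 ^ r) =
      real N * ((\<Sum>T\<in>Pow P. bern_weight x P T * of_bool (G T)) - exp (3 * \<Lambda>) / 2 ^ r) - real N * (exp (3 * \<Lambda>) / 2 ^ r)"
    by (simp add: right_diff_distrib)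
  ultimately show ?thesis unfolding x_def[symmetric] by linarith
qed

section \<open>Divisors from equal subset sums\<close>

lemma log_random_space_cylinder:
  assumes I: "finite I" "I \<subseteq> {1..}" and T: "T \<subseteq> I"
  shows "measure log_random_space {\<omega> \<in> space log_random_space. \<forall>i\<in>I. i \<in> log_random_set \<omega> \<longleftrightarrow> i \<in> T}
    = bern_weight (\<lambda>i. 1 / real i) I T"
proof -
  interpret P: product_prob_space "\<lambda>i. measure_pmf (bernoulli_pmf (1 / real i))" "{1..}"
    by unfold_locales
  define X where "X = (\<lambda>i. {i \<in> T})"
  have "{\<omega> \<in> space log_random_space. \<forall>i\<in>I. i \<in> log_random_set \<omega> \<longleftrightarrow> i \<in> T} =
     prod_emb {1..} (\<lambda>i. measure_pmf (bernoulli_pmf (1 / real i))) I (\<Pi>\<^sub>E i\<in>I. X i)"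
  proof -
    have "prod_emb {1..} (\<lambda>i. measure_pmf (bernoulli_pmf (1 / real i))) I (\<Pi>\<^sub>E i\<in>I. X i) =
        (\<Pi>\<^sub>E i\<in>{1..}. if i \<in> I then X i else UNIV)"
      using I by (subst prod_emb_PiE) (auto intro!: PiE_cong)
    also have "\<dots> = {\<omega> \<in> space log_random_space. \<forall>i\<in>I. i \<in> log_random_set \<omega> \<longleftrightarrow> i \<in> T}"
      unfolding log_random_space_def log_random_set_def space_PiM set_eq_iff mem_Collect_eq PiE_iff X_def
      using I by (fastforce split: if_splits)
    finally show ?thesis ..
  qed
  then have "measure log_random_space {\<omega> \<in> space log_random_space. \<forall>i\<in>I. i \<in> log_random_set \<omega> \<longleftrightarrow> i \<in> T} =
     measure (PiM {1..} (\<lambda>i. measure_pmf (bernoulli_pmf (1 / real i))))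
       (prod_emb {1..} (\<lambda>i. measure_pmf (bernoulli_pmf (1 / real i))) I (\<Pi>\<^sub>E i\<in>I. X i))"
    by (simp only: log_random_space_def)
  also have "\<dots> = (\<Prod>i\<in>I. measure (measure_pmf (bernoulli_pmf (1 / real i))) (X i))"
    using I by (intro P.measure_PiM_emb) auto
  also have "(\<Prod>i\<in>I. measure (measure_pmf (bernoulli_pmf (1 / real i))) (X i)) = (\<Prod>i\<in>I. if i \<in> T then 1 / real i else 1 - 1 / real i)"
    using I by (intro prod.cong refl) (auto simp: X_def measure_pmf_single Suc_le_eq)
  also have "\<dots> = bern_weight (\<lambda>i. 1 / real i) I T"
  proof -
    have "(\<Prod>i\<in>I. if i \<in> T then 1 / real i else 1 - 1 / real i) =
      (\<Prod>i\<in>T. if i \<in> T then 1 / real i else 1 - 1 / real i) * (\<Prod>i\<in>I - T. if i \<in> T then 1 / real i else 1 - 1 / real i)"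
      using I T by (metis (no_types, lifting) prod.subset_diff mult.commute)
    also have "(\<Prod>i\<in>T. if i \<in> T then 1 / real i else 1 - 1 / real i) = (\<Prod>i\<in>T. 1 / real i)"
      by (intro prod.cong) auto
    also have "(\<Prod>i\<in>I - T. if i \<in> T then 1 / real i else 1 - 1 / real i) = (\<Prod>i\<in>I - T. 1 - 1 / real i)"
      by (intro prod.cong) auto
    finally show ?thesis by (simp only: bern_weight_def)
  qed
  finally show ?thesis .
qed

definition log_window :: "real \<Rightarrow> real \<Rightarrow> nat set" where
  "log_window c D = {a::nat. 1 \<le> a \<and> D powr c \<le> real a \<and> real a \<le> D}"

lemma finite_log_window: "finite (log_window c D)"
  by (rule finite_subset[of _ "{..nat \<lfloor>D\<rfloor>}"]) (auto simp: log_window_def le_nat_floor)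

text \<open>Only the coordinates in the window matter, so the event on the infinite product becomes
  a finite sum of \<open>bern_weight\<close>, the form in which the sieve describes
  divisibility.\<close>

lemma measure_equal_sums_event:
  "measure log_random_space (equal_sums_event k c D) =
     (\<Sum>T\<in>Pow (log_window c D). bern_weight (\<lambda>i. 1 / real i) (log_window c D) T * of_bool (has_equal_subset_sums k T))"
proof -
  interpret Q: prob_space log_random_space by (rule prob_space_log_random_space)
  define I where "I = log_window c D"
  have I: "finite I" "I \<subseteq> {1..}" by (auto simp: I_def finite_log_window) (auto simp: log_window_def)
  define Cy where "Cy = (\<lambda>T. {\<omega> \<in> space log_random_space. \<forall>i\<in>I. i \<in> log_random_set \<omega> \<longleftrightarrow> i \<in> T})"
  define H where "H = {T \<in> Pow I. has_equal_subset_sums k T}"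
  have restrict: "{a \<in> log_random_set \<omega>. D powr c \<le> real a \<and> real a \<le> D} = log_random_set \<omega> \<inter> I" for \<omega>
    by (auto simp: I_def log_window_def log_random_set_def)
  have eq: "equal_sums_event k c D = (\<Union>T\<in>H. Cy T)"
  proof (intro equalityI subsetI)
    fix \<omega> assume "\<omega> \<in> equal_sums_event k c D"
    then show "\<omega> \<in> (\<Union>T\<in>H. Cy T)"
      unfolding equal_sums_event_def restrict
      by (intro UN_I[of "log_random_set \<omega> \<inter> I"]) (auto simp: H_def Cy_def)
  next
    fix \<omega> assume "\<omega> \<in> (\<Union>T\<in>H. Cy T)"
    then obtain T where T: "T \<subseteq> I" "has_equal_subset_sums k T" "\<omega> \<in> space log_random_space"
      "\<forall>i\<in>I. i \<in> log_random_set \<omega> \<longleftrightarrow> i \<in> T" by (auto simp: H_def Cy_def)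
    then have "log_random_set \<omega> \<inter> I = T" by blast
    with T show "\<omega> \<in> equal_sums_event k c D" unfolding equal_sums_event_def restrict by simp
  qed
  have meas: "Cy T \<in> sets log_random_space" for T
    unfolding Cy_def
  proof (rule sets.sets_Collect_finite_All[OF _ I(1)])
    fix i assume "i \<in> I"
    then have *: "{\<omega> \<in> space log_random_space. i \<in> log_random_set \<omega>} \<in> sets log_random_space"
      using I by (intro mem_log_random_set_measurable) auto
    show "{\<omega> \<in> space log_random_space. i \<in> log_random_set \<omega> \<longleftrightarrow> i \<in> T} \<in> sets log_random_space"
      using * sets.sets_Collect_neg[OF *] by (cases "i \<in> T") auto
  qed
  have "measure log_random_space (\<Union>T\<in>H. Cy T) = (\<Sum>T\<in>H. measure log_random_space (Cy T))"
  proof (rule Q.finite_measure_finite_Union)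
    show "disjoint_family_on Cy H"
      unfolding disjoint_family_on_def
    proof (intro ballI impI)
      fix T T' assume "T \<in> H" "T' \<in> H" "T \<noteq> T'"
      then obtain i where "i \<in> I" "(i \<in> T) \<noteq> (i \<in> T')" by (auto simp: H_def)
      then show "Cy T \<inter> Cy T' = {}" by (auto simp: Cy_def)
    qed
  qed (use I meas in \<open>auto simp: H_def\<close>)
  also have "\<dots> = (\<Sum>T\<in>H. bern_weight (\<lambda>i. 1 / real i) I T)"
    unfolding Cy_def using I by (intro sum.cong refl log_random_space_cylinder) (auto simp: H_def)
  also have "\<dots> = (\<Sum>T\<in>Pow I. bern_weight (\<lambda>i. 1 / real i) I T * of_bool (has_equal_subset_sums k T))"
    unfolding H_def using I by (intro sum_of_bool_filter[symmetric]) auto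
  finally show ?thesis unfolding eq by (simp add: I_def)
qed

lemma sum_inverse_le_ln:
  assumes "finite J" "J \<subseteq> {1..n}" "n \<ge> 1"
  shows "(\<Sum>i\<in>J. 1 / real i) \<le> 1 + ln (real n)"
proof -
  have "(\<Sum>i\<in>J. 1 / real i) \<le> (\<Sum>i\<in>{1..n}. 1 / real i)"
    using assms by (intro sum_mono2) auto
  also have "\<dots> \<le> 1 + ln (real n)"
    using \<open>n \<ge> 1\<close>
  proof (induction n rule: dec_induct)
    case (step n)
    have "ln (real (Suc n)) - ln (real n) = - ln (real n / real (Suc n))"
      using step by (subst ln_div) auto
    moreover have "ln (real n / real (Suc n)) \<le> real n / real (Suc n) - 1"
      using step by (intro ln_le_minus_one) auto
    moreover have "real n / real (Suc n) - 1 = - (1 / real (Suc n))" by (simp add: field_simps)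
    ultimately have "1 / real (Suc n) \<le> ln (real (Suc n)) - ln (real n)" by linarith
    then show ?case using step by simp
  qed simp
  finally show ?thesis .
qed

lemma almost_everyI:
  assumes "\<And>\<epsilon>. \<epsilon> > 0 \<Longrightarrow> eventually (\<lambda>N::nat. real (card {n\<in>{1..N}. P n}) \<ge> (1 - \<epsilon>) * real N) sequentially"
  shows "almost_every P"
  unfolding almost_every_def
proof (rule landau_o.smallI)
  fix c :: real assume c: "c > 0"
  from assms[OF c] obtain N0 where N0: "\<And>N. N \<ge> N0 \<Longrightarrow> real (card {n\<in>{1..N}. P n}) \<ge> (1 - c) * real N"
    by (auto simp: eventually_sequentially)
  show "eventually (\<lambda>X. norm (real (card {n. 0 < n \<and> real n \<le> X \<and> \<not> P n})) \<le> c * norm X) at_top"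
    using eventually_ge_at_top[of "real N0"] eventually_ge_at_top[of 0]
  proof eventually_elim
    case (elim X)
    define N where "N = nat \<lfloor>X\<rfloor>"
    have N: "N \<ge> N0" using elim by (simp add: N_def le_nat_floor)
    have NX: "real N \<le> X" using elim by (simp add: N_def)
    have "{n. 0 < n \<and> real n \<le> X \<and> \<not> P n} = {1..N} - {n\<in>{1..N}. P n}"
    proof -
      have iff: "real n \<le> X \<longleftrightarrow> n \<le> N" for n
      proof
        show "n \<le> N" if "real n \<le> X" unfolding N_def using that by (rule le_nat_floor)
        show "real n \<le> X" if "n \<le> N" using that NX by linarith
      qed
      show ?thesis unfolding iff by auto
    qed
    moreover have "card ({1..N} - {n\<in>{1..N}. P n}) = card {1..N} - card {n\<in>{1..N}. P n}"
      by (rule card_Diff_subset) (auto intro: finite_subset[of _ "{1..N}"])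
    moreover have "card {n\<in>{1..N}. P n} \<le> N"
    proof -
      have "card {n\<in>{1..N}. P n} \<le> card {1..N}" by (rule card_mono) auto
      then show ?thesis by simp
    qed
    ultimately have "real (card {n. 0 < n \<and> real n \<le> X \<and> \<not> P n}) = real N - real (card {n\<in>{1..N}. P n})"
      by (simp only: card_atLeastAtMost of_nat_diff)
    also have "\<dots> \<le> c * real N" using N0[OF N] by (simp add: algebra_simps)
    also have "\<dots> \<le> c * X" using NX c by (intro mult_left_mono) auto
    finally show ?case using elim by simp
  qed
qed

text \<open>Closeness is asked of all pairs in both orders, so the sorted enumeration of F can
  simply be cut after k entries.\<close>

lemma has_close_divisorsI:
  assumes F: "finite F" "card F \<ge> k" and dvd: "\<And>u. u \<in> F \<Longrightarrow> u dvd n" and k: "k \<ge> 1"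
    and close: "\<And>u v. u \<in> F \<Longrightarrow> v \<in> F \<Longrightarrow> real u \<le> real v * (1 + ln (real n) powr (- \<alpha>))"
  shows "has_close_divisors k \<alpha> n"
proof -
  define xs where "xs = sorted_list_of_set F"
  have xs: "length xs = card F" "set xs = F" "sorted_wrt (<) xs"
    using F by (auto simp: xs_def)
  \<comment> \<open>The list is indexed from 0, the divisors from 1.\<close>
  define d where "d = (\<lambda>i. xs ! (i - 1))"
  have dF: "d i \<in> F" if "i \<in> {1..k}" for i
    using that xs F by (auto simp: d_def intro!: nth_mem[of "i - 1" xs, simplified xs])
  have "strict_mono_on {1..k} d"
  proof (rule strict_mono_onI)
    fix i j assume "i \<in> {1..k}" "j \<in> {1..k}" "i < j"
    then show "d i < d j" unfolding d_def using xs F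
      by (intro sorted_wrt_nth_less[OF xs(3)]) auto
  qed
  then show ?thesis
    unfolding has_close_divisors_def using dF dvd close k
    by (intro exI[of _ d]) auto
qed

section \<open>Negative exponents\<close>

lemma primes_log_sum_unbounded:
  obtains P where "finite P" "\<And>p. p \<in> P \<Longrightarrow> prime p" "(\<Sum>p\<in>P. 1 / real p) \<ge> (B::real)"
proof -
  from primes_log_interval[of 0] obtain C a0 where C: "C > 0" "a0 \<ge> 1"
    "\<And>a \<delta>. a \<ge> a0 \<Longrightarrow> a powr (- 0) \<le> \<delta> \<Longrightarrow> \<delta> \<le> 1 \<Longrightarrow>
      (\<Sum>p\<in>{p. prime p \<and> \<bar>ln (real p) - a\<bar> < \<delta> / 2}. ln (real p) / real p) \<ge> \<delta> * (1 - C / a)"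
    by auto
  \<comment> \<open>Blocks of length 1 around the integers m, each contributing at least 1 / (4m) by
    the interval bound with \<delta> = 1; divergence of the harmonic series does the rest.\<close>
  define b where "b = (\<lambda>m::nat. {p. prime p \<and> \<bar>ln (real p) - real m\<bar> < 1 / 2})"
  define x0 where "x0 = ln (max a0 (2 * C))"
  define y0 where "y0 = x0 + 4 * max 0 B + exp (- x0)"
  define J where "J = {n::nat. n \<ge> 1 \<and> x0 \<le> ln (real n) \<and> ln (real n) \<le> y0}"
  have "J \<subseteq> {..nat \<lceil>exp y0\<rceil>}"
  proof
    fix n assume "n \<in> J"
    then have "real n \<le> exp y0" by (auto simp: J_def ln_le_iff_le_exp)
    also have "\<dots> \<le> real (nat \<lceil>exp y0\<rceil>)" by (rule real_nat_ceiling_ge)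
    finally show "n \<in> {..nat \<lceil>exp y0\<rceil>}" by simp
  qed
  then have finJ: "finite J" by (rule finite_subset) simp
  have finb: "finite (b m)" for m
    using finite_log_interval[of "real m" "1/2"] by (rule rev_finite_subset) (auto simp: b_def intro: prime_ge_1_nat[unfolded One_nat_def])
  have each: "(\<Sum>p\<in>b m. 1 / real p) \<ge> 1 / 4 * (1 / real m)" if m: "m \<in> J" for m
  proof -
    have m1: "m \<ge> 1" using m by (simp add: J_def)
    have "exp x0 \<le> real m" using m by (auto simp: J_def ln_ge_iff)
    then have ma: "real m \<ge> a0" "real m \<ge> 2 * C" using C by (auto simp: x0_def)
    have "1 - C / real m \<le> (\<Sum>p\<in>b m. ln (real p) / real p)"
      using C(3)[of "real m" 1] ma m1 by (simp add: b_def)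
    also have "\<dots> \<le> (\<Sum>p\<in>b m. (2 * real m) * (1 / real p))"
    proof (rule sum_mono)
      fix p assume "p \<in> b m"
      then have "\<bar>ln (real p) - real m\<bar> < 1 / 2" "prime p" by (auto simp: b_def)
      moreover have "real m \<ge> 1" using m1 by simp
      ultimately have "ln (real p) \<le> 2 * real m" "real p > 0" using prime_gt_0_nat[of p] by linarith+
      then show "ln (real p) / real p \<le> 2 * real m * (1 / real p)" by (simp add: divide_right_mono)
    qed
    also have "\<dots> = 2 * real m * (\<Sum>p\<in>b m. 1 / real p)" by (simp add: sum_distrib_left)
    finally have "1 - C / real m \<le> 2 * real m * (\<Sum>p\<in>b m. 1 / real p)" .
    moreover have "1 - C / real m \<ge> 1 / 2" using ma m1 C by (simp add: field_simps)
    ultimately have "1 / 2 \<le> 2 * real m * (\<Sum>p\<in>b m. 1 / real p)" by linarith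
    then show ?thesis using m1 by (simp add: field_simps)
  qed
  show thesis
  proof (rule that[of "\<Union>m\<in>J. b m"])
    show "finite (\<Union>m\<in>J. b m)" using finJ finb by auto
    show "prime p" if "p \<in> (\<Union>m\<in>J. b m)" for p using that by (auto simp: b_def)
    have "4 * max 0 B = y0 - x0 - exp (- x0)" by (simp add: y0_def)
    also have "\<dots> \<le> (\<Sum>m\<in>J. 1 / real m)"
      unfolding J_def by (intro harmonic_log_interval) (simp add: y0_def)
    finally have "B \<le> 1 / 4 * (\<Sum>m\<in>J. 1 / real m)" by linarith
    then have "B \<le> (\<Sum>m\<in>J. 1 / 4 * (1 / real m))" by (simp only: sum_distrib_left)
    also have "\<dots> \<le> (\<Sum>m\<in>J. \<Sum>p\<in>b m. 1 / real p)" by (intro sum_mono each)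
    also have "\<dots> = (\<Sum>p\<in>(\<Union>m\<in>J. b m). 1 / real p)"
    proof (rule sum.UNION_disjoint[symmetric, OF finJ])
      show "\<forall>m\<in>J. \<forall>m'\<in>J. m \<noteq> m' \<longrightarrow> b m \<inter> b m' = {}"
      proof (intro ballI impI)
        fix m m' :: nat assume "m \<noteq> m'"
        then have "\<bar>real m - real m'\<bar> \<ge> 1" by linarith
        moreover have "\<bar>real m - real m'\<bar> < 1" if "p \<in> b m" "p \<in> b m'" for p
        proof -
          have "\<bar>ln (real p) - real m\<bar> < 1 / 2" "\<bar>ln (real p) - real m'\<bar> < 1 / 2" using that by (auto simp: b_def)
          then show ?thesis by linarith
        qed
        ultimately show "b m \<inter> b m' = {}" by force
      qed
    qed (use finb in auto)
    finally show "(\<Sum>p\<in>(\<Union>m\<in>J. b m). 1 / real p) \<ge> B" .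
  qed
qed

text \<open>An exponential moment: the indicator of card T < k is at most 2^k / 2^(card T), after
  which the expectation factors into terms 1 - x p / 2.\<close>

lemma few_primes_weight:
  assumes P: "finite P" "\<And>p. p \<in> P \<Longrightarrow> 0 \<le> x p \<and> x p \<le> (1::real)"
  shows "(\<Sum>T\<in>Pow P. bern_weight x P T * of_bool (card T < k)) \<le> 2 ^ k * exp (- (\<Sum>p\<in>P. x p) / 2)"
proof -
  have "(\<Sum>T\<in>Pow P. bern_weight x P T * of_bool (card T < k)) \<le>
      (\<Sum>T\<in>Pow P. 2 ^ k * ((\<Prod>p\<in>T. x p / 2) * (\<Prod>p\<in>P - T. 1 - x p)))"
  proof (rule sum_mono)
    fix T assume "T \<in> Pow P"
    then have nn: "bern_weight x P T \<ge> 0" using P by (intro bern_weight_nonneg) auto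
    have eq: "2 ^ k * ((\<Prod>p\<in>T. x p / 2) * (\<Prod>p\<in>P - T. 1 - x p)) = bern_weight x P T * (2 ^ k / 2 ^ card T)"
      by (simp add: bern_weight_def prod_dividef)
    have "of_bool (card T < k) \<le> (2::real) ^ k / 2 ^ card T"
      by (auto simp: power_increasing less_imp_le)
    then show "bern_weight x P T * of_bool (card T < k) \<le> 2 ^ k * ((\<Prod>p\<in>T. x p / 2) * (\<Prod>p\<in>P - T. 1 - x p))"
      unfolding eq using nn by (intro mult_left_mono)
  qed
  also have "\<dots> = 2 ^ k * (\<Prod>p\<in>P. x p / 2 + (1 - x p))"
    unfolding prod_add[OF P(1)] by (simp add: sum_distrib_left)
  also have "(\<Prod>p\<in>P. x p / 2 + (1 - x p)) \<le> (\<Prod>p\<in>P. exp (- (x p / 2)))"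
  proof (rule prod_mono)
    fix p assume "p \<in> P"
    then show "0 \<le> x p / 2 + (1 - x p) \<and> x p / 2 + (1 - x p) \<le> exp (- (x p / 2))"
      using P(2)[of p] exp_ge_add_one_self[of "- (x p / 2)"] by simp
  qed
  also have "(\<Prod>p\<in>P. exp (- (x p / 2))) = exp (- (\<Sum>p\<in>P. x p) / 2)"
    using P by (simp add: exp_sum[symmetric] sum_negf sum_divide_distrib[symmetric])
  finally show ?thesis by simp
qed

text \<open>For \<alpha> < 0 the tolerance 1 + (ln n)^(-\<alpha>) tends to infinity, so any k primes
  from a fixed finite set are eventually close. A set with a large sum of reciprocals supplies k
  prime divisors for all n outside a small proportion. This yields \<open>alpha k\<close> \<ge>
  0.\<close>

lemma almost_every_close_divisors_neg:
  assumes k: "k \<ge> 1" and \<alpha>: "\<alpha> < 0"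
  shows "almost_every (has_close_divisors k \<alpha>)"
proof (rule almost_everyI)
  fix \<epsilon> :: real assume \<epsilon>: "\<epsilon> > 0"
  \<comment> \<open>Makes 2^k exp (-B / 2) equal to \<epsilon> / 4.\<close>
  define B where "B = 2 * ln (2 ^ k * 4 / \<epsilon>)"
  from primes_log_sum_unbounded obtain P where P: "finite P" "\<And>p. p \<in> P \<Longrightarrow> prime p" "(\<Sum>p\<in>P. 1 / real p) \<ge> B"
    by blast
  define \<Lambda> where "\<Lambda> = (\<Sum>p\<in>P. 1 / real p)"
  have x: "0 \<le> 1 / real p \<and> 1 / real p \<le> 1" if "p \<in> P" for p
    using P(2)[OF that] prime_ge_1_nat[of p] by auto
  have few: "(\<Sum>T\<in>Pow P. bern_weight (\<lambda>p. 1 / real p) P T * of_bool (card T < k)) \<le> \<epsilon> / 4"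
  proof -
    have "(\<Sum>T\<in>Pow P. bern_weight (\<lambda>p. 1 / real p) P T * of_bool (card T < k)) \<le> 2 ^ k * exp (- \<Lambda> / 2)"
      unfolding \<Lambda>_def by (rule few_primes_weight[OF P(1) x])
    also have "\<dots> \<le> 2 ^ k * exp (- B / 2)" using P(3) by (intro mult_left_mono) (auto simp: \<Lambda>_def)
    also have "exp (- B / 2) = inverse (2 ^ k * 4 / \<epsilon>)" using \<epsilon> by (simp add: B_def exp_minus)
    also have "2 ^ k * inverse (2 ^ k * 4 / \<epsilon>) = \<epsilon> / 4" using \<epsilon> by simp
    finally show ?thesis .
  qed
  have many: "(\<Sum>T\<in>Pow P. bern_weight (\<lambda>p. 1 / real p) P T * of_bool (card T \<ge> k)) \<ge> 1 - \<epsilon> / 4"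
  proof -
    have "(\<Sum>T\<in>Pow P. bern_weight (\<lambda>p. 1 / real p) P T * of_bool (card T \<ge> k)) +
       (\<Sum>T\<in>Pow P. bern_weight (\<lambda>p. 1 / real p) P T * of_bool (card T < k)) = (\<Sum>T\<in>Pow P. bern_weight (\<lambda>p. 1 / real p) P T)"
      unfolding sum.distrib[symmetric] by (intro sum.cong) auto
    then show ?thesis using few sum_bern_weight[OF P(1), of "\<lambda>p. 1 / real p"] by linarith
  qed
  have "((\<lambda>r::nat. 2 * exp (3 * \<Lambda>) / 2 ^ r) \<longlongrightarrow> 0) sequentially" by real_asymp
  then have "eventually (\<lambda>r::nat. 2 * exp (3 * \<Lambda>) / 2 ^ r < \<epsilon> / 4) sequentially"
    using \<epsilon> by (intro order_tendstoD) auto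
  then obtain r0 where r0: "\<And>r. r \<ge> r0 \<Longrightarrow> 2 * exp (3 * \<Lambda>) / 2 ^ r < \<epsilon> / 4"
    by (auto simp: eventually_sequentially)
  define r where "r = 2 * r0 + 1"
  have r: "odd r" "2 * exp (3 * \<Lambda>) / 2 ^ r < \<epsilon> / 4" using r0[of r] by (auto simp: r_def)
  \<comment> \<open>A crude bound for every prime in P, and hence for the ratio of any two of
    them.\<close>
  define y where "y = real (\<Sum>P)"
  define A where "A = 9 * real (Suc (card P)) ^ (2 * r)"
  have "filterlim (\<lambda>N::nat. 1 + ln (real N) powr (- \<alpha>)) at_top sequentially"
  proof -
    define \<beta> where "\<beta> = - \<alpha>"
    have "\<beta> > 0" using \<alpha> by (simp add: \<beta>_def)
    then have "filterlim (\<lambda>N::nat. 1 + ln (real N) powr \<beta>) at_top sequentially" by real_asymp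
    then show ?thesis by (simp add: \<beta>_def)
  qed
  then have "eventually (\<lambda>N::nat. 1 + ln (real N) powr (- \<alpha>) \<ge> y) sequentially"
    by (simp add: filterlim_at_top)
  then obtain n0 where n0: "\<And>n. n \<ge> n0 \<Longrightarrow> 1 + ln (real n) powr (- \<alpha>) \<ge> y"
    by (auto simp: eventually_sequentially)
  have main: "real (card {n\<in>{1..N}. has_close_divisors k \<alpha> n}) \<ge> real N * (1 - \<epsilon> / 2) - A - real n0" for N
  proof -
    have close: "has_close_divisors k \<alpha> n" if n: "n \<ge> n0" "card (prime_part P n) \<ge> k" for n
    proof (rule has_close_divisorsI[OF _ n(2) _ k])
      show "finite (prime_part P n)" using P by (simp add: prime_part_def)
      show "u dvd n" if "u \<in> prime_part P n" for u using that by (simp add: prime_part_def)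
      fix u v assume uv: "u \<in> prime_part P n" "v \<in> prime_part P n"
      have "u \<le> \<Sum>P" using uv P by (intro member_le_sum) (auto simp: prime_part_def)
      then have "real u \<le> y" by (simp only: y_def of_nat_le_iff)
      also have "\<dots> \<le> 1 + ln (real n) powr (- \<alpha>)" by (rule n0[OF n(1)])
      also have "\<dots> \<le> real v * (1 + ln (real n) powr (- \<alpha>))"
        using P(2)[of v] uv prime_ge_1_nat[of v] by (auto simp: prime_part_def intro!: mult_right_mono[of 1 "real v", simplified])
      finally show "real u \<le> real v * (1 + ln (real n) powr (- \<alpha>))" .
    qed
    have "{n\<in>{1..N}. card (prime_part P n) \<ge> k \<and> card (prime_part P n) \<le> r} \<subseteq> {n\<in>{1..N}. has_close_divisors k \<alpha> n} \<union> {..<n0}"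
      using close by (auto simp: not_less)
    then have "card {n\<in>{1..N}. card (prime_part P n) \<ge> k \<and> card (prime_part P n) \<le> r} \<le> card ({n\<in>{1..N}. has_close_divisors k \<alpha> n} \<union> {..<n0})"
      by (intro card_mono) auto
    also have "\<dots> \<le> card {n\<in>{1..N}. has_close_divisors k \<alpha> n} + n0"
      using card_Un_le[of "{n\<in>{1..N}. has_close_divisors k \<alpha> n}" "{..<n0}"] by simp
    finally have 1: "real (card {n\<in>{1..N}. card (prime_part P n) \<ge> k \<and> card (prime_part P n) \<le> r}) \<le> real (card {n\<in>{1..N}. has_close_divisors k \<alpha> n}) + real n0"
      by linarith
    have 2: "real N * ((\<Sum>T\<in>Pow P. bern_weight (\<lambda>p. 1 / real p) P T * of_bool (card T \<ge> k)) - 2 * exp (3 * \<Lambda>) / 2 ^ r) - A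
       \<le> real (card {n\<in>{1..N}. card (prime_part P n) \<ge> k \<and> card (prime_part P n) \<le> r})"
      using sieve_monotone[OF P(1,2) r(1), of N "\<lambda>T. card T \<ge> k"] by (simp only: A_def \<Lambda>_def)
    have "real N * (1 - \<epsilon> / 2) \<le> real N * ((\<Sum>T\<in>Pow P. bern_weight (\<lambda>p. 1 / real p) P T * of_bool (card T \<ge> k)) - 2 * exp (3 * \<Lambda>) / 2 ^ r)"
      using many r(2) by (intro mult_left_mono) auto
    then show ?thesis using 1 2 by linarith
  qed
  have "eventually (\<lambda>N::nat. A + real n0 \<le> \<epsilon> / 2 * real N) sequentially"
    using \<epsilon> by real_asymp
  then show "eventually (\<lambda>N. real (card {n\<in>{1..N}. has_close_divisors k \<alpha> n}) \<ge> (1 - \<epsilon>) * real N) sequentially"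
  proof eventually_elim
    case (elim N)
    then show ?case using main[of N] by (simp add: algebra_simps)
  qed
qed

section \<open>Blocks of primes and the divisors built from them\<close>

definition log_block :: "real \<Rightarrow> nat \<Rightarrow> nat set" where
  "log_block \<delta> i = {p. prime p \<and> \<bar>ln (real p) - (real i + 1/2) * \<delta>\<bar> < \<delta> / 2}"

lemma log_block_bounds:
  assumes "p \<in> log_block \<delta> i"
  shows "prime p" "real i * \<delta> < ln (real p)" "ln (real p) < (real i + 1) * \<delta>"
proof -
  define x where "x = real i * \<delta>"
  have e: "(real i + 1/2) * \<delta> = x + \<delta> / 2" "(real i + 1) * \<delta> = x + \<delta>"
    by (simp_all add: x_def algebra_simps)
  have *: "\<bar>ln (real p) - (x + \<delta> / 2)\<bar> < \<delta> / 2" using assms unfolding log_block_def e by simp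
  have "x < ln (real p)" "ln (real p) < x + \<delta>" using * unfolding abs_less_iff by linarith+
  then show "real i * \<delta> < ln (real p)" "ln (real p) < (real i + 1) * \<delta>" unfolding e by (simp_all add: x_def)
  show "prime p" using assms by (simp add: log_block_def)
qed

lemma finite_log_block: "finite (log_block \<delta> i)"
  using finite_log_interval[of "(real i + 1/2) * \<delta>" "\<delta> / 2"]
  by (rule rev_finite_subset) (auto simp: log_block_def intro: prime_ge_1_nat[unfolded One_nat_def])

lemma log_block_disjoint:
  assumes "\<delta> > 0" "i \<noteq> j"
  shows "log_block \<delta> i \<inter> log_block \<delta> j = {}"
proof -
  have *: False if "i < j" "p \<in> log_block \<delta> i" "p \<in> log_block \<delta> j" for i j p
  proof -
    have "(real i + 1) * \<delta> \<le> real j * \<delta>" using that(1) assms(1) by (intro mult_right_mono) auto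
    then show False using log_block_bounds[OF that(2)] log_block_bounds[OF that(3)] by linarith
  qed
  show ?thesis using *[of i j] *[of j i] assms(2) by (cases i j rule: linorder_cases) auto
qed

text \<open>From each hit block one prime of T is chosen. An index set with sum \<sigma> gives a
  product whose logarithm exceeds \<sigma> \<delta> by at most \<delta> card T, so equal sums give
  divisors within a factor exp(\<delta> card T) of each other. Blocks are disjoint, so the choice is
  injective, and unique factorisation keeps the divisors distinct.\<close>

lemma has_close_divisors_from_hits:
  assumes k: "k \<ge> 2" and \<delta>: "\<delta> > 0" and n: "n \<ge> 1"
    and T: "finite T" "\<And>p. p \<in> T \<Longrightarrow> prime p \<and> p dvd n"
    and eq: "has_equal_subset_sums k (hits (log_block \<delta>) J T)"
    and small: "n \<ge> 2 \<Longrightarrow> exp (\<delta> * real (card T)) \<le> 1 + ln (real n) powr (- \<alpha>)"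
  shows "has_close_divisors k \<alpha> n"
proof -
  define H where "H = hits (log_block \<delta>) J T"
  have "\<forall>i\<in>H. \<exists>p. p \<in> T \<inter> log_block \<delta> i" by (auto simp: H_def hits_def)
  then obtain f where f: "\<And>i. i \<in> H \<Longrightarrow> f i \<in> T \<inter> log_block \<delta> i" by metis
  have finj: "inj_on f H"
  proof (rule inj_onI)
    fix i j assume ij: "i \<in> H" "j \<in> H" "f i = f j"
    then have "f i \<in> log_block \<delta> i \<inter> log_block \<delta> j" using f[of i] f[of j] by auto
    then show "i = j" using log_block_disjoint[OF \<delta>, of i j] by auto
  qed
  have fpr: "prime (f i)" "f i dvd n" "f i > 0" if "i \<in> H" for i
    using f[OF that] T(2)[of "f i"] prime_gt_0_nat by auto
  have finH: "finite H" and cardH: "card H \<le> card T"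
  proof -
    have sub: "f ` H \<subseteq> T" using f by auto
    then show "finite H" using T finj finite_imageD finite_subset by blast
    show "card H \<le> card T" by (rule card_inj_on_le[OF finj sub T(1)])
  qed
  from eq obtain S where S: "inj_on S {1..k}" "\<And>i. i \<in> {1..k} \<Longrightarrow> S i \<subseteq> H"
    "\<And>i j. i \<in> {1..k} \<Longrightarrow> j \<in> {1..k} \<Longrightarrow> \<Sum>(S i) = \<Sum>(S j)"
    unfolding has_equal_subset_sums_def H_def by blast
  have finS: "finite (S j)" if "j \<in> {1..k}" for j using S(2)[OF that] finH finite_subset by blast
  define d where "d = (\<lambda>j. \<Prod>i\<in>S j. f i)"
  have mem: "f i dvd d j \<longleftrightarrow> i \<in> S j" if j: "j \<in> {1..k}" and i: "i \<in> H" for i j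
  proof
    assume "i \<in> S j"
    then show "f i dvd d j" unfolding d_def using finS[OF j] by (intro dvd_prodI)
  next
    assume "f i dvd d j"
    then obtain i' where i': "i' \<in> S j" "f i dvd f i'"
      unfolding d_def using prime_dvd_prod_iff[OF finS[OF j] fpr(1)[OF i]] by blast
    then have "i' \<in> H" using S(2)[OF j] by auto
    then have "f i = f i'" using i' fpr(1)[OF i] fpr(1)[of i'] primes_dvd_imp_eq by blast
    then show "i \<in> S j" using finj i \<open>i' \<in> H\<close> i'(1) by (auto dest: inj_onD)
  qed
  have dinj: "inj_on d {1..k}"
  proof (rule inj_onI)
    fix j j' assume jj: "j \<in> {1..k}" "j' \<in> {1..k}" "d j = d j'"
    have "S j = S j'" using mem[OF jj(1)] mem[OF jj(2)] S(2)[OF jj(1)] S(2)[OF jj(2)] jj(3) by auto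
    then show "j = j'" using S(1) jj by (auto dest: inj_onD)
  qed
  have ddvd: "d j dvd n" if j: "j \<in> {1..k}" for j
  proof -
    have inj: "inj_on f (S j)" using finj S(2)[OF j] inj_on_subset by blast
    have "d j = \<Prod>(f ` S j)" unfolding d_def using inj by (simp add: prod.reindex)
    also have "\<dots> dvd n"
      using finS[OF j] S(2)[OF j] fpr by (subst prod_primes_dvd_iff) auto
    finally show ?thesis .
  qed
  have dpos: "d j > 0" if j: "j \<in> {1..k}" for j
    unfolding d_def using S(2)[OF j] fpr(3) by (intro prod_pos) auto
  define \<sigma> where "\<sigma> = real (\<Sum>(S 1))"
  have lnd: "\<sigma> * \<delta> \<le> ln (real (d j))" "ln (real (d j)) \<le> \<sigma> * \<delta> + real (card T) * \<delta>" if j: "j \<in> {1..k}" for j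
  proof -
    have "1 \<in> {1..k}" using k by simp
    then have sj: "\<sigma> = (\<Sum>i\<in>S j. real i)" unfolding \<sigma>_def using S(3)[of 1 j] j by (simp del: of_nat_sum add: of_nat_sum[symmetric])
    have ln: "ln (real (d j)) = (\<Sum>i\<in>S j. ln (real (f i)))"
      unfolding d_def of_nat_prod using S(2)[OF j] fpr(3) by (intro ln_prod[OF finS[OF j]]) auto
    have each: "real i * \<delta> \<le> ln (real (f i)) \<and> ln (real (f i)) \<le> real i * \<delta> + \<delta>" if "i \<in> S j" for i
      using log_block_bounds[of "f i" \<delta> i] f[of i] S(2)[OF j] that by (auto simp: algebra_simps)
    have "\<sigma> * \<delta> = (\<Sum>i\<in>S j. real i * \<delta>)" unfolding sj by (rule sum_distrib_right)
    also have "\<dots> \<le> ln (real (d j))" unfolding ln using each by (intro sum_mono) auto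
    finally show "\<sigma> * \<delta> \<le> ln (real (d j))" .
    have "ln (real (d j)) \<le> (\<Sum>i\<in>S j. real i * \<delta> + \<delta>)" unfolding ln using each by (intro sum_mono) auto
    also have "\<dots> = \<sigma> * \<delta> + real (card (S j)) * \<delta>" unfolding sj by (simp add: sum.distrib sum_distrib_right)
    also have "real (card (S j)) * \<delta> \<le> real (card T) * \<delta>"
    proof -
      have "card (S j) \<le> card H" using S(2)[OF j] finH by (intro card_mono)
      then show ?thesis using cardH \<delta> by (intro mult_right_mono) auto
    qed
    finally show "ln (real (d j)) \<le> \<sigma> * \<delta> + real (card T) * \<delta>" by simp
  qed
  \<comment> \<open>Two distinct divisors rule out n = 1, where ln n = 0 and the closeness bound is
    not assumed.\<close>
  have n2: "n \<ge> 2"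
  proof (rule ccontr)
    assume "\<not> n \<ge> 2"
    then have "n = 1" using n by simp
    then have "d 1 = d 2" using ddvd[of 1] ddvd[of 2] k by simp
    then have "(1::nat) = 2" using dinj k by (auto dest!: inj_onD)
    then show False by simp
  qed
  show ?thesis
  proof (rule has_close_divisorsI[of "d ` {1..k}"])
    show "finite (d ` {1..k})" by simp
    show "card (d ` {1..k}) \<ge> k" using dinj by (simp add: card_image)
    show "k \<ge> 1" using k by simp
    show "u dvd n" if "u \<in> d ` {1..k}" for u using that ddvd by auto
    fix u v assume "u \<in> d ` {1..k}" "v \<in> d ` {1..k}"
    then obtain j j' where j: "j \<in> {1..k}" "j' \<in> {1..k}" "u = d j" "v = d j'" by auto
    have "ln (real u) \<le> ln (real v) + real (card T) * \<delta>"
      using lnd[OF j(1)] lnd[OF j(2)] unfolding j(3,4) by linarith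
    then have "exp (ln (real u)) \<le> exp (ln (real v) + real (card T) * \<delta>)" by simp
    also have "\<dots> = real v * exp (\<delta> * real (card T))" using dpos[OF j(2)] j by (simp add: exp_add mult.commute)
    also have "\<dots> \<le> real v * (1 + ln (real n) powr (- \<alpha>))"
      using small[OF n2] by (intro mult_left_mono) auto
    finally show "real u \<le> real v * (1 + ln (real n) powr (- \<alpha>))" using dpos[OF j(1)] j by simp
  qed
qed

text \<open>In block i one has ln p < (i + 1) \<delta>, so the reciprocals sum to at least s = (1 -
  C / a) / (i + 1), and the probability of a hit is at least 1 - exp (-s) \<ge> s - s^2. Replacing i
  + 1 by i and dropping s^2 cost at most 1 / i^2 each, together the 2 / i in the relative
  error.\<close>

lemma block_hit_probability:
  assumes \<delta>: "0 < \<delta>" and i: "i \<ge> 1" and C: "C > 0" and a: "a > 0" "a \<ge> C" "a \<le> (real i + 1/2) * \<delta>"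
    and sum: "(\<Sum>p\<in>log_block \<delta> i. ln (real p) / real p) \<ge> \<delta> * (1 - C / ((real i + 1/2) * \<delta>))"
  shows "1 - (\<Prod>p\<in>log_block \<delta> i. 1 - 1 / real p) \<ge> 1 / real i - (2 / real i + C / a) * (1 / real i)"
proof -
  define S where "S = (\<Sum>p\<in>log_block \<delta> i. 1 / real p)"
  define s where "s = (1 - C / a) / (real i + 1)"
  have i1: "real i \<ge> 1" using i by simp
  have s0: "s \<ge> 0" using a by (simp add: s_def)
  have "C / ((real i + 1/2) * \<delta>) \<le> C / a" using a C by (intro divide_left_mono) auto
  then have "\<delta> * (1 - C / a) \<le> \<delta> * (1 - C / ((real i + 1/2) * \<delta>))" using \<delta> by (intro mult_left_mono) auto
  also have "\<dots> \<le> (\<Sum>p\<in>log_block \<delta> i. ln (real p) / real p)" by (rule sum)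
  also have "\<dots> \<le> (\<Sum>p\<in>log_block \<delta> i. ((real i + 1) * \<delta>) * (1 / real p))"
  proof (rule sum_mono)
    fix p assume "p \<in> log_block \<delta> i"
    from log_block_bounds(3)[OF this] show "ln (real p) / real p \<le> ((real i + 1) * \<delta>) * (1 / real p)"
      by (simp add: divide_right_mono)
  qed
  also have "\<dots> = \<delta> * ((real i + 1) * S)" by (simp add: S_def sum_distrib_left mult_ac)
  finally have "1 - C / a \<le> (real i + 1) * S" using \<delta> by simp
  then have sS: "s \<le> S" unfolding s_def by (simp add: pos_divide_le_eq mult.commute add_pos_pos)
  have "(\<Prod>p\<in>log_block \<delta> i. 1 - 1 / real p) \<le> (\<Prod>p\<in>log_block \<delta> i. exp (- (1 / real p)))"
  proof (rule prod_mono)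
    fix p assume "p \<in> log_block \<delta> i"
    then have "p \<ge> 1" using log_block_bounds(1) prime_ge_1_nat by blast
    then show "0 \<le> 1 - 1 / real p \<and> 1 - 1 / real p \<le> exp (- (1 / real p))"
      using exp_ge_add_one_self[of "- (1 / real p)"] by simp
  qed
  also have "\<dots> = exp (- S)" using finite_log_block by (simp add: S_def exp_sum[symmetric] sum_negf)
  also have "\<dots> \<le> exp (- s)" using sS by simp
  \<comment> \<open>Because exp (-s) \<le> 1 / (1 + s) and (1 - s + s^2) (1 + s) = 1 + s^3.\<close>
  also have "\<dots> \<le> 1 - s + s ^ 2"
  proof -
    have "exp (- s) * (1 + s) \<le> exp (- s) * exp s" by (intro mult_left_mono exp_ge_add_one_self) auto
    also have "\<dots> = 1" by (simp flip: exp_add)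
    also have "1 \<le> (1 - s + s ^ 2) * (1 + s)"
      using s0 by (simp add: algebra_simps power2_eq_square)
    finally show ?thesis using s0 by (subst (asm) mult_le_cancel_right_pos) auto
  qed
  finally have 1: "(\<Prod>p\<in>log_block \<delta> i. 1 - 1 / real p) \<le> 1 - s + s ^ 2" .
  have s_up: "s \<le> 1 / real i"
    unfolding s_def using i1 a C by (intro frac_le) (auto simp: divide_nonneg_nonneg)
  then have s2: "s ^ 2 \<le> (1 / real i) ^ 2" using s0 by (intro power_mono)
  have s_lo: "s \<ge> 1 / real i - (1 / real i) ^ 2 - C / a * (1 / real i)"
  proof -
    have "1 / real i - 1 / (real i + 1) = 1 / (real i * (real i + 1))" using i1 by (simp add: field_simps)
    also have "\<dots> \<le> 1 / (real i * real i)" using i1 by (intro divide_left_mono mult_left_mono) auto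
    finally have A: "1 / (real i + 1) \<ge> 1 / real i - (1 / real i) ^ 2" by (simp add: power2_eq_square)
    have "C / a * (1 / (real i + 1)) \<le> C / a * (1 / real i)"
      using i1 a C by (intro mult_left_mono divide_left_mono) auto
    moreover have "s = 1 / (real i + 1) - C / a * (1 / (real i + 1))" by (simp add: s_def diff_divide_distrib)
    ultimately show ?thesis using A by linarith
  qed
  have "(2 / real i + C / a) * (1 / real i) = 2 * (1 / real i) ^ 2 + C / a * (1 / real i)"
    by (simp add: power2_eq_square algebra_simps)
  with 1 s2 s_lo show ?thesis by linarith
qed

lemma has_equal_subset_sums_mono:
  "A \<subseteq> B \<Longrightarrow> has_equal_subset_sums k A \<Longrightarrow> has_equal_subset_sums k B"
  unfolding has_equal_subset_sums_def by (meson subset_trans)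

text \<open>Block comparison, sieve and divisor construction combined, with all parameters still
  free. The logarithmic positions of the blocks lie between a and M. The losses are the deviations
  of the hitting probabilities from 1 / i summed over the window, the truncation error, and the
  rounding error, where the number of primes is at most exp M.\<close>

lemma close_divisors_count:
  fixes k N r :: nat
  assumes k: "k \<ge> 2" and \<delta>: "0 < \<delta>" and r: "odd r" and D: "D \<ge> 1" and C: "C > 0"
    and block: "\<And>i. i \<in> log_window c D \<Longrightarrow>
       (\<Sum>p\<in>log_block \<delta> i. ln (real p) / real p) \<ge> \<delta> * (1 - C / ((real i + 1/2) * \<delta>))"
    and a: "a > 0" "a \<ge> C" "a \<le> D powr c * \<delta>"
    and M: "(D + 1) * \<delta> \<le> M"
    and \<Lambda>0: "\<And>S. finite S \<Longrightarrow> (\<And>p. p \<in> S \<Longrightarrow> prime p \<and> ln (real p) \<le> M) \<Longrightarrow> (\<Sum>p\<in>S. 1 / real p) \<le> \<Lambda>0"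
    and small: "\<And>n. 2 \<le> n \<Longrightarrow> n \<le> N \<Longrightarrow> exp (\<delta> * real r) \<le> 1 + ln (real n) powr (- \<alpha>)"
  shows "real (card {n\<in>{1..N}. has_close_divisors k \<alpha> n}) \<ge>
     real N * (measure log_random_space (equal_sums_event k c D)
        - (2 / D powr c + C / a) * (1 + ln D) - 2 * exp (3 * \<Lambda>0) / 2 ^ r) - 9 * (exp M + 1) ^ (2 * r)"
proof -
  define J where "J = log_window c D"
  define P where "P = (\<Union>i\<in>J. log_block \<delta> i)"
  define e where "e = (\<lambda>i. (2 / real i + C / a) * (1 / real i))"
  define \<Lambda> where "\<Lambda> = (\<Sum>p\<in>P. 1 / real p)"
  have J: "finite J" "\<And>i. i \<in> J \<Longrightarrow> i \<ge> 1" "\<And>i. i \<in> J \<Longrightarrow> D powr c \<le> real i" "\<And>i. i \<in> J \<Longrightarrow> real i \<le> D"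
    by (simp add: J_def finite_log_window) (simp_all add: J_def log_window_def)
  have P: "finite P" "\<And>p. p \<in> P \<Longrightarrow> prime p" using J finite_log_block log_block_bounds(1) by (auto simp: P_def)
  have lnP: "ln (real p) \<le> M" if p: "p \<in> P" for p
  proof -
    obtain i where i: "i \<in> J" "p \<in> log_block \<delta> i" using p by (auto simp: P_def)
    have "ln (real p) \<le> (real i + 1) * \<delta>" using log_block_bounds(3)[OF i(2)] by simp
    also have "\<dots> \<le> (D + 1) * \<delta>" using J(4)[OF i(1)] \<delta> by (intro mult_right_mono) auto
    finally show ?thesis using M by simp
  qed
  have \<Lambda>: "\<Lambda> \<le> \<Lambda>0" unfolding \<Lambda>_def using P lnP by (intro \<Lambda>0) auto
  have cardP: "real (card P) \<le> exp M"
  proof -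
    have "P \<subseteq> {1..nat \<lfloor>exp M\<rfloor>}"
    proof
      fix p assume p: "p \<in> P"
      then have "p \<ge> 1" using P(2) prime_ge_1_nat by blast
      moreover have "real p \<le> exp M" using lnP[OF p] \<open>p \<ge> 1\<close> by (subst (asm) ln_le_iff_le_exp) auto
      ultimately show "p \<in> {1..nat \<lfloor>exp M\<rfloor>}" using le_nat_floor by auto
    qed
    then have "card P \<le> card {1..nat \<lfloor>exp M\<rfloor>}" by (intro card_mono) auto
    then have "real (card P) \<le> real (card {1..nat \<lfloor>exp M\<rfloor>})" by (simp only: of_nat_le_iff)
    also have "\<dots> \<le> exp M" by simp
    finally show ?thesis .
  qed
  have blocks: "(\<Sum>T\<in>Pow P. bern_weight (\<lambda>p. 1 / real p) P T * of_bool (has_equal_subset_sums k (hits (log_block \<delta>) J T)))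
      \<ge> (\<Sum>T\<in>Pow J. bern_weight (\<lambda>i. 1 / real i) J T * of_bool (has_equal_subset_sums k T)) - (\<Sum>i\<in>J. e i)"
    unfolding P_def
  proof (rule bern_weight_blocks[OF J(1)])
    show "finite (log_block \<delta> i)" for i by (rule finite_log_block)
    show "log_block \<delta> i \<inter> log_block \<delta> j = {}" if "i \<noteq> j" for i j by (rule log_block_disjoint[OF \<delta> that])
    show "0 \<le> 1 / real i \<and> 1 / real i \<le> 1" if "i \<in> J" for i using J(2)[OF that] by simp
    show "0 \<le> 1 / real p \<and> 1 / real p \<le> 1" if "p \<in> log_block \<delta> i" for i p
      using prime_ge_1_nat[OF log_block_bounds(1)[OF that]] by simp
    show "e i \<ge> 0" for i using C a by (simp add: e_def)
    show "has_equal_subset_sums k B" if "A \<subseteq> B" "has_equal_subset_sums k A" for A B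
      using that by (rule has_equal_subset_sums_mono)
    fix i assume i: "i \<in> J"
    have "D powr c * \<delta> \<le> (real i + 1/2) * \<delta>" using J(3)[OF i] \<delta> by (intro mult_right_mono) auto
    then have "a \<le> (real i + 1/2) * \<delta>" using a by linarith
    then show "1 - (\<Prod>p\<in>log_block \<delta> i. 1 - 1 / real p) \<ge> 1 / real i - e i"
      unfolding e_def using block[of i] i by (intro block_hit_probability[OF \<delta> J(2)[OF i] C a(1,2)]) (auto simp: J_def)
  qed
  have sume: "(\<Sum>i\<in>J. e i) \<le> (2 / D powr c + C / a) * (1 + ln D)"
  proof -
    have "(\<Sum>i\<in>J. e i) \<le> (\<Sum>i\<in>J. (2 / D powr c + C / a) * (1 / real i))"
    proof (rule sum_mono)
      fix i assume i: "i \<in> J"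
      have "2 / real i \<le> 2 / D powr c" using J(2,3)[OF i] D by (intro divide_left_mono mult_pos_pos) auto
      then show "e i \<le> (2 / D powr c + C / a) * (1 / real i)" unfolding e_def by (intro mult_right_mono) auto
    qed
    also have "\<dots> = (2 / D powr c + C / a) * (\<Sum>i\<in>J. 1 / real i)" by (simp add: sum_distrib_left)
    also have "\<dots> \<le> (2 / D powr c + C / a) * (1 + ln D)"
    proof (rule mult_left_mono)
      have n1: "nat \<lfloor>D\<rfloor> \<ge> 1" using D by (simp add: le_nat_floor)
      have "(\<Sum>i\<in>J. 1 / real i) \<le> 1 + ln (real (nat \<lfloor>D\<rfloor>))"
        using J(1) J(2) J(4) n1 by (intro sum_inverse_le_ln) (auto simp: le_nat_floor Suc_le_eq)
      also have "\<dots> \<le> 1 + ln D" using n1 D by (intro add_left_mono ln_mono) auto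
      finally show "(\<Sum>i\<in>J. 1 / real i) \<le> 1 + ln D" .
    qed (use C a in auto)
    finally show ?thesis .
  qed
  define G where "G = (\<lambda>T. has_equal_subset_sums k (hits (log_block \<delta>) J T))"
  have sub: "{n\<in>{1..N}. G (prime_part P n) \<and> card (prime_part P n) \<le> r} \<subseteq> {n\<in>{1..N}. has_close_divisors k \<alpha> n}"
  proof
    fix n assume n: "n \<in> {n\<in>{1..N}. G (prime_part P n) \<and> card (prime_part P n) \<le> r}"
    have "has_close_divisors k \<alpha> n"
    proof (rule has_close_divisors_from_hits[OF k \<delta>])
      show "n \<ge> 1" using n by simp
      show "finite (prime_part P n)" using P by (simp add: prime_part_def)
      show "prime p \<and> p dvd n" if "p \<in> prime_part P n" for p using that P by (simp add: prime_part_def)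
      show "has_equal_subset_sums k (hits (log_block \<delta>) J (prime_part P n))" using n by (simp add: G_def)
      assume n2: "n \<ge> 2"
      have "exp (\<delta> * real (card (prime_part P n))) \<le> exp (\<delta> * real r)" using n \<delta> by simp
      also have "\<dots> \<le> 1 + ln (real n) powr (- \<alpha>)" using n n2 by (intro small) auto
      finally show "exp (\<delta> * real (card (prime_part P n))) \<le> 1 + ln (real n) powr (- \<alpha>)" .
    qed
    then show "n \<in> {n\<in>{1..N}. has_close_divisors k \<alpha> n}" using n by simp
  qed
  have "card {n\<in>{1..N}. G (prime_part P n) \<and> card (prime_part P n) \<le> r} \<le> card {n\<in>{1..N}. has_close_divisors k \<alpha> n}"
    by (rule card_mono[OF _ sub]) simp
  then have c1: "real (card {n\<in>{1..N}. G (prime_part P n) \<and> card (prime_part P n) \<le> r}) \<le> real (card {n\<in>{1..N}. has_close_divisors k \<alpha> n})"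
    by simp
  have c2: "real N * ((\<Sum>T\<in>Pow P. bern_weight (\<lambda>p. 1 / real p) P T * of_bool (G T)) - 2 * exp (3 * \<Lambda>) / 2 ^ r) - 9 * real (Suc (card P)) ^ (2 * r)
      \<le> real (card {n\<in>{1..N}. G (prime_part P n) \<and> card (prime_part P n) \<le> r})"
    unfolding \<Lambda>_def by (rule sieve_monotone[OF P r])
  have c3: "real (Suc (card P)) ^ (2 * r) \<le> (exp M + 1) ^ (2 * r)"
    using cardP by (intro power_mono) auto
  have c4: "2 * exp (3 * \<Lambda>) / 2 ^ r \<le> 2 * exp (3 * \<Lambda>0) / 2 ^ r" using \<Lambda> by (intro divide_right_mono) auto
  have "measure log_random_space (equal_sums_event k c D) = (\<Sum>T\<in>Pow J. bern_weight (\<lambda>i. 1 / real i) J T * of_bool (has_equal_subset_sums k T))"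
    unfolding J_def by (rule measure_equal_sums_event)
  then have "measure log_random_space (equal_sums_event k c D) - (2 / D powr c + C / a) * (1 + ln D) - 2 * exp (3 * \<Lambda>0) / 2 ^ r
     \<le> (\<Sum>T\<in>Pow P. bern_weight (\<lambda>p. 1 / real p) P T * of_bool (G T)) - 2 * exp (3 * \<Lambda>) / 2 ^ r"
    unfolding G_def using blocks sume c4 by linarith
  from mult_left_mono[OF this, of "real N"]
  show ?thesis using c1 c2 c3 by linarith
qed

lemma exp_le_one_plus_twice:
  assumes "0 \<le> x" "x \<le> (1::real)"
  shows "exp x \<le> 1 + 2 * x"
proof -
  have "exp x \<le> 1 + x + x ^ 2" using assms by (intro exp_bound)
  moreover have "x ^ 2 \<le> x" using assms by (simp add: power2_eq_square mult_left_le)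
  ultimately show ?thesis by simp
qed

lemma almost_every_close_divisors:
  fixes c \<alpha> :: real
  assumes k: "k \<ge> 2" and c: "0 < c" "c < 1"
    and adm: "((\<lambda>D::real. measure log_random_space (equal_sums_event k c D)) \<longlongrightarrow> 1) at_top"
    and \<alpha>: "0 < \<alpha>" "\<alpha> < c / (1 - c)"
  shows "almost_every (has_close_divisors k \<alpha>)"
proof (rule almost_everyI)
  fix \<epsilon>0 :: real assume \<epsilon>0: "\<epsilon>0 > 0"
  \<comment> \<open>Half of the gap in \<alpha> (1 - c) < c, which makes \<eta> equal to
    \<epsilon>.\<close>
  define \<epsilon> where "\<epsilon> = (c - \<alpha> * (1 - c)) / 2"
  define \<eta> where "\<eta> = (1 + \<alpha>) * c - \<alpha> - \<epsilon>"
  have "\<alpha> * (1 - c) < c" using \<alpha> c by (simp add: field_simps)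
  then have \<epsilon>: "0 < \<epsilon>" by (simp add: \<epsilon>_def)
  have "\<eta> = \<epsilon>" by (simp add: \<eta>_def \<epsilon>_def field_simps)
  then have \<eta>: "0 < \<eta>" using \<epsilon> by simp
  have "\<alpha> * (1 - c) > 0" using \<alpha> c by simp
  then have \<epsilon>1: "\<epsilon> < 1/2" using c by (simp add: \<epsilon>_def)
  \<comment> \<open>Then (L^\<eta>)^(-B) is the block width \<delta>: B is the power of the
    logarithm required at the lowest block.\<close>
  define B where "B = (\<alpha> + \<epsilon>) / \<eta>"
  have B: "B \<ge> 0" using \<alpha> \<epsilon> \<eta> by (simp add: B_def)
  from primes_log_interval[OF B] obtain C a0 where C: "C > 0" "a0 \<ge> 1"
    "\<And>a \<delta>. a \<ge> a0 \<Longrightarrow> a powr (- B) \<le> \<delta> \<Longrightarrow> \<delta> \<le> 1 \<Longrightarrow>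
      (\<Sum>p\<in>{p. prime p \<and> \<bar>ln (real p) - a\<bar> < \<delta> / 2}. ln (real p) / real p) \<ge> \<delta> * (1 - C / a)"
    by blast
  from sum_inverse_primes_upper obtain C2 where C2: "C2 \<ge> 1"
    "\<And>L S. L \<ge> 1 \<Longrightarrow> finite S \<Longrightarrow> (\<And>p. p \<in> S \<Longrightarrow> prime p \<and> ln (real p) \<le> L) \<Longrightarrow> (\<Sum>p\<in>S. 1 / real p) \<le> 3 * ln (C2 * L)"
    by blast
  define D where "D = (\<lambda>L. L powr (1 + \<alpha>))"
  have limD: "filterlim D at_top at_top" unfolding D_def using \<alpha> by real_asymp
  have ev1: "eventually (\<lambda>L. L powr \<eta> \<ge> max a0 C) at_top"
  proof -
    have "filterlim (\<lambda>L. L powr \<eta>) at_top at_top" using \<eta> by real_asymp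
    then show ?thesis by (simp only: filterlim_at_top)
  qed
  have ev2: "eventually (\<lambda>L. (2 / D L powr c + C / L powr \<eta>) * (1 + ln (D L)) < \<epsilon>0 / 4) at_top"
  proof -
    define \<gamma> where "\<gamma> = (1 + \<alpha>) * c"
    have \<gamma>: "\<gamma> > 0" using \<alpha> c by (simp add: \<gamma>_def)
    have "((\<lambda>L. (2 / L powr \<gamma> + C / L powr \<eta>) * (1 + (1 + \<alpha>) * ln L)) \<longlongrightarrow> 0) at_top"
    proof -
      have "((\<lambda>L. 2 * ((1 + (1 + \<alpha>) * ln L) / L powr \<gamma>) + C * ((1 + (1 + \<alpha>) * ln L) / L powr \<eta>)) \<longlongrightarrow> 2 * 0 + C * 0) at_top"
      proof (intro tendsto_intros)
        show "((\<lambda>L. (1 + (1 + \<alpha>) * ln L) / L powr \<gamma>) \<longlongrightarrow> 0) at_top" using \<gamma> \<alpha> by real_asymp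
        show "((\<lambda>L. (1 + (1 + \<alpha>) * ln L) / L powr \<eta>) \<longlongrightarrow> 0) at_top" using \<eta> \<alpha> by real_asymp
      qed
      then show ?thesis by (simp add: algebra_simps add_divide_distrib)
    qed
    then have "eventually (\<lambda>L. (2 / L powr \<gamma> + C / L powr \<eta>) * (1 + (1 + \<alpha>) * ln L) < \<epsilon>0 / 4) at_top"
      using \<epsilon>0 by (intro order_tendstoD) auto
    then show ?thesis using eventually_gt_at_top[of 0]
      by eventually_elim (simp add: D_def powr_powr ln_powr \<gamma>_def)
  qed
  \<comment> \<open>The power 9 is 3 * 3: the sieve has exp(3 \<Lambda>), and \<Lambda> is at most 3
    ln (C2 M). A power of L loses against 2^(L^(\<epsilon>/2)).\<close>
  have ev3: "eventually (\<lambda>L. 2 * (C2 * (2 * L powr (1 - \<epsilon>))) ^ 9 / 2 powr (L powr (\<epsilon> / 2)) < \<epsilon>0 / 4) at_top"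
  proof -
    have "((\<lambda>L::real. L powr 9 / 2 powr (L powr (\<epsilon> / 2))) \<longlongrightarrow> 0) at_top" using \<epsilon> by real_asymp
    then have "((\<lambda>L. (2 * (C2 * 2) ^ 9) * (L powr 9 / 2 powr (L powr (\<epsilon> / 2)))) \<longlongrightarrow> (2 * (C2 * 2) ^ 9) * 0) at_top"
      by (intro tendsto_intros)
    then have "eventually (\<lambda>L. (2 * (C2 * 2) ^ 9) * (L powr 9 / 2 powr (L powr (\<epsilon> / 2))) < \<epsilon>0 / 4) at_top"
      using \<epsilon>0 by (intro order_tendstoD) auto
    then show ?thesis using eventually_ge_at_top[of 1]
    proof eventually_elim
      case (elim L)
      have "(L powr (1 - \<epsilon>)) ^ 9 \<le> L ^ 9" using elim \<epsilon> powr_mono[of "1 - \<epsilon>" 1 L] by (intro power_mono) auto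
      then have "2 * (C2 * (2 * L powr (1 - \<epsilon>))) ^ 9 \<le> 2 * (C2 * 2) ^ 9 * L powr 9"
        using C2(1) elim by (simp add: power_mult_distrib mult_left_mono)
      then have "2 * (C2 * (2 * L powr (1 - \<epsilon>))) ^ 9 / 2 powr (L powr (\<epsilon> / 2)) \<le> (2 * (C2 * 2) ^ 9) * (L powr 9 / 2 powr (L powr (\<epsilon> / 2)))"
        by (simp add: divide_right_mono)
      then show ?case using elim by linarith
    qed
  qed
  \<comment> \<open>The factor 18 is 6 * 3, from 2r \<le> 6y with y = L^(\<epsilon>/2) and M + 1
    \<le> 3 L^(1 - \<epsilon>).\<close>
  have ev4: "eventually (\<lambda>L. 9 * exp (18 * L powr (1 - \<epsilon> / 2)) < \<epsilon>0 / 4 * exp L) at_top"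
  proof -
    have "((\<lambda>L::real. 9 * exp (18 * L powr (1 - \<epsilon> / 2) - L)) \<longlongrightarrow> 0) at_top" using \<epsilon> \<epsilon>1 by real_asymp
    then have "eventually (\<lambda>L. 9 * exp (18 * L powr (1 - \<epsilon> / 2) - L) < \<epsilon>0 / 4) at_top"
      using \<epsilon>0 by (intro order_tendstoD) auto
    then show ?thesis by eventually_elim (simp add: exp_diff field_simps)
  qed
  have ev5: "eventually (\<lambda>L::real. L powr (\<epsilon> / 2) \<ge> 6) at_top" using \<epsilon> by real_asymp
  have ev6: "eventually (\<lambda>L. measure log_random_space (equal_sums_event k c (D L)) > 1 - \<epsilon>0 / 4) at_top"
  proof -
    have "((\<lambda>L. measure log_random_space (equal_sums_event k c (D L))) \<longlongrightarrow> 1) at_top"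
      by (rule filterlim_compose[OF adm limD])
    then show ?thesis using \<epsilon>0 by (intro order_tendstoD) auto
  qed
  have limL: "filterlim (\<lambda>N::nat. ln (real N)) at_top sequentially" by real_asymp
  have "eventually (\<lambda>L. (max a0 C \<le> L powr \<eta> \<and> (2 / D L powr c + C / L powr \<eta>) * (1 + ln (D L)) < \<epsilon>0 / 4 \<and>
     2 * (C2 * (2 * L powr (1 - \<epsilon>))) ^ 9 / 2 powr (L powr (\<epsilon> / 2)) < \<epsilon>0 / 4 \<and>
     9 * exp (18 * L powr (1 - \<epsilon> / 2)) < \<epsilon>0 / 4 * exp L \<and> 6 \<le> L powr (\<epsilon> / 2) \<and>
     measure log_random_space (equal_sums_event k c (D L)) > 1 - \<epsilon>0 / 4) \<and> L \<ge> 1) at_top"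
    by (intro eventually_conj ev1 ev2 ev3 ev4 ev5 ev6 eventually_ge_at_top)
  from eventually_compose_filterlim[OF this limL] eventually_gt_at_top[of 0]
  show "eventually (\<lambda>N. real (card {n\<in>{1..N}. has_close_divisors k \<alpha> n}) \<ge> (1 - \<epsilon>0) * real N) sequentially"
  proof eventually_elim
    case (elim N)
    define L where "L = ln (real N)"
    have E: "max a0 C \<le> L powr \<eta>" "(2 / D L powr c + C / L powr \<eta>) * (1 + ln (D L)) < \<epsilon>0 / 4"
     "2 * (C2 * (2 * L powr (1 - \<epsilon>))) ^ 9 / 2 powr (L powr (\<epsilon> / 2)) < \<epsilon>0 / 4"
     "9 * exp (18 * L powr (1 - \<epsilon> / 2)) < \<epsilon>0 / 4 * exp L" "6 \<le> L powr (\<epsilon> / 2)"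
     "measure log_random_space (equal_sums_event k c (D L)) > 1 - \<epsilon>0 / 4" "L \<ge> 1"
      using elim by (simp_all only: L_def)
    have N: "real N = exp L" "N > 0" using elim by (auto simp: L_def)
    define \<delta> where "\<delta> = L powr (- (\<alpha> + \<epsilon>))"
    define y where "y = L powr (\<epsilon> / 2)"
    \<comment> \<open>Odd, as the sieve demands, and between y and 3y.\<close>
    define r where "r = 2 * nat \<lfloor>y\<rfloor> + 1"
    define M where "M = 2 * L powr (1 - \<epsilon>)"
    have L0: "L > 0" using E by simp
    have ydef: "y \<ge> 6" using E by (simp add: y_def)
    have \<delta>: "0 < \<delta>" "\<delta> \<le> 1"
      using L0 E(7) \<alpha> \<epsilon> powr_mono[of "- (\<alpha> + \<epsilon>)" 0 L] by (auto simp: \<delta>_def)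
    have r: "odd r" "real r \<ge> y" "real r \<le> 3 * y"
    proof -
      have "real (nat \<lfloor>y\<rfloor>) = of_int \<lfloor>y\<rfloor>" using ydef by simp
      then have *: "real (nat \<lfloor>y\<rfloor>) \<le> y" "real (nat \<lfloor>y\<rfloor>) \<ge> y - 1" by linarith+
      moreover have "real r = 2 * real (nat \<lfloor>y\<rfloor>) + 1"
        by (simp only: r_def of_nat_add of_nat_mult of_nat_numeral of_nat_1)
      ultimately show "real r \<ge> y" "real r \<le> 3 * y" using ydef by linarith+
    qed (simp add: r_def)
    have L1e: "L powr (1 - \<epsilon>) \<ge> 1" using E(7) \<epsilon>1 by (intro ge_one_powr_ge_zero) auto
    have M1: "M \<ge> 1" using L1e by (simp add: M_def)
    have Dc: "D L powr c * \<delta> = L powr \<eta>"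
      by (simp add: D_def \<delta>_def powr_powr \<eta>_def algebra_simps flip: powr_add)
    have D1: "D L \<ge> 1" using E(7) \<alpha> unfolding D_def by (intro ge_one_powr_ge_zero) auto
    have DM: "(D L + 1) * \<delta> \<le> M"
    proof -
      have "D L * \<delta> = L powr (1 - \<epsilon>)" by (simp add: D_def \<delta>_def algebra_simps flip: powr_add)
      then show ?thesis using L1e \<delta> by (simp add: M_def distrib_right)
    qed
    have count: "real (card {n\<in>{1..N}. has_close_divisors k \<alpha> n}) \<ge>
       real N * (measure log_random_space (equal_sums_event k c (D L))
        - (2 / D L powr c + C / L powr \<eta>) * (1 + ln (D L)) - 2 * exp (3 * (3 * ln (C2 * M))) / 2 ^ r) - 9 * (exp M + 1) ^ (2 * r)"
    proof (rule close_divisors_count[OF k \<delta>(1) r(1) D1 C(1)])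
      fix i assume i: "i \<in> log_window c (D L)"
      have "D L powr c * \<delta> \<le> (real i + 1/2) * \<delta>" using i \<delta> by (intro mult_right_mono) (auto simp: log_window_def)
      then have ai: "(real i + 1/2) * \<delta> \<ge> L powr \<eta>" by (simp add: Dc)
      have "((real i + 1/2) * \<delta>) powr (- B) \<le> (L powr \<eta>) powr (- B)"
        using ai B L0 by (intro powr_mono2') auto
      also have "\<dots> = \<delta>" using \<eta> by (simp add: powr_powr B_def \<delta>_def)
      finally show "\<delta> * (1 - C / ((real i + 1/2) * \<delta>)) \<le> (\<Sum>p\<in>log_block \<delta> i. ln (real p) / real p)"
        unfolding log_block_def using ai E(1) \<delta> by (intro C(3)) auto
    next
      show "L powr \<eta> > 0" "C \<le> L powr \<eta>" "L powr \<eta> \<le> D L powr c * \<delta>" using L0 E(1) Dc by auto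
      show "(D L + 1) * \<delta> \<le> M" by (rule DM)
      show "(\<Sum>p\<in>S. 1 / real p) \<le> 3 * ln (C2 * M)" if "finite S" "\<And>p. p \<in> S \<Longrightarrow> prime p \<and> ln (real p) \<le> M" for S
        using that by (intro C2(2) M1)
      fix n :: nat assume n: "2 \<le> n" "n \<le> N"
      \<comment> \<open>Since \<delta> y^2 = L^(-\<alpha>), this is at most 3 L^(-\<alpha>) / y;
        with y \<ge> 6 it is half of the tolerance, and the factor 2 is consumed by exp x \<le> 1 +
        2x.\<close>
      have "\<delta> * real r \<le> \<delta> * (3 * y)" using r \<delta> by (intro mult_left_mono) auto
      also have "\<dots> = 3 * L powr (- \<alpha>) * (L powr (- \<epsilon>) * y)" by (simp add: \<delta>_def powr_add[symmetric] algebra_simps)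
      also have "L powr (- \<epsilon>) * y = 1 / y" using L0 by (simp add: y_def powr_minus_divide flip: powr_add powr_diff)
      also have "3 * L powr (- \<alpha>) * (1 / y) \<le> 3 * L powr (- \<alpha>) * (1 / 6)"
        using ydef by (intro mult_left_mono divide_left_mono) auto
      finally have dr: "\<delta> * real r \<le> L powr (- \<alpha>) / 2" by simp
      have "L powr (- \<alpha>) \<le> 1" using E(7) \<alpha> powr_mono[of "- \<alpha>" 0 L] by simp
      then have "exp (\<delta> * real r) \<le> 1 + 2 * (\<delta> * real r)" using dr \<delta> by (intro exp_le_one_plus_twice) auto
      also have "\<dots> \<le> 1 + L powr (- \<alpha>)" using dr by simp
      \<comment> \<open>As \<alpha> > 0, the tolerance at n \<le> N is no smaller than at N, so one
        \<delta> serves all n up to N.\<close>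
      also have "L powr (- \<alpha>) \<le> ln (real n) powr (- \<alpha>)"
        unfolding L_def using n \<alpha> by (intro powr_mono2') auto
      finally show "exp (\<delta> * real r) \<le> 1 + ln (real n) powr (- \<alpha>)" by simp
    qed
    have F1: "2 * exp (3 * (3 * ln (C2 * M))) / 2 ^ r \<le> \<epsilon>0 / 4"
    proof -
      have pos: "C2 * M > 0" using C2 M1 by (intro mult_pos_pos) auto
      have "exp (3 * (3 * ln (C2 * M))) = exp (ln (C2 * M)) ^ 9" by (simp flip: exp_of_nat_mult)
      also have "\<dots> = (C2 * M) ^ 9" using pos by simp
      finally have e9: "exp (3 * (3 * ln (C2 * M))) = (C2 * M) ^ 9" .
      have "2 powr y \<le> 2 powr real r" using r by (intro powr_mono) auto
      then have "2 powr y \<le> 2 ^ r" by (simp add: powr_realpow)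
      then have "2 * (C2 * M) ^ 9 / 2 ^ r \<le> 2 * (C2 * M) ^ 9 / 2 powr y"
        using pos by (intro divide_left_mono) auto
      then show ?thesis unfolding e9 using E(3) by (simp add: M_def y_def)
    qed
    have F2: "9 * (exp M + 1) ^ (2 * r) \<le> \<epsilon>0 / 4 * real N"
    proof -
      have "exp M + 1 \<le> exp (M + 1)"
      proof -
        have "exp M * 2 \<le> exp M * exp 1" using exp_ge_add_one_self[of 1] by (intro mult_left_mono) auto
        moreover have "exp M \<ge> 1" using M1 by simp
        ultimately show ?thesis unfolding exp_add by linarith
      qed
      then have "(exp M + 1) ^ (2 * r) \<le> exp (M + 1) ^ (2 * r)" by (intro power_mono) auto
      also have "\<dots> = exp (real (2 * r) * (M + 1))" by (rule exp_of_nat_mult[symmetric])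
      also have "\<dots> \<le> exp (18 * L powr (1 - \<epsilon> / 2))"
      proof -
        have "real (2 * r) * (M + 1) \<le> (6 * y) * (3 * L powr (1 - \<epsilon>))"
          using r L1e ydef M1 by (intro mult_mono) (auto simp: M_def)
        also have "\<dots> = 18 * (L powr (\<epsilon> / 2) * L powr (1 - \<epsilon>))" by (simp add: y_def)
        also have "L powr (\<epsilon> / 2) * L powr (1 - \<epsilon>) = L powr (1 - \<epsilon> / 2)" by (simp flip: powr_add)
        finally show ?thesis by simp
      qed
      finally show ?thesis unfolding N(1) using E(4) by linarith
    qed
    have "real N * (1 - 3 * \<epsilon>0 / 4) \<le> real N * (measure log_random_space (equal_sums_event k c (D L))
        - (2 / D L powr c + C / L powr \<eta>) * (1 + ln (D L)) - 2 * exp (3 * (3 * ln (C2 * M))) / 2 ^ r)"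
      using F1 E(2,6) by (intro mult_left_mono) auto
    then have "real N * (1 - 3 * \<epsilon>0 / 4) - \<epsilon>0 / 4 * real N \<le> real (card {n\<in>{1..N}. has_close_divisors k \<alpha> n})"
      using count F2 by linarith
    then show ?case by (simp add: algebra_simps)
  qed
qed

theorem theorem6:
  fixes k :: nat
  assumes "k \<ge> 2"
  shows "alpha k \<ge> beta k / (1 - beta k)"
proof -
  define A where "A = {c::real. c < 1 \<and> ((\<lambda>D::real. measure log_random_space (equal_sums_event k c D)) \<longlongrightarrow> 1) at_top}"
  have beta: "beta k = (SUP c\<in>A. ereal c)" by (simp add: beta_def A_def)
  have alphaI: "ereal \<alpha> \<le> alpha k" if "almost_every (has_close_divisors k \<alpha>)" for \<alpha>
    unfolding alpha_def using that by (intro SUP_upper) auto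
  \<comment> \<open>Settles \<open>beta k\<close> \<le> 0, where the quotient is at most 0.\<close>
  have alpha0: "alpha k \<ge> 0"
  proof (rule dense_le)
    fix x :: ereal assume "x < 0"
    then consider "x = - \<infinity>" | y where "x = ereal y" "y < 0" by (cases x) auto
    then show "x \<le> alpha k"
      using alphaI almost_every_close_divisors_neg[of k] assms by cases auto
  qed
  have alphac: "ereal (c / (1 - c)) \<le> alpha k" if c: "c \<in> A" "0 < c" for c
  proof (rule dense_le)
    fix x assume x: "x < ereal (c / (1 - c))"
    show "x \<le> alpha k"
    proof (cases "x \<le> 0")
      case True
      then show ?thesis using alpha0 by simp
    next
      case False
      then obtain \<alpha> where \<alpha>: "x = ereal \<alpha>" "0 < \<alpha>" "\<alpha> < c / (1 - c)" using x by (cases x) auto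
      have "almost_every (has_close_divisors k \<alpha>)"
        using c \<alpha> assms by (intro almost_every_close_divisors[of k c]) (auto simp: A_def)
      then show ?thesis using alphaI \<alpha> by simp
    qed
  qed
  have le1: "beta k \<le> 1" unfolding beta by (intro SUP_least) (auto simp: A_def)
  show ?thesis
  proof (cases "beta k \<le> 0")
    case True
    then show ?thesis
    proof (cases "beta k")
      case (real b)
      then have "beta k / (1 - beta k) = ereal (b / (1 - b))" using True by (simp add: one_ereal_def)
      also have "\<dots> \<le> 0" using True real by (simp add: divide_nonpos_pos)
      finally show ?thesis using alpha0 by simp
    qed (use alpha0 in auto)
  next
    case False
    have "\<exists>c\<in>A. ereal y < ereal c" if "ereal y < beta k" for y
      using that unfolding beta by (simp add: less_SUP_iff)
    then have approx: "\<exists>c\<in>A. y < c" if "ereal y < beta k" for y using that by auto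
    obtain b where b: "beta k = ereal b" "0 < b" "b \<le> 1" using False le1 by (cases "beta k") (auto simp: one_ereal_def)
    show ?thesis
    proof (rule dense_le)
      fix x assume x: "x < beta k / (1 - beta k)"
      show "x \<le> alpha k"
      proof (cases "x \<le> 0")
        case True
        then show ?thesis using alpha0 by simp
      next
        case pos: False
        then obtain z where z: "x = ereal z" "0 < z" using x by (cases x) auto
        \<comment> \<open>The map z / (1 + z) inverts b / (1 - b). For b = 1 the extended quotient
          is infinite, and z / (1 + z) < 1 holds for every z > 0.\<close>
        have zb: "z / (1 + z) < b"
        proof (cases "b = 1")
          case False
          then have "z < b / (1 - b)" using x b z by (simp add: one_ereal_def)
          then show ?thesis using b False z by (simp add: field_simps)
        qed (use z in simp)
        then obtain c where c: "c \<in> A" "z / (1 + z) < c" using approx[of "z / (1 + z)"] b by auto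
        have "0 < z / (1 + z)" using z by simp
        then have c0: "0 < c" using c by linarith
        have "c < 1" using c by (simp add: A_def)
        then have "z \<le> c / (1 - c)" using c z by (simp add: field_simps)
        then have "x \<le> ereal (c / (1 - c))" using z by simp
        then show ?thesis using alphac[OF c(1) c0] by (rule order_trans)
      qed
    qed
  qed
qed

end
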